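(* Let $\mathbb{E}=(\mathbb{E}_\alpha)_{\alpha>\alpha_*}$ be a scale of Banach spaces with dual scale $\mathbb{B}=(\mathbb{B}_\alpha)_{\alpha>\alpha_*}$, $\mathbb{B}_\alpha=\mathbb{E}_\alpha^*$. Let $(A(t))_{t\ge0}\subset L(\mathbb{E})$ satisfy (A1) and let $(B(t))_{t\ge0}\subset L(\mathbb{E})$ satisfy (B1) and (B2). Let $\mathcal{Y}\subset\bigcap_{\beta>\alpha_*}\mathbb{E}_\beta$ be dense in $\mathbb{E}_\beta$ for every $\beta>\alpha_*$. Fix $\alpha'<\alpha$ and $\ell\in\mathbb{B}_{\alpha'}$. (Conditions, the families $W$, and $T(\alpha',\alpha)=\frac{\alpha-\alpha'}{2KeM(\alpha)}$ are defined in the context.) Then: (a) Let $t>0$, $T\in(0,t]$, and suppose that $(V(t,s))_{t\ge s\ge0}$ satisfies (A2), (A3), (A4); let $W(t,s)$ be the perturbed forward family associated with $V,B$. Let $(\ell(s))_{t-T\le s\le t}\subset\mathbb{B}_\alpha$ be such that $[t-T,t]\ni s\mapsto\langle k,\ell(s)\rangle$ is continuous for any $k\in\mathbb{E}_\alpha$ and, for any $k\in\mathcal{Y}$ and all $\alpha''>\alpha$, $$\langle k,\ell(s)\rangle=\langle k,\ell\rangle+\int_s^t\langle(A(r)+B(r))_{\alpha''\alpha}k,\ell(r)\rangle\,dr,\qquad s\in[t-T,t].$$ Then $$\ell(s)=W_{\alpha'\alpha}(t,s)^*\ell\qquad\text{for all } s\text{ with } t-\min\{T,T(\alpha',\alpha)\}<s\le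 t.$$ Moreover, for all $k\in\mathbb{E}_\alpha$ and $\alpha''\in(\alpha',\alpha)$, the function $$(t-\min\{T(\alpha',\alpha),T(\alpha',\alpha'')\},t]\cap[0,\infty)\ni s\mapsto\langle k,W_{\alpha'\alpha}(t,s)^*\ell\rangle$$ is continuously differentiable with $$\frac{d}{ds}\langle k,W_{\alpha'\alpha}(t,s)^*\ell\rangle=-\langle(A_{\alpha\alpha''}(s)+B_{\alpha\alpha''}(s))k,W_{\alpha'\alpha''}(t,s)^*\ell\rangle.$$ (b) Let $s\ge0$, $T>0$, and suppose that $(V(s,t))_{t\ge s\ge0}$ satisfies (A2)$^*$, (A3)$^*$, (A4)$^*$; let $W(s,t)$ be the perturbed backward family associated with $V,B$. Let $(\ell(t))_{t\in[s,s+T]}\subset\mathbb{B}_\alpha$ be such that $[s,s+T]\ni t\mapsto\langle k,\ell(t)\rangle$ is continuous for any $k\in\mathbb{E}_\alpha$ and, for any $k\in\mathcal{Y}$ and all $\alpha''>\alpha$, $$\langle k,\ell(t)\rangle=\langle k,\ell\rangle+\int_s^t\langle(A(r)+B(r))_{\alpha''\alpha}k,\ell(r)\rangle\,dr,\qquad t\in[s,s+T].$$ Then $$\ell(t)=W_{\alpha'\alpha}(s,t)^*\ell\qquad\text{for all } t\text{ with } s\le t<s+\min\{T,T(\alpha',\alpha)\}.$$ Moreover, for all $k\in\mathbb{E}_\alpha$ and $\alpha''\in(\alpha',\alpha)$, the function $$[s,s+\min\{T(\alpha',\alpha),T(\alpha',\alpha'')\})\ni t\mapsto\langle k,W_{\alpha'\alpha}(s,t)^*\ell\rangle$$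 is continuously differentiable with $$\frac{d}{dt}\langle k,W_{\alpha'\alpha}(s,t)^*\ell\rangle=\langle(A_{\alpha\alpha''}(t)+B_{\alpha\alpha''}(t))k,W_{\alpha'\alpha''}(s,t)^*\ell\rangle.$$
   Context: Scale of Banach spaces: $\alpha_*\in\mathbb{R}$ is fixed and $\mathbb{E}=(\mathbb{E}_\alpha)_{\alpha>\alpha_*}$ is a family of Banach spaces with $\mathbb{E}_\alpha\subset\mathbb{E}_{\alpha'}$ and $\|\cdot\|_{\alpha'}\le\|\cdot\|_\alpha$ for $\alpha'<\alpha$. Writing $\alpha'<\alpha$ always includes $\alpha'>\alpha_*$. $i_{\alpha\alpha'}\in L(\mathbb{E}_\alpha,\mathbb{E}_{\alpha'})$ denotes the embedding; $\|\cdot\|_{\alpha\alpha'}$ is the operator norm on $L(\mathbb{E}_\alpha,\mathbb{E}_{\alpha'})$. $L(\mathbb{E})$ is the set of collections $A=(A_{\alpha\alpha'})_{\alpha'<\alpha}$, $A_{\alpha\alpha'}\in L(\mathbb{E}_\alpha,\mathbb{E}_{\alpha'})$, with $A_{\alpha''\alpha'}=i_{\alpha\alpha'}A_{\alpha''\alpha}=A_{\alpha\alpha'}i_{\alpha''\alpha}$ for all $\alpha'<\alpha<\alpha''$. Composition in $L(\mathbb{E})$: $(AB)_{\alpha\alpha'}:=A_{\beta\alpha'}B_{\alpha\beta}$ for any $\beta\in(\alpha',\alpha)$ (independent of $\beta$). Dual scale: $\mathbb{B}_\alpha:=\mathbb{E}_\alpha^*$. For $\alpha'<\alpha$, $\mathbb{B}_{\alpha'}$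 is mapped into $\mathbb{B}_\alpha$ by restriction $\ell\mapsto\ell|_{\mathbb{E}_\alpha}$. $\langle k,\ell\rangle:=\ell(k)$ is the dual pairing of $k\in\mathbb{E}_\alpha$, $\ell\in\mathbb{B}_\alpha$. For an operator $Q_{\alpha\alpha'}\in L(\mathbb{E}_\alpha,\mathbb{E}_{\alpha'})$, $\alpha'<\alpha$, its adjoint is denoted $Q^*_{\alpha'\alpha}\in L(\mathbb{B}_{\alpha'},\mathbb{B}_\alpha)$: $(Q^*_{\alpha'\alpha}\ell)(k)=\ell(Q_{\alpha\alpha'}k)$. Thus $W_{\alpha'\alpha}(t,s)^*$ is the adjoint of $W_{\alpha\alpha'}(t,s)$. (A1) For all $\alpha'<\alpha$, $t\mapsto A_{\alpha\alpha'}(t)\in L(\mathbb{E}_\alpha,\mathbb{E}_{\alpha'})$ is continuous in the operator norm on $[0,\infty)$. (A2) $V(t,s)\in L(\mathbb{E})$ for all $t\ge s\ge0$, $V_{\alpha\alpha'}(t,t)=i_{\alpha\alpha'}$, and for any $\alpha'<\alpha$, $k\in\mathbb{E}_\alpha$ the map $(t,s)\mapsto V_{\alpha\alpha'}(t,s)k$ is continuous in $\mathbb{E}_{\alpha'}$. (A3) For any $\alpha'<\alpha''<\alpha$, $k\in\mathbb{E}_\alpha$, $0\le s\le t$: $V_{\alpha\alpha'}(t,s)k=k+\int_s^tA_{\alpha''\alpha'}(r)V_{\alpha\alpha''}(r,s)k\,dr$ and $V_{\alpha\alpha'}(t,s)k=k+\int_s^tV_{\alpha''\alpha'}(t,r)A_{\alpha\alpha''}(r)k\,dr$,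 where the integrals exist in $\mathbb{E}_{\alpha'}$. (A4) There is $K\ge1$ with $\|V_{\alpha\alpha'}(t,s)\|_{\alpha\alpha'}\le K$ for all $0\le s\le t$, $\alpha'<\alpha$. (A2)$^*$ $V(s,t)\in L(\mathbb{E})$ for all $t\ge s\ge0$, $V_{\alpha\alpha'}(t,t)=i_{\alpha\alpha'}$, and for any $\alpha'<\alpha$, $k\in\mathbb{E}_\alpha$ the map $(s,t)\mapsto V_{\alpha\alpha'}(s,t)k$ is continuous in $\mathbb{E}_{\alpha'}$. (A3)$^*$ For any $\alpha'<\alpha''<\alpha$, $k\in\mathbb{E}_\alpha$, $0\le s\le t$: $V_{\alpha\alpha'}(s,t)k=k+\int_s^tV_{\alpha''\alpha'}(s,r)A_{\alpha\alpha''}(r)k\,dr$ and $V_{\alpha\alpha'}(s,t)k=k+\int_s^tA_{\alpha''\alpha'}(r)V_{\alpha\alpha''}(r,t)k\,dr$, where the integrals exist in $\mathbb{E}_{\alpha'}$. (A4)$^*$ There is $K\ge1$ with $\|V_{\alpha\alpha'}(s,t)\|_{\alpha\alpha'}\le K$ for all $0\le s\le t$, $\alpha'<\alpha$. (B1) For all $\alpha'<\alpha$ and $k\in\mathbb{E}_\alpha$, $t\mapsto B_{\alpha\alpha'}(t)k\in\mathbb{E}_{\alpha'}$ is continuous on $[0,\infty)$. (B2) There is an increasing continuous function $M:(\alpha_*,\infty)\to[0,\infty)$ with $\|B_{\alpha\alpha'}(t)\|_{\alpha\alpha'}\le\frac{M(\alpha)}{\alpha-\alpha'}$ for all $t\ge0$,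 $\alpha'<\alpha$. Put $T(\alpha',\alpha):=\frac{\alpha-\alpha'}{2KeM(\alpha)}$ with $1/0:=+\infty$ ($K$ from (A4), resp. (A4)$^*$). Perturbed forward family: $\{W_{\alpha\alpha'}(t,s)\in L(\mathbb{E}_\alpha,\mathbb{E}_{\alpha'}):\alpha'<\alpha,\ 0\le s\le t,\ t-s<T(\alpha',\alpha)\}$ with the following properties (under (A2), (A4), (B1), (B2) it exists and is unique): (i) $(t,s)\mapsto W_{\alpha\alpha'}(t,s)$ is strongly continuous, $W_{\alpha\alpha'}(t,t)=i_{\alpha\alpha'}$, $\|W_{\alpha\alpha'}(t,s)\|_{\alpha\alpha'}\le\frac{T(\alpha',\alpha)}{T(\alpha',\alpha)-(t-s)}K$; (ii) for $\alpha'<\alpha''<\alpha$, $W_{\alpha\alpha'}(t,s)=i_{\alpha''\alpha'}W_{\alpha\alpha''}(t,s)$ if $t-s<\min\{T(\alpha',\alpha),T(\alpha'',\alpha)\}$ and $W_{\alpha\alpha'}(t,s)=W_{\alpha''\alpha'}(t,s)i_{\alpha\alpha''}$ if $t-s<\min\{T(\alpha',\alpha),T(\alpha',\alpha'')\}$; (iii) $W_{\alpha\alpha'}(t,s)k=V_{\alpha\alpha'}(t,s)k+\int_s^t(V(t,r)B(r))_{\alpha''\alpha'}W_{\alpha\alpha''}(r,s)k\,dr$ for $k\in\mathbb{E}_\alpha$, $\alpha'<\alpha''<\alpha$, $t-s<\min\{T(\alpha',\alpha),T(\alpha'',\alpha)\}$; (iv) $W_{\alpha\alpha'}(t,s)k=V_{\alpha\alpha'}(t,s)k+\int_s^tW_{\alpha''\alpha'}(t,r)(B(r)V(r,s))_{\alpha\alpha''}k\,dr$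 for $k\in\mathbb{E}_\alpha$, $\alpha'<\alpha''<\alpha$, $t-s<\min\{T(\alpha',\alpha),T(\alpha',\alpha'')\}$. Perturbed backward family: $\{W_{\alpha\alpha'}(s,t)\in L(\mathbb{E}_\alpha,\mathbb{E}_{\alpha'}):\alpha'<\alpha,\ 0\le s\le t,\ t-s<T(\alpha',\alpha)\}$ with the following properties (under (A2)$^*$, (A4)$^*$, (B1), (B2) it exists and is unique): (i)$^*$ and (ii)$^*$, which are (i) and (ii) with $(t,s)$ replaced by $(s,t)$ as arguments of $W$; (iii)$^*$ $W_{\alpha\alpha'}(s,t)k=V_{\alpha\alpha'}(s,t)k+\int_s^tW_{\alpha''\alpha'}(s,r)(B(r)V(r,t))_{\alpha\alpha''}k\,dr$ for $k\in\mathbb{E}_\alpha$, $\alpha'<\alpha''<\alpha$, $t-s<\min\{T(\alpha',\alpha),T(\alpha',\alpha'')\}$; (iv)$^*$ $W_{\alpha\alpha'}(s,t)k=V_{\alpha\alpha'}(s,t)k+\int_s^t(V(s,r)B(r))_{\alpha''\alpha'}W_{\alpha\alpha''}(r,t)k\,dr$ for $k\in\mathbb{E}_\alpha$, $\alpha'<\alpha''<\alpha$, $t-s<\min\{T(\alpha',\alpha),T(\alpha'',\alpha)\}$. *)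

theory Defs
  imports "HOL-Analysis.Analysis"
begin

section \<open>Scales of Banach spaces\<close>

text \<open>
  Since the spaces are nested, they are carriers \<open>spc X \<alpha>\<close> inside one vector space \<open>'a\<close>
  (for instance their union), each with its own norm \<open>nrm X \<alpha>\<close>.  No norm or topology on \<open>'a\<close>
  is involved, and the values of \<open>nrm X \<alpha>\<close> outside \<open>spc X \<alpha>\<close> are irrelevant.  The scalars
  are any complete normed field over the reals; by Gelfand--Mazur this means the real or
  the complex numbers.  The spaces are indexed by \<open>\<alpha> > low X\<close>.  The embeddings \<open>i\<close> are
  the identity on elements.
\<close>

record ('k, 'a) scale_data =
  smult :: "'k \<Rightarrow> 'a \<Rightarrow> 'a"
  low :: real
  spc :: "real \<Rightarrow> 'a set"
  nrm :: "real \<Rightarrow> 'a \<Rightarrow> real"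

text \<open>
  The locale \<open>Metric_space\<close> asks for nonnegativity and symmetry on the whole type, hence
  the value 0 off the carrier.
\<close>

definition sdist :: "('k, 'a::ab_group_add) scale_data \<Rightarrow> real \<Rightarrow> 'a \<Rightarrow> 'a \<Rightarrow> real" where
  "sdist X \<alpha> x y = (if x \<in> spc X \<alpha> \<and> y \<in> spc X \<alpha> then nrm X \<alpha> (x - y) else 0)"

definition stop :: "('k, 'a::ab_group_add) scale_data \<Rightarrow> real \<Rightarrow> 'a topology" where
  "stop X \<alpha> = Metric_space.mtopology (spc X \<alpha>) (sdist X \<alpha>)"

definition banach_space ::
    "('k::{real_normed_field,banach}, 'a::ab_group_add) scale_data \<Rightarrow> real \<Rightarrow> bool" where
  "banach_space X \<alpha> \<longleftrightarrow>
     module.subspace (smult X) (spc X \<alpha>) \<and>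
     (\<forall>x\<in>spc X \<alpha>. 0 \<le> nrm X \<alpha> x \<and> (nrm X \<alpha> x = 0 \<longleftrightarrow> x = 0)) \<and>
     (\<forall>x\<in>spc X \<alpha>. \<forall>y\<in>spc X \<alpha>. nrm X \<alpha> (x + y) \<le> nrm X \<alpha> x + nrm X \<alpha> y) \<and>
     (\<forall>c. \<forall>x\<in>spc X \<alpha>. nrm X \<alpha> (smult X c x) = norm c * nrm X \<alpha> x) \<and>
     Metric_space.mcomplete (spc X \<alpha>) (sdist X \<alpha>)"

definition banach_scale ::
    "('k::{real_normed_field,banach}, 'a::ab_group_add) scale_data \<Rightarrow> bool" where
  "banach_scale X \<longleftrightarrow>
     vector_space (smult X) \<and>
     (\<forall>\<alpha>>low X. banach_space X \<alpha>) \<and>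
     (\<forall>\<alpha>' \<alpha>. low X < \<alpha>' \<and> \<alpha>' < \<alpha> \<longrightarrow>
        spc X \<alpha> \<subseteq> spc X \<alpha>' \<and> (\<forall>x\<in>spc X \<alpha>. nrm X \<alpha>' x \<le> nrm X \<alpha> x))"

lemma Metric_space_sdist:
  fixes X :: "('k::{real_normed_field,banach}, 'a::ab_group_add) scale_data"
  assumes "banach_scale X" "low X < \<alpha>"
  shows "Metric_space (spc X \<alpha>) (sdist X \<alpha>)"
proof -
  interpret vector_space "smult X" using assms by (simp add: banach_scale_def)
  have B: "banach_space X \<alpha>" using assms by (simp add: banach_scale_def)
  have nonneg: "0 \<le> nrm X \<alpha> x" and zero: "nrm X \<alpha> x = 0 \<longleftrightarrow> x = 0" if "x \<in> spc X \<alpha>" for x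
    using B that by (simp_all add: banach_space_def)
  have add: "nrm X \<alpha> (x + y) \<le> nrm X \<alpha> x + nrm X \<alpha> y" if "x \<in> spc X \<alpha>" "y \<in> spc X \<alpha>" for x y
    using B that by (simp add: banach_space_def)
  have sub: "subspace (spc X \<alpha>)" using B by (simp add: banach_space_def)
  have minus: "x - y \<in> spc X \<alpha>" if "x \<in> spc X \<alpha>" "y \<in> spc X \<alpha>" for x y
    using subspace_diff[OF sub that] .
  have comm: "nrm X \<alpha> (x - y) = nrm X \<alpha> (y - x)" if "x \<in> spc X \<alpha>" "y \<in> spc X \<alpha>" for x y
  proof -
    have "nrm X \<alpha> (smult X (- 1) (x - y)) = norm (- 1 :: 'k) * nrm X \<alpha> (x - y)"
      using B minus[OF that] unfolding banach_space_def by blast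
    then show ?thesis by simp
  qed
  have tri: "nrm X \<alpha> (x - z) \<le> nrm X \<alpha> (x - y) + nrm X \<alpha> (y - z)"
    if "x \<in> spc X \<alpha>" "y \<in> spc X \<alpha>" "z \<in> spc X \<alpha>" for x y z
  proof -
    show ?thesis using add[of "x - y" "y - z"] minus that by simp
  qed
  show ?thesis
  proof (rule Metric_space.intro)
    show "0 \<le> sdist X \<alpha> x y" for x y
      by (simp add: sdist_def nonneg minus)
    show "sdist X \<alpha> x y = sdist X \<alpha> y x" for x y
      using comm[of x y] by (simp add: sdist_def)
    show "sdist X \<alpha> x y = 0 \<longleftrightarrow> x = y" if "x \<in> spc X \<alpha>" "y \<in> spc X \<alpha>" for x y
      using that by (simp add: sdist_def zero minus)
    show "sdist X \<alpha> x z \<le> sdist X \<alpha> x y + sdist X \<alpha> y z"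
      if "x \<in> spc X \<alpha>" "y \<in> spc X \<alpha>" "z \<in> spc X \<alpha>" for x y z
      using that tri[OF that] by (simp add: sdist_def)
  qed
qed


section \<open>Operators, the class \<open>L(E)\<close>, continuity and integrals\<close>

text \<open>
  Operators between the carriers are total functions of which only the restriction to the
  source carrier matters.  A collection \<open>A\<close> has \<open>A \<alpha> \<alpha>'\<close> mapping \<open>spc X \<alpha>\<close> to \<open>spc X \<alpha>'\<close>.
\<close>

definition bounded_op ::
    "('k::{real_normed_field,banach}, 'a::ab_group_add) scale_data \<Rightarrow> real \<Rightarrow> real \<Rightarrow> ('a \<Rightarrow> 'a) \<Rightarrow> bool"
  where
  "bounded_op X \<alpha> \<alpha>' F \<longleftrightarrow>
     (\<forall>x\<in>spc X \<alpha>. F x \<in> spc X \<alpha>') \<and>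
     (\<forall>x\<in>spc X \<alpha>. \<forall>y\<in>spc X \<alpha>. F (x + y) = F x + F y) \<and>
     (\<forall>c. \<forall>x\<in>spc X \<alpha>. F (smult X c x) = smult X c (F x)) \<and>
     (\<exists>C. \<forall>x\<in>spc X \<alpha>. nrm X \<alpha>' (F x) \<le> C * nrm X \<alpha> x)"

definition op_norm :: "('k, 'a) scale_data \<Rightarrow> real \<Rightarrow> real \<Rightarrow> ('a \<Rightarrow> 'a) \<Rightarrow> real" where
  "op_norm X \<alpha> \<alpha>' F = (SUP x\<in>spc X \<alpha>. nrm X \<alpha>' (F x) / nrm X \<alpha> x)"

definition scale_ops ::
    "('k::{real_normed_field,banach}, 'a::ab_group_add) scale_data \<Rightarrow> (real \<Rightarrow> real \<Rightarrow> 'a \<Rightarrow> 'a) set"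
  where
  "scale_ops X = {A.
     (\<forall>\<alpha>' \<alpha>. low X < \<alpha>' \<and> \<alpha>' < \<alpha> \<longrightarrow> bounded_op X \<alpha> \<alpha>' (A \<alpha> \<alpha>')) \<and>
     (\<forall>\<alpha>' \<alpha> \<alpha>''. low X < \<alpha>' \<and> \<alpha>' < \<alpha> \<and> \<alpha> < \<alpha>'' \<longrightarrow>
        (\<forall>x\<in>spc X \<alpha>''. A \<alpha>'' \<alpha>' x = A \<alpha>'' \<alpha> x \<and> A \<alpha>'' \<alpha>' x = A \<alpha> \<alpha>' x))}"

text \<open>
  Composition in \<open>L(E)\<close> through the midpoint; by the following lemma any intermediate
  index gives the same operator.
\<close>

definition scale_comp ::
    "(real \<Rightarrow> real \<Rightarrow> 'a \<Rightarrow> 'a) \<Rightarrow> (real \<Rightarrow> real \<Rightarrow> 'a \<Rightarrow> 'a) \<Rightarrow> real \<Rightarrow> real \<Rightarrow> 'a \<Rightarrow> 'a" where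
  "scale_comp A B \<alpha> \<alpha>' k = A ((\<alpha> + \<alpha>') / 2) \<alpha>' (B \<alpha> ((\<alpha> + \<alpha>') / 2) k)"

lemma scale_comp_eq:
  assumes A: "A \<in> scale_ops X" and B: "B \<in> scale_ops X"
    and "low X < \<alpha>'" "\<alpha>' < \<beta>" "\<beta> < \<alpha>" and k: "k \<in> spc X \<alpha>"
  shows "scale_comp A B \<alpha> \<alpha>' k = A \<beta> \<alpha>' (B \<alpha> \<beta> k)"
proof -
  have *: "A \<beta> \<alpha>' (B \<alpha> \<beta> k) = A \<gamma> \<alpha>' (B \<alpha> \<gamma> k)"
    if "\<alpha>' < \<beta>" "\<beta> < \<gamma>" "\<gamma> < \<alpha>" for \<beta> \<gamma>
  proof -
    have low: "low X < \<beta>" "low X < \<gamma>" using that \<open>low X < \<alpha>'\<close> by linarith+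
    have "B \<alpha> \<beta> k = B \<alpha> \<gamma> k" "B \<alpha> \<gamma> k \<in> spc X \<gamma>"
      using B k that low unfolding scale_ops_def bounded_op_def by blast+
    moreover have "\<forall>x\<in>spc X \<gamma>. A \<gamma> \<alpha>' x = A \<beta> \<alpha>' x"
      using A that \<open>low X < \<alpha>'\<close> unfolding scale_ops_def by blast
    ultimately show ?thesis by simp
  qed
  define \<mu> where "\<mu> = (\<alpha> + \<alpha>') / 2"
  have \<mu>: "\<alpha>' < \<mu>" "\<mu> < \<alpha>" using assms(4,5) by (simp_all add: \<mu>_def field_simps)
  have "A \<mu> \<alpha>' (B \<alpha> \<mu> k) = A \<beta> \<alpha>' (B \<alpha> \<beta> k)"
  proof (cases \<mu> \<beta> rule: linorder_cases)
    case less
    then show ?thesis using *[of \<mu> \<beta>] \<mu> assms(4,5) by blast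
  next
    case greater
    then show ?thesis using *[of \<beta> \<mu>] \<mu> assms(4,5) by metis
  qed simp
  then show ?thesis by (simp add: scale_comp_def \<mu>_def)
qed

definition strongly_continuous ::
    "('k, 'a::ab_group_add) scale_data \<Rightarrow> real \<Rightarrow> real \<Rightarrow> 'p::topological_space set \<Rightarrow> ('p \<Rightarrow> 'a \<Rightarrow> 'a) \<Rightarrow> bool"
  where
  "strongly_continuous X \<alpha> \<alpha>' D F \<longleftrightarrow>
     (\<forall>k\<in>spc X \<alpha>. continuous_map (top_of_set D) (stop X \<alpha>') (\<lambda>p. F p k))"

text \<open>
  \<open>f\<close> is integrable over \<open>[s,t]\<close> in the Banach space with index \<open>\<beta>\<close>, with integral \<open>I\<close>.
  This is the library's Henstock--Kurzweil integral with \<open>norm\<close> replaced by \<open>nrm X \<beta>\<close>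
  (cf. \<open>has_integral\<close>, where \<open>content\<close> is \<open>measure lborel\<close>).  It extends the Riemann and the Bochner integral; all
  integrands below are continuous under the standing assumptions, where the three agree.
\<close>

definition scale_has_integral ::
    "('k::{real_normed_field,banach}, 'a::ab_group_add) scale_data \<Rightarrow> real \<Rightarrow> (real \<Rightarrow> 'a) \<Rightarrow> 'a
      \<Rightarrow> real \<Rightarrow> real \<Rightarrow> bool" where
  "scale_has_integral X \<beta> f I s t \<longleftrightarrow>
     (\<forall>r\<in>{s..t}. f r \<in> spc X \<beta>) \<and> I \<in> spc X \<beta> \<and>
     (\<forall>e>0. \<exists>\<gamma>. gauge \<gamma> \<and>
        (\<forall>D. D tagged_division_of {s..t} \<and> \<gamma> fine D \<longrightarrow>
           nrm X \<beta> ((\<Sum>(r,J)\<in>D. smult X (of_real (measure lborel J)) (f r)) - I) < e))"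


section \<open>The dual scale\<close>

text \<open>
  Functionals are taken to be \<open>extensional\<close> on their carrier, so that equality in the dual
  space is equality of functions.
\<close>

definition dual ::
    "('k::{real_normed_field,banach}, 'a::ab_group_add) scale_data \<Rightarrow> real \<Rightarrow> ('a \<Rightarrow> 'k) set" where
  "dual X \<alpha> = {l \<in> extensional (spc X \<alpha>).
     (\<forall>x\<in>spc X \<alpha>. \<forall>y\<in>spc X \<alpha>. l (x + y) = l x + l y) \<and>
     (\<forall>c. \<forall>x\<in>spc X \<alpha>. l (smult X c x) = c * l x) \<and>
     (\<exists>C. \<forall>x\<in>spc X \<alpha>. norm (l x) \<le> C * nrm X \<alpha> x)}"

text \<open>The adjoint of an operator \<open>Q\<close> with source \<open>spc X \<alpha>\<close>.\<close>

definition adj :: "('k, 'a) scale_data \<Rightarrow> real \<Rightarrow> ('a \<Rightarrow> 'a) \<Rightarrow> ('a \<Rightarrow> 'k) \<Rightarrow> 'a \<Rightarrow> 'k" where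
  "adj X \<alpha> Q l = (\<lambda>k\<in>spc X \<alpha>. l (Q k))"

definition pairing :: "'a \<Rightarrow> ('a \<Rightarrow> 'k) \<Rightarrow> 'k" (\<open>\<langle>_, _\<rangle>\<close>) where
  "\<langle>k, l\<rangle> = l k"


section \<open>Assumptions on the families\<close>

text \<open>
  Time-dependent collections: \<open>A t \<alpha> \<alpha>'\<close> and \<open>V t s \<alpha> \<alpha>'\<close>.  The backward families are written
  with their times in the order \<open>V s t\<close>, \<open>s \<le> t\<close>; conditions that differ from the forward
  ones only in the order of the time arguments are applied to \<open>\<lambda>t s. V s t\<close>.
\<close>

definition condA1 ::
    "('k, 'a::ab_group_add) scale_data \<Rightarrow> (real \<Rightarrow> real \<Rightarrow> real \<Rightarrow> 'a \<Rightarrow> 'a) \<Rightarrow> bool" where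
  "condA1 X A \<longleftrightarrow>
     (\<forall>\<alpha>' \<alpha>. low X < \<alpha>' \<and> \<alpha>' < \<alpha> \<longrightarrow>
        (\<forall>t\<ge>0. ((\<lambda>r. op_norm X \<alpha> \<alpha>' (\<lambda>k. A r \<alpha> \<alpha>' k - A t \<alpha> \<alpha>' k)) \<longlongrightarrow> 0) (at t within {0..})))"

definition condA2 ::
    "('k::{real_normed_field,banach}, 'a::ab_group_add) scale_data \<Rightarrow>
      (real \<Rightarrow> real \<Rightarrow> real \<Rightarrow> real \<Rightarrow> 'a \<Rightarrow> 'a) \<Rightarrow> bool" where
  "condA2 X V \<longleftrightarrow>
     (\<forall>s t. 0 \<le> s \<and> s \<le> t \<longrightarrow> V t s \<in> scale_ops X) \<and>
     (\<forall>\<alpha>' \<alpha>. low X < \<alpha>' \<and> \<alpha>' < \<alpha> \<longrightarrow>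
        (\<forall>t\<ge>0. \<forall>k\<in>spc X \<alpha>. V t t \<alpha> \<alpha>' k = k) \<and>
        strongly_continuous X \<alpha> \<alpha>' {(t, s). 0 \<le> s \<and> s \<le> t} (\<lambda>(t, s). V t s \<alpha> \<alpha>'))"

definition condA3 ::
    "('k::{real_normed_field,banach}, 'a::ab_group_add) scale_data \<Rightarrow>
      (real \<Rightarrow> real \<Rightarrow> real \<Rightarrow> 'a \<Rightarrow> 'a) \<Rightarrow> (real \<Rightarrow> real \<Rightarrow> real \<Rightarrow> real \<Rightarrow> 'a \<Rightarrow> 'a) \<Rightarrow> bool" where
  "condA3 X A V \<longleftrightarrow>
     (\<forall>\<alpha>' \<alpha>'' \<alpha>. low X < \<alpha>' \<and> \<alpha>' < \<alpha>'' \<and> \<alpha>'' < \<alpha> \<longrightarrow>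
        (\<forall>k\<in>spc X \<alpha>. \<forall>s t. 0 \<le> s \<and> s \<le> t \<longrightarrow>
           scale_has_integral X \<alpha>' (\<lambda>r. A r \<alpha>'' \<alpha>' (V r s \<alpha> \<alpha>'' k)) (V t s \<alpha> \<alpha>' k - k) s t \<and>
           scale_has_integral X \<alpha>' (\<lambda>r. V t r \<alpha>'' \<alpha>' (A r \<alpha> \<alpha>'' k)) (V t s \<alpha> \<alpha>' k - k) s t))"

definition condA3_bwd ::
    "('k::{real_normed_field,banach}, 'a::ab_group_add) scale_data \<Rightarrow>
      (real \<Rightarrow> real \<Rightarrow> real \<Rightarrow> 'a \<Rightarrow> 'a) \<Rightarrow> (real \<Rightarrow> real \<Rightarrow> real \<Rightarrow> real \<Rightarrow> 'a \<Rightarrow> 'a) \<Rightarrow> bool" where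
  "condA3_bwd X A V \<longleftrightarrow>
     (\<forall>\<alpha>' \<alpha>'' \<alpha>. low X < \<alpha>' \<and> \<alpha>' < \<alpha>'' \<and> \<alpha>'' < \<alpha> \<longrightarrow>
        (\<forall>k\<in>spc X \<alpha>. \<forall>s t. 0 \<le> s \<and> s \<le> t \<longrightarrow>
           scale_has_integral X \<alpha>' (\<lambda>r. V s r \<alpha>'' \<alpha>' (A r \<alpha> \<alpha>'' k)) (V s t \<alpha> \<alpha>' k - k) s t \<and>
           scale_has_integral X \<alpha>' (\<lambda>r. A r \<alpha>'' \<alpha>' (V r t \<alpha> \<alpha>'' k)) (V s t \<alpha> \<alpha>' k - k) s t))"

definition condA4 ::
    "('k, 'a) scale_data \<Rightarrow> real \<Rightarrow> (real \<Rightarrow> real \<Rightarrow> real \<Rightarrow> real \<Rightarrow> 'a \<Rightarrow> 'a) \<Rightarrow> bool" where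
  "condA4 X K V \<longleftrightarrow>
     1 \<le> K \<and>
     (\<forall>\<alpha>' \<alpha> s t. low X < \<alpha>' \<and> \<alpha>' < \<alpha> \<and> 0 \<le> s \<and> s \<le> t \<longrightarrow> op_norm X \<alpha> \<alpha>' (V t s \<alpha> \<alpha>') \<le> K)"

definition condB1 ::
    "('k, 'a::ab_group_add) scale_data \<Rightarrow> (real \<Rightarrow> real \<Rightarrow> real \<Rightarrow> 'a \<Rightarrow> 'a) \<Rightarrow> bool" where
  "condB1 X B \<longleftrightarrow>
     (\<forall>\<alpha>' \<alpha>. low X < \<alpha>' \<and> \<alpha>' < \<alpha> \<longrightarrow> strongly_continuous X \<alpha> \<alpha>' {0..} (\<lambda>t. B t \<alpha> \<alpha>'))"

definition condB2 ::
    "('k, 'a) scale_data \<Rightarrow> (real \<Rightarrow> real) \<Rightarrow> (real \<Rightarrow> real \<Rightarrow> real \<Rightarrow> 'a \<Rightarrow> 'a) \<Rightarrow> bool" where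
  "condB2 X M B \<longleftrightarrow>
     mono_on {low X<..} M \<and> continuous_on {low X<..} M \<and> (\<forall>\<alpha>>low X. 0 \<le> M \<alpha>) \<and>
     (\<forall>\<alpha>' \<alpha> t. low X < \<alpha>' \<and> \<alpha>' < \<alpha> \<and> 0 \<le> t \<longrightarrow>
        op_norm X \<alpha> \<alpha>' (B t \<alpha> \<alpha>') \<le> M \<alpha> / (\<alpha> - \<alpha>'))"


section \<open>The perturbed families\<close>

text \<open>For \<open>M \<alpha> = 0\<close> the value is \<open>\<infinity>\<close>, by the definition of division on \<open>ereal\<close>.\<close>

definition Tmax :: "real \<Rightarrow> (real \<Rightarrow> real) \<Rightarrow> real \<Rightarrow> real \<Rightarrow> ereal" where
  "Tmax K M \<alpha>' \<alpha> = ereal (\<alpha> - \<alpha>') / ereal (2 * K * exp 1 * M \<alpha>)"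

lemma Tmax_cases:
  assumes "\<alpha>' < \<alpha>"
  shows "Tmax K M \<alpha>' \<alpha> =
    (if K * M \<alpha> = 0 then \<infinity> else ereal ((\<alpha> - \<alpha>') / (2 * K * exp 1 * M \<alpha>)))"
proof (cases "K * M \<alpha> = 0")
  case True
  then have "2 * K * exp 1 * M \<alpha> = 0" by auto
  with True assms show ?thesis by (simp add: Tmax_def divide_ereal_def)
next
  case False
  then have "2 * K * exp 1 * M \<alpha> \<noteq> 0" by simp
  with False show ?thesis unfolding Tmax_def by (simp only: ereal_divide if_False simp_thms)
qed

text \<open>
  The properties shared, up to the order of the times, by the forward and the backward family.
  In the norm bound the quotient \<open>\<infinity> / \<infinity>\<close> would be \<open>0\<close> in \<open>ereal\<close>; it stands for the limit \<open>1\<close>.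
\<close>

definition perturbed_base ::
    "('k::{real_normed_field,banach}, 'a::ab_group_add) scale_data \<Rightarrow> real \<Rightarrow> (real \<Rightarrow> real) \<Rightarrow>
      (real \<Rightarrow> real \<Rightarrow> real \<Rightarrow> real \<Rightarrow> 'a \<Rightarrow> 'a) \<Rightarrow> bool" where
  "perturbed_base X K M W \<longleftrightarrow>
     (\<forall>\<alpha>' \<alpha>. low X < \<alpha>' \<and> \<alpha>' < \<alpha> \<longrightarrow>
        strongly_continuous X \<alpha> \<alpha>' {(t, s). 0 \<le> s \<and> s \<le> t \<and> ereal (t - s) < Tmax K M \<alpha>' \<alpha>}
          (\<lambda>(t, s). W t s \<alpha> \<alpha>') \<and>
        (\<forall>t\<ge>0. \<forall>k\<in>spc X \<alpha>. W t t \<alpha> \<alpha>' k = k) \<and>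
        (\<forall>s t. 0 \<le> s \<and> s \<le> t \<and> ereal (t - s) < Tmax K M \<alpha>' \<alpha> \<longrightarrow>
           bounded_op X \<alpha> \<alpha>' (W t s \<alpha> \<alpha>') \<and>
           ereal (op_norm X \<alpha> \<alpha>' (W t s \<alpha> \<alpha>')) \<le>
             (if Tmax K M \<alpha>' \<alpha> = \<infinity> then ereal K
              else Tmax K M \<alpha>' \<alpha> / (Tmax K M \<alpha>' \<alpha> - ereal (t - s)) * ereal K))) \<and>
     (\<forall>\<alpha>' \<alpha>'' \<alpha> s t. low X < \<alpha>' \<and> \<alpha>' < \<alpha>'' \<and> \<alpha>'' < \<alpha> \<and> 0 \<le> s \<and> s \<le> t \<longrightarrow>
        (ereal (t - s) < min (Tmax K M \<alpha>' \<alpha>) (Tmax K M \<alpha>'' \<alpha>) \<longrightarrow>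
           (\<forall>k\<in>spc X \<alpha>. W t s \<alpha> \<alpha>' k = W t s \<alpha> \<alpha>'' k)) \<and>
        (ereal (t - s) < min (Tmax K M \<alpha>' \<alpha>) (Tmax K M \<alpha>' \<alpha>'') \<longrightarrow>
           (\<forall>k\<in>spc X \<alpha>. W t s \<alpha> \<alpha>' k = W t s \<alpha>'' \<alpha>' k)))"

definition perturbed_forward ::
    "('k::{real_normed_field,banach}, 'a::ab_group_add) scale_data \<Rightarrow> real \<Rightarrow> (real \<Rightarrow> real) \<Rightarrow>
      (real \<Rightarrow> real \<Rightarrow> real \<Rightarrow> real \<Rightarrow> 'a \<Rightarrow> 'a) \<Rightarrow> (real \<Rightarrow> real \<Rightarrow> real \<Rightarrow> 'a \<Rightarrow> 'a) \<Rightarrow>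
      (real \<Rightarrow> real \<Rightarrow> real \<Rightarrow> real \<Rightarrow> 'a \<Rightarrow> 'a) \<Rightarrow> bool" where
  "perturbed_forward X K M V B W \<longleftrightarrow>
     perturbed_base X K M W \<and>
     (\<forall>\<alpha>' \<alpha>'' \<alpha> s t. low X < \<alpha>' \<and> \<alpha>' < \<alpha>'' \<and> \<alpha>'' < \<alpha> \<and> 0 \<le> s \<and> s \<le> t \<longrightarrow>
        (\<forall>k\<in>spc X \<alpha>.
          (ereal (t - s) < min (Tmax K M \<alpha>' \<alpha>) (Tmax K M \<alpha>'' \<alpha>) \<longrightarrow>
             scale_has_integral X \<alpha>' (\<lambda>r. scale_comp (V t r) (B r) \<alpha>'' \<alpha>' (W r s \<alpha> \<alpha>'' k))
               (W t s \<alpha> \<alpha>' k - V t s \<alpha> \<alpha>' k) s t) \<and>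
          (ereal (t - s) < min (Tmax K M \<alpha>' \<alpha>) (Tmax K M \<alpha>' \<alpha>'') \<longrightarrow>
             scale_has_integral X \<alpha>' (\<lambda>r. W t r \<alpha>'' \<alpha>' (scale_comp (B r) (V r s) \<alpha> \<alpha>'' k))
               (W t s \<alpha> \<alpha>' k - V t s \<alpha> \<alpha>' k) s t)))"

definition perturbed_backward ::
    "('k::{real_normed_field,banach}, 'a::ab_group_add) scale_data \<Rightarrow> real \<Rightarrow> (real \<Rightarrow> real) \<Rightarrow>
      (real \<Rightarrow> real \<Rightarrow> real \<Rightarrow> real \<Rightarrow> 'a \<Rightarrow> 'a) \<Rightarrow> (real \<Rightarrow> real \<Rightarrow> real \<Rightarrow> 'a \<Rightarrow> 'a) \<Rightarrow>
      (real \<Rightarrow> real \<Rightarrow> real \<Rightarrow> real \<Rightarrow> 'a \<Rightarrow> 'a) \<Rightarrow> bool" where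
  "perturbed_backward X K M V B W \<longleftrightarrow>
     perturbed_base X K M (\<lambda>t s. W s t) \<and>
     (\<forall>\<alpha>' \<alpha>'' \<alpha> s t. low X < \<alpha>' \<and> \<alpha>' < \<alpha>'' \<and> \<alpha>'' < \<alpha> \<and> 0 \<le> s \<and> s \<le> t \<longrightarrow>
        (\<forall>k\<in>spc X \<alpha>.
          (ereal (t - s) < min (Tmax K M \<alpha>' \<alpha>) (Tmax K M \<alpha>' \<alpha>'') \<longrightarrow>
             scale_has_integral X \<alpha>' (\<lambda>r. W s r \<alpha>'' \<alpha>' (scale_comp (B r) (V r t) \<alpha> \<alpha>'' k))
               (W s t \<alpha> \<alpha>' k - V s t \<alpha> \<alpha>' k) s t) \<and>
          (ereal (t - s) < min (Tmax K M \<alpha>' \<alpha>) (Tmax K M \<alpha>'' \<alpha>) \<longrightarrow>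
             scale_has_integral X \<alpha>' (\<lambda>r. scale_comp (V s r) (B r) \<alpha>'' \<alpha>' (W r t \<alpha> \<alpha>'' k))
               (W s t \<alpha> \<alpha>' k - V s t \<alpha> \<alpha>' k) s t)))"

text \<open>One-sided derivatives at the end points of \<open>D\<close>.\<close>

definition continuously_differentiable_on ::
    "real set \<Rightarrow> (real \<Rightarrow> 'k::real_normed_vector) \<Rightarrow> (real \<Rightarrow> 'k) \<Rightarrow> bool" where
  "continuously_differentiable_on D f f' \<longleftrightarrow>
     (\<forall>x\<in>D. (f has_vector_derivative f' x) (at x within D)) \<and> continuous_on D f'"

end

theory Submission
  imports Defs
begin

text \<open>
  Before anything is integrated, it is paired with a functional.  The integrals in the spaces of the
  scale become integrals of scalar functions (\<open>has_integral_functional\<close>), and the analysis reduces to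
  continuous scalar functions on a compact time window \<open>[a,b]\<close>.  On such a window the reversal
  \<open>r \<mapsto> a + b - r\<close> turns the backward problem into the forward one with final time \<open>b\<close>
  (\<open>perturbed_dual_cauchy_backward\<close>), so one argument proves both halves.

  Differentiability.  The variation of constants formula gives
  \<open>\<ell>(W(t,s)k) = \<ell>(V(t,s)k) + \<integral>\<^sub>s\<^sup>t \<ell>(W(t,r)B(r)V(r,s)k) dr\<close>.  Insert
  \<open>V(r,s)k = k + \<integral>\<^sub>s\<^sup>r V(r,u)A(u)k du\<close> and exchange the two integrations over the triangle
  \<open>s \<le> u \<le> r \<le> t\<close>: the inner integral becomes the same formula for the vector \<open>A(u)k\<close>, and what is left is
  \<open>\<ell>(W(t,s)k) = \<ell>(k) + \<integral>\<^sub>s\<^sup>t \<ell>(W(t,u)(A(u)+B(u))k) du\<close>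
  with a continuous integrand (\<open>generator_equation_of_duhamel\<close>).  The vector \<open>A(u)k\<close> lies in a slightly
  larger space than \<open>k\<close>; the formula is still valid there, because by continuity of \<open>M\<close> the condition
  \<open>t - s < T(\<alpha>',\<gamma>)\<close> is open in \<open>\<gamma>\<close> (\<open>open_Tmax\<close>).

  Uniqueness.  By density the equation for \<open>\<ell>(s)\<close> holds for all vectors of \<open>E\<^sub>\<mu>\<close>, \<open>\<mu> > \<alpha>\<close>, and not only on
  \<open>Y\<close> (\<open>weak_equation_of_dense\<close>).  The same exchange of integrals then shows that \<open>\<ell>(s)\<close> satisfies the
  variation of constants formula (\<open>duhamel_of_weak_equation\<close>), as does \<open>W(t,s)\<^sup>*\<ell>\<close>.  The difference \<open>m\<close>
  solves \<open>m(s)k = \<integral>\<^sub>s\<^sup>t m(r)B(r)V(r,s)k dr\<close> for \<open>k\<close> in \<open>E\<^sub>\<gamma>\<close>, \<open>\<gamma> > \<alpha>\<close>.  Iterating \<open>n\<close> times, with \<open>n\<close> equal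
  losses of index between \<open>\<gamma>\<close> and \<open>\<alpha>\<close>, costs a factor \<open>(L n/(\<gamma>-\<alpha>))\<^sup>n\<close> and gains \<open>(t-s)\<^sup>n/n!\<close>; the product
  is at most \<open>(e L (t-s)/(\<gamma>-\<alpha>))\<^sup>n\<close> (\<open>volterra_iterate_bound\<close>), so \<open>m\<close> vanishes shortly before \<open>t\<close>.  The length
  of this time step depends only on \<open>\<gamma>\<close>, \<open>\<alpha>\<close> and \<open>L\<close>.  On the times already treated \<open>m\<close> is zero, so the
  equation restarts with their beginning in place of \<open>t\<close>, and finitely many steps exhaust the window
  (\<open>volterra_unique\<close>).

  The bounds \<open>K\<close> and \<open>M\<close> enter through the constant \<open>L\<close> of one factor \<open>B(r)V(r,s)\<close>.  The other bounds that are
  uniform in time come from the uniform boundedness principle on compact sets of times, in particular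
  the bound on \<open>\<ell>(s)\<close>, which is only assumed to be weakly continuous.
\<close>

section \<open>Scales of Banach spaces\<close>

locale banach_scale_space =
  fixes X :: "('k::{real_normed_field,banach}, 'a::ab_group_add) scale_data"
  assumes scale: "banach_scale X"
begin

lemma vector_space_smult: "vector_space (smult X)"
  using scale by (simp add: banach_scale_def)

lemma banach_space_spc: "low X < \<beta> \<Longrightarrow> banach_space X \<beta>"
  using scale by (simp add: banach_scale_def)

lemma subspace: "low X < \<beta> \<Longrightarrow> module.subspace (smult X) (spc X \<beta>)"
  using banach_space_spc by (simp add: banach_space_def)

lemma module: "module (smult X)"
  using vector_space_smult by (simp add: vector_space_def module_def)

lemma spc_0: "low X < \<beta> \<Longrightarrow> 0 \<in> spc X \<beta>"
  and spc_add: "low X < \<beta> \<Longrightarrow> x \<in> spc X \<beta> \<Longrightarrow> y \<in> spc X \<beta> \<Longrightarrow> x + y \<in> spc X \<beta>"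
  and spc_smult: "low X < \<beta> \<Longrightarrow> x \<in> spc X \<beta> \<Longrightarrow> smult X c x \<in> spc X \<beta>"
  using module.subspace_0[OF module subspace] module.subspace_add[OF module subspace]
    module.subspace_scale[OF module subspace] by blast+

lemma smult_minus_one: "smult X (- 1) x = - x"
proof -
  interpret vector_space "smult X" by (rule vector_space_smult)
  show ?thesis by simp
qed

lemma spc_minus: "low X < \<beta> \<Longrightarrow> x \<in> spc X \<beta> \<Longrightarrow> - x \<in> spc X \<beta>"
  using spc_smult[of \<beta> x "- 1"] by (simp add: smult_minus_one)

lemma spc_diff: "low X < \<beta> \<Longrightarrow> x \<in> spc X \<beta> \<Longrightarrow> y \<in> spc X \<beta> \<Longrightarrow> x - y \<in> spc X \<beta>"
  using spc_add[of \<beta> x "- y"] spc_minus by simp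

lemma spc_mono: "low X < \<beta>' \<Longrightarrow> \<beta>' \<le> \<beta> \<Longrightarrow> x \<in> spc X \<beta> \<Longrightarrow> x \<in> spc X \<beta>'"
  using scale unfolding banach_scale_def by (metis le_less subsetD)

lemma nrm_mono: "low X < \<beta>' \<Longrightarrow> \<beta>' \<le> \<beta> \<Longrightarrow> x \<in> spc X \<beta> \<Longrightarrow> nrm X \<beta>' x \<le> nrm X \<beta> x"
  using scale unfolding banach_scale_def by (metis le_less)

lemma nrm_ge0: "low X < \<beta> \<Longrightarrow> x \<in> spc X \<beta> \<Longrightarrow> 0 \<le> nrm X \<beta> x"
  and nrm_eq0: "low X < \<beta> \<Longrightarrow> x \<in> spc X \<beta> \<Longrightarrow> nrm X \<beta> x = 0 \<longleftrightarrow> x = 0"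
  and nrm_add: "low X < \<beta> \<Longrightarrow> x \<in> spc X \<beta> \<Longrightarrow> y \<in> spc X \<beta> \<Longrightarrow>
    nrm X \<beta> (x + y) \<le> nrm X \<beta> x + nrm X \<beta> y"
  and nrm_smult: "low X < \<beta> \<Longrightarrow> x \<in> spc X \<beta> \<Longrightarrow> nrm X \<beta> (smult X c x) = norm c * nrm X \<beta> x"
  using banach_space_spc unfolding banach_space_def by blast+

lemma nrm_minus: "low X < \<beta> \<Longrightarrow> x \<in> spc X \<beta> \<Longrightarrow> nrm X \<beta> (- x) = nrm X \<beta> x"
  using nrm_smult[of \<beta> x "- 1"] by (simp add: smult_minus_one)

lemma nrm_diff_le: "low X < \<beta> \<Longrightarrow> x \<in> spc X \<beta> \<Longrightarrow> y \<in> spc X \<beta> \<Longrightarrow>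
    \<bar>nrm X \<beta> x - nrm X \<beta> y\<bar> \<le> nrm X \<beta> (x - y)"
  using nrm_add[of \<beta> "x - y" y] nrm_add[of \<beta> "y - x" x] nrm_minus[of \<beta> "x - y"] spc_diff[of \<beta> x y]
    spc_diff[of \<beta> y x] by simp

lemma Metric_space_spc: "low X < \<beta> \<Longrightarrow> Metric_space (spc X \<beta>) (sdist X \<beta>)"
  by (rule Metric_space_sdist[OF scale])

end

section \<open>Uniform boundedness\<close>

context banach_scale_space begin

text \<open>
  With seminorms instead of maps, this covers operators (\<open>x \<mapsto> \<parallel>F x\<parallel>\<close>) and functionals (\<open>x \<mapsto> |f x|\<close>)
  at once.  By Baire's theorem the seminorms are bounded by one constant on some ball, hence by
  subadditivity on a ball around \<open>0\<close>.
\<close>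

lemma uniform_boundedness:
  fixes p :: "'i \<Rightarrow> 'a \<Rightarrow> real"
  assumes \<beta>: "low X < \<beta>"
    and sub: "\<And>i x y. i \<in> I \<Longrightarrow> x \<in> spc X \<beta> \<Longrightarrow> y \<in> spc X \<beta> \<Longrightarrow> p i (x + y) \<le> p i x + p i y"
    and hom: "\<And>i c x. i \<in> I \<Longrightarrow> x \<in> spc X \<beta> \<Longrightarrow> p i (smult X c x) = norm c * p i x"
    and bdd: "\<And>i. i \<in> I \<Longrightarrow> \<exists>C. \<forall>x\<in>spc X \<beta>. p i x \<le> C * nrm X \<beta> x"
    and pt: "\<And>x. x \<in> spc X \<beta> \<Longrightarrow> \<exists>C. \<forall>i\<in>I. p i x \<le> C"
  shows "\<exists>C\<ge>0. \<forall>i\<in>I. \<forall>x\<in>spc X \<beta>. p i x \<le> C * nrm X \<beta> x"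
proof -
  interpret Metric_space "spc X \<beta>" "sdist X \<beta>" by (rule Metric_space_spc[OF \<beta>])
  have complete: mcomplete using banach_space_spc[OF \<beta>] by (simp add: banach_space_def)
  have pminus: "p i (- x) = p i x" if "i \<in> I" "x \<in> spc X \<beta>" for i x
    using hom[OF that, of "- 1"] by (simp add: smult_minus_one)
  \<comment> \<open>If these open sets were all dense, so would be their intersection, which is empty by pointwise boundedness.\<close>
  define U where "U n = {x \<in> spc X \<beta>. \<exists>i\<in>I. real n < p i x}" for n
  have openU: "openin mtopology (U n)" for n
    unfolding openin_mtopology
  proof (intro conjI allI impI)
    show "U n \<subseteq> spc X \<beta>" by (auto simp: U_def)
    fix x assume "x \<in> U n"
    then obtain i where i: "i \<in> I" "real n < p i x" and x: "x \<in> spc X \<beta>" by (auto simp: U_def)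
    obtain C where C: "\<And>y. y \<in> spc X \<beta> \<Longrightarrow> p i y \<le> C * nrm X \<beta> y" using bdd[OF i(1)] by blast
    define D where "D = max C 1"
    have D: "p i y \<le> D * nrm X \<beta> y" if "y \<in> spc X \<beta>" for y
      using C[OF that] mult_right_mono[OF _ nrm_ge0[OF \<beta> that], of C D] by (auto simp: D_def)
    have "D > 0" by (simp add: D_def)
    show "\<exists>r>0. mball x r \<subseteq> U n"
    proof (intro exI conjI)
      show "(p i x - real n) / D > 0" using i \<open>D > 0\<close> by simp
      show "mball x ((p i x - real n) / D) \<subseteq> U n"
      proof
        fix y assume "y \<in> mball x ((p i x - real n) / D)"
        then have y: "y \<in> spc X \<beta>" and "nrm X \<beta> (x - y) < (p i x - real n) / D"
          using x by (auto simp: sdist_def)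
        then have "D * nrm X \<beta> (x - y) < p i x - real n" using \<open>D > 0\<close> by (simp add: field_simps)
        moreover have "p i x \<le> p i (x - y) + p i y" using sub[OF i(1) spc_diff[OF \<beta> x y] y] by simp
        moreover have "p i (x - y) \<le> D * nrm X \<beta> (x - y)" by (rule D[OF spc_diff[OF \<beta> x y]])
        ultimately show "y \<in> U n" using y i(1) by (auto simp: U_def intro!: bexI[of _ i])
      qed
    qed
  qed
  have "\<exists>n. mtopology closure_of U n \<noteq> spc X \<beta>"
  proof (rule ccontr)
    assume "\<not> ?thesis"
    then have "mtopology closure_of \<Inter>(range U) = spc X \<beta>"
      using metric_Baire_category[OF complete, of "range U"] openU by auto
    moreover have "\<Inter>(range U) = {}"
    proof -
      have "\<exists>n. x \<notin> U n" for x
      proof (cases "x \<in> spc X \<beta>")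
        case True
        then obtain C where "\<forall>i\<in>I. p i x \<le> C" using pt by blast
        moreover obtain n where "C \<le> real n" using real_arch_simple by blast
        ultimately have "x \<notin> U n" by (auto simp: U_def not_less intro: order_trans)
        then show ?thesis ..
      qed (simp add: U_def)
      then show ?thesis by auto
    qed
    ultimately show False using spc_0[OF \<beta>] by auto
  qed
  then obtain n x0 where "x0 \<in> spc X \<beta>" "x0 \<notin> mtopology closure_of U n"
    using closure_of_subset_topspace[of mtopology] by fastforce
  then obtain r where r: "r > 0" and x0: "x0 \<in> spc X \<beta>" and
    ball: "\<And>y. y \<in> U n \<Longrightarrow> y \<notin> mball x0 r"
    by (auto simp: metric_closure_of)
  have ball_le: "p i y \<le> real n" if "i \<in> I" "y \<in> spc X \<beta>" "nrm X \<beta> (x0 - y) < r" for i y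
    using ball[of y] that x0 by (force simp: U_def sdist_def)
  have small: "p i y \<le> 2 * real n" if i: "i \<in> I" and y: "y \<in> spc X \<beta>" and "nrm X \<beta> y < r" for i y
  proof -
    have "p i (x0 + y) \<le> real n"
      using that x0 nrm_minus[OF \<beta> y] by (intro ball_le) (auto intro: spc_add[OF \<beta>])
    moreover have "p i x0 \<le> real n"
      using x0 i r nrm_eq0[OF \<beta> spc_0[OF \<beta>]] by (intro ball_le) auto
    moreover have "p i y \<le> p i (x0 + y) + p i (- x0)"
      using sub[OF i spc_add[OF \<beta> x0 y] spc_minus[OF \<beta> x0]] by simp
    ultimately show ?thesis using pminus[OF i x0] by simp
  qed
  show ?thesis
  proof (intro exI[of _ "4 * real n / r"] conjI ballI)
    show "0 \<le> 4 * real n / r" using r by simp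
    fix i x assume i: "i \<in> I" and x: "x \<in> spc X \<beta>"
    show "p i x \<le> 4 * real n / r * nrm X \<beta> x"
    proof (cases "nrm X \<beta> x = 0")
      case True
      obtain C where "p i x \<le> C * nrm X \<beta> x" using bdd[OF i] x by blast
      with True show ?thesis by simp
    next
      case False
      then have pos: "nrm X \<beta> x > 0" using nrm_ge0[OF \<beta> x] by simp
      define c where "c = r / (2 * nrm X \<beta> x)"
      have c: "c > 0" using r pos by (simp add: c_def)
      have "nrm X \<beta> (smult X (of_real c) x) < r"
        using nrm_smult[OF \<beta> x, of "of_real c"] c pos r unfolding norm_of_real by (simp add: c_def)
      then have "c * p i x \<le> 2 * real n"
        using small[OF i spc_smult[OF \<beta> x], of "of_real c"] hom[OF i x, of "of_real c"] c by simp
      then show ?thesis using r pos by (simp add: c_def field_simps)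
    qed
  qed
qed

end

section \<open>Continuous families of operators and functionals\<close>

text \<open>
  The members of the dual space without the condition \<open>extensional\<close>: it is not preserved by composition
  with operators nor by restriction to the smaller spaces of the scale.
\<close>

definition bounded_functional :: "('k::{real_normed_field,banach}, 'a::ab_group_add) scale_data \<Rightarrow> real \<Rightarrow> ('a \<Rightarrow> 'k) \<Rightarrow> bool"
  where "bounded_functional X \<beta> f \<longleftrightarrow>
     (\<forall>x\<in>spc X \<beta>. \<forall>y\<in>spc X \<beta>. f (x + y) = f x + f y) \<and>
     (\<forall>c. \<forall>x\<in>spc X \<beta>. f (smult X c x) = c * f x) \<and>
     (\<exists>C. \<forall>x\<in>spc X \<beta>. norm (f x) \<le> C * nrm X \<beta> x)"

text \<open>
  Continuity into \<open>spc X \<beta>\<close>, written with the norm so that it can be estimated directly;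
  \<open>strongly_continuousD\<close> connects it with the topology \<open>stop X \<beta>\<close>.
\<close>

definition cont_into :: "('k, 'a::ab_group_add) scale_data \<Rightarrow> real \<Rightarrow> 'p::t2_space set \<Rightarrow> ('p \<Rightarrow> 'a) \<Rightarrow> bool"
  where "cont_into X \<beta> D x \<longleftrightarrow>
    (\<forall>p\<in>D. x p \<in> spc X \<beta> \<and> ((\<lambda>q. nrm X \<beta> (x q - x p)) \<longlongrightarrow> 0) (at p within D))"

definition operator_family :: "('k::{real_normed_field,banach}, 'a::ab_group_add) scale_data \<Rightarrow> real \<Rightarrow> real \<Rightarrow>
    'p::t2_space set \<Rightarrow> ('p \<Rightarrow> 'a \<Rightarrow> 'a) \<Rightarrow> bool"
  where "operator_family X \<alpha> \<beta> D F \<longleftrightarrow>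
    (\<forall>p\<in>D. bounded_op X \<alpha> \<beta> (F p)) \<and> (\<forall>k\<in>spc X \<alpha>. cont_into X \<beta> D (\<lambda>p. F p k))"

definition functional_family :: "('k::{real_normed_field,banach}, 'a::ab_group_add) scale_data \<Rightarrow> real \<Rightarrow>
    'p::t2_space set \<Rightarrow> ('p \<Rightarrow> 'a \<Rightarrow> 'k) \<Rightarrow> bool"
  where "functional_family X \<beta> D f \<longleftrightarrow>
    (\<forall>p\<in>D. bounded_functional X \<beta> (f p)) \<and> (\<forall>k\<in>spc X \<beta>. continuous_on D (\<lambda>p. f p k))"

lemma dual_bounded_functional: "l \<in> dual X \<beta> \<Longrightarrow> bounded_functional X \<beta> l"
  by (simp add: dual_def bounded_functional_def)

lemma cont_into_in: "cont_into X \<beta> D x \<Longrightarrow> p \<in> D \<Longrightarrow> x p \<in> spc X \<beta>"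
  by (simp add: cont_into_def)

context banach_scale_space begin

lemma cont_into_compose:
  assumes x: "cont_into X \<beta> D x" and h: "continuous_on D' h" and hD: "h ` D' \<subseteq> D" and \<beta>: "low X < \<beta>"
  shows "cont_into X \<beta> D' (\<lambda>q. x (h q))"
  unfolding cont_into_def
proof (intro ballI conjI)
  fix p assume p: "p \<in> D'"
  then have hp: "h p \<in> D" using hD by blast
  show "x (h p) \<in> spc X \<beta>" using x hp by (simp add: cont_into_def)
  let ?g = "\<lambda>q. nrm X \<beta> (x q - x (h p))"
  have "(?g \<longlongrightarrow> ?g (h p)) (at (h p) within D)"
    using x hp nrm_eq0[OF \<beta> spc_0[OF \<beta>]] by (simp add: cont_into_def)
  then have "continuous (at (h p) within D) ?g" by (simp add: continuous_within)
  moreover have "continuous (at p within D') h"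
    using h p by (simp add: continuous_on_eq_continuous_within)
  ultimately have "continuous (at p within D') (\<lambda>q. ?g (h q))"
    using continuous_within_compose2 continuous_within_subset hD by blast
  then show "((\<lambda>q. nrm X \<beta> (x (h q) - x (h p))) \<longlongrightarrow> 0) (at p within D')"
    using nrm_eq0[OF \<beta> spc_0[OF \<beta>]] by (simp add: continuous_within)
qed

lemma operator_family_compose:
  assumes "operator_family X \<alpha> \<beta> D F" "continuous_on D' h" "h ` D' \<subseteq> D" "low X < \<beta>"
  shows "operator_family X \<alpha> \<beta> D' (\<lambda>q. F (h q))"
  unfolding operator_family_def
proof (intro conjI ballI)
  show "bounded_op X \<alpha> \<beta> (F (h q))" if "q \<in> D'" for q
    using assms(1,3) that by (auto simp: operator_family_def)
  show "cont_into X \<beta> D' (\<lambda>q. F (h q) k)" if "k \<in> spc X \<alpha>" for k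
    using assms(1) that by (intro cont_into_compose[OF _ assms(2-4)]) (simp add: operator_family_def)
qed

lemma functional_family_compose:
  assumes "functional_family X \<beta> D f" "continuous_on D' h" "h ` D' \<subseteq> D"
  shows "functional_family X \<beta> D' (\<lambda>q. f (h q))"
  unfolding functional_family_def
proof (intro conjI ballI)
  show "bounded_functional X \<beta> (f (h q))" if "q \<in> D'" for q
    using assms(1,3) that by (auto simp: functional_family_def)
  show "continuous_on D' (\<lambda>q. f (h q) k)" if "k \<in> spc X \<beta>" for k
    using assms(1) that by (intro continuous_on_compose2[OF _ assms(2,3)]) (simp add: functional_family_def)
qed

lemma cont_into_nrm:
  assumes x: "cont_into X \<beta> D x" and \<beta>: "low X < \<beta>"
  shows "continuous_on D (\<lambda>p. nrm X \<beta> (x p))"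
  unfolding continuous_on_def
proof
  fix p assume p: "p \<in> D"
  have "((\<lambda>q. nrm X \<beta> (x q) - nrm X \<beta> (x p)) \<longlongrightarrow> 0) (at p within D)"
  proof (rule Lim_null_comparison)
    show "\<forall>\<^sub>F q in at p within D. norm (nrm X \<beta> (x q) - nrm X \<beta> (x p)) \<le> nrm X \<beta> (x q - x p)"
      using x p nrm_diff_le[OF \<beta>] by (auto simp: cont_into_def eventually_at_filter)
    show "((\<lambda>q. nrm X \<beta> (x q - x p)) \<longlongrightarrow> 0) (at p within D)" using x p by (simp add: cont_into_def)
  qed
  then show "((\<lambda>q. nrm X \<beta> (x q)) \<longlongrightarrow> nrm X \<beta> (x p)) (at p within D)"
    by (simp add: Lim_null[symmetric])
qed

lemma cont_into_add:
  assumes "cont_into X \<beta> D x" "cont_into X \<beta> D y" and \<beta>: "low X < \<beta>"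
  shows "cont_into X \<beta> D (\<lambda>p. x p + y p)"
  unfolding cont_into_def
proof (intro ballI conjI)
  fix p assume p: "p \<in> D"
  show "x p + y p \<in> spc X \<beta>" using assms p by (auto simp: cont_into_def intro: spc_add)
  have "((\<lambda>q. nrm X \<beta> (x q - x p) + nrm X \<beta> (y q - y p)) \<longlongrightarrow> 0 + 0) (at p within D)"
    using assms p by (intro tendsto_add) (auto simp: cont_into_def)
  then have *: "((\<lambda>q. nrm X \<beta> (x q - x p) + nrm X \<beta> (y q - y p)) \<longlongrightarrow> 0) (at p within D)" by simp
  show "((\<lambda>q. nrm X \<beta> (x q + y q - (x p + y p))) \<longlongrightarrow> 0) (at p within D)"
  proof (rule Lim_null_comparison[OF _ *])
    have "norm (nrm X \<beta> (x q + y q - (x p + y p))) \<le> nrm X \<beta> (x q - x p) + nrm X \<beta> (y q - y p)"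
      if "q \<in> D" for q
    proof -
      have "x q - x p \<in> spc X \<beta>" "y q - y p \<in> spc X \<beta>"
        using assms p that by (auto simp: cont_into_def intro: spc_diff)
      then show ?thesis
        using nrm_add[OF \<beta>, of "x q - x p" "y q - y p"] nrm_ge0[OF \<beta>, of "x q - x p + (y q - y p)"]
          spc_add[OF \<beta>, of "x q - x p" "y q - y p"] by (simp add: algebra_simps)
    qed
    then show "\<forall>\<^sub>F q in at p within D.
        norm (nrm X \<beta> (x q + y q - (x p + y p))) \<le> nrm X \<beta> (x q - x p) + nrm X \<beta> (y q - y p)"
      by (auto simp: eventually_at_filter)
  qed
qed

lemma cont_into_mono:
  assumes "cont_into X \<beta> D x" and \<beta>: "low X < \<beta>'" "\<beta>' \<le> \<beta>"
  shows "cont_into X \<beta>' D x"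
  unfolding cont_into_def
proof (intro ballI conjI)
  fix p assume p: "p \<in> D"
  show "x p \<in> spc X \<beta>'" using assms p spc_mono[OF \<beta>] by (auto simp: cont_into_def)
  have *: "((\<lambda>q. nrm X \<beta> (x q - x p)) \<longlongrightarrow> 0) (at p within D)"
    using assms p by (auto simp: cont_into_def)
  have "norm (nrm X \<beta>' (x q - x p)) \<le> nrm X \<beta> (x q - x p)" if "q \<in> D" for q
  proof -
    have "x q - x p \<in> spc X \<beta>" using assms p that by (auto simp: cont_into_def intro: spc_diff)
    then show ?thesis using nrm_mono[OF \<beta>] nrm_ge0[OF \<beta>(1)] spc_mono[OF \<beta>] by auto
  qed
  then show "((\<lambda>q. nrm X \<beta>' (x q - x p)) \<longlongrightarrow> 0) (at p within D)"
    by (intro Lim_null_comparison[OF _ *]) (auto simp: eventually_at_filter)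
qed

lemma strongly_continuousD:
  assumes "strongly_continuous X \<alpha> \<beta> D F" "low X < \<beta>" "k \<in> spc X \<alpha>"
  shows "cont_into X \<beta> D (\<lambda>p. F p k)"
proof -
  interpret Metric_space "spc X \<beta>" "sdist X \<beta>" by (rule Metric_space_spc[OF assms(2)])
  have c: "continuous_map (top_of_set D) mtopology (\<lambda>p. F p k)"
    using assms by (simp add: strongly_continuous_def stop_def)
  show ?thesis unfolding cont_into_def
  proof (intro ballI conjI)
    fix p assume p: "p \<in> D"
    have inE: "F q k \<in> spc X \<beta>" if "q \<in> D" for q
      using continuous_map_image_subset_topspace[OF c] that by auto
    show "F p k \<in> spc X \<beta>" by (rule inE[OF p])
    show "((\<lambda>q. nrm X \<beta> (F q k - F p k)) \<longlongrightarrow> 0) (at p within D)"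
      unfolding tendsto_iff
    proof (intro allI impI)
      fix e :: real assume "e > 0"
      then obtain U where U: "openin (top_of_set D) U" "p \<in> U" "\<And>y. y \<in> U \<Longrightarrow> F y k \<in> mball (F p k) e"
        using c p unfolding continuous_map_to_metric by (metis topspace_euclidean_subtopology)
      obtain S where S: "open S" "U = D \<inter> S" using U(1) by (auto simp: openin_open)
      have "dist (nrm X \<beta> (F q k - F p k)) 0 < e" if "q \<in> D" "q \<in> S" for q
      proof -
        have "sdist X \<beta> (F p k) (F q k) < e" using U(3)[of q] that S by auto
        then show ?thesis using inE[OF that(1)] inE[OF p] commute[of "F p k" "F q k"]
            nrm_ge0[OF assms(2) spc_diff[OF assms(2) inE[OF that(1)] inE[OF p]]]
          by (simp add: sdist_def)
      qed
      moreover have "\<forall>\<^sub>F q in at p within D. q \<in> S \<and> q \<in> D"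
        using S U(2) by (auto simp: eventually_at_topological)
      ultimately show "\<forall>\<^sub>F q in at p within D. dist (nrm X \<beta> (F q k - F p k)) 0 < e"
        by (auto elim: eventually_mono)
    qed
  qed
qed

lemma bounded_opD:
  assumes "bounded_op X \<alpha> \<beta> F"
  shows "x \<in> spc X \<alpha> \<Longrightarrow> F x \<in> spc X \<beta>"
    and "x \<in> spc X \<alpha> \<Longrightarrow> y \<in> spc X \<alpha> \<Longrightarrow> F (x + y) = F x + F y"
    and "x \<in> spc X \<alpha> \<Longrightarrow> F (smult X c x) = smult X c (F x)"
  using assms by (auto simp: bounded_op_def)

lemma bounded_op_bound:
  assumes "bounded_op X \<alpha> \<beta> F" "low X < \<alpha>"
  shows "\<exists>C\<ge>0. \<forall>x\<in>spc X \<alpha>. nrm X \<beta> (F x) \<le> C * nrm X \<alpha> x"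
proof -
  obtain C where C: "\<forall>x\<in>spc X \<alpha>. nrm X \<beta> (F x) \<le> C * nrm X \<alpha> x"
    using assms unfolding bounded_op_def by blast
  have "nrm X \<beta> (F x) \<le> max C 0 * nrm X \<alpha> x" if x: "x \<in> spc X \<alpha>" for x
    using C x mult_right_mono[OF max.cobounded1 nrm_ge0[OF \<open>low X < \<alpha>\<close> x], of C 0] by force
  then show ?thesis by (intro exI[of _ "max C 0"]) auto
qed

lemma bounded_op_diff:
  assumes "bounded_op X \<alpha> \<beta> F" "low X < \<alpha>" "x \<in> spc X \<alpha>" "y \<in> spc X \<alpha>"
  shows "F (x - y) = F x - F y"
  using bounded_opD(2)[OF assms(1) spc_diff[OF assms(2-4)] assms(4)] by (simp add: algebra_simps)

lemma bounded_op_le: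
  assumes F: "bounded_op X \<alpha> \<beta> F" and \<alpha>: "low X < \<alpha>" and \<beta>: "low X < \<beta>" and x: "x \<in> spc X \<alpha>"
  shows "nrm X \<beta> (F x) \<le> op_norm X \<alpha> \<beta> F * nrm X \<alpha> x"
proof (cases "nrm X \<alpha> x = 0")
  case True
  then show ?thesis using bounded_op_bound[OF F \<alpha>] x by force
next
  case False
  then have pos: "nrm X \<alpha> x > 0" using nrm_ge0[OF \<alpha> x] by simp
  obtain C where C: "C \<ge> 0" "\<And>x. x \<in> spc X \<alpha> \<Longrightarrow> nrm X \<beta> (F x) \<le> C * nrm X \<alpha> x"
    using bounded_op_bound[OF F \<alpha>] by blast
  have "nrm X \<beta> (F x) / nrm X \<alpha> x \<le> op_norm X \<alpha> \<beta> F"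
    unfolding op_norm_def
  proof (rule cSUP_upper[OF x])
    have "nrm X \<beta> (F y) / nrm X \<alpha> y \<le> C" if y: "y \<in> spc X \<alpha>" for y
      using C(1) C(2)[OF y] nrm_ge0[OF \<alpha> y] by (cases "nrm X \<alpha> y = 0") (auto simp: field_simps)
    then show "bdd_above ((\<lambda>x. nrm X \<beta> (F x) / nrm X \<alpha> x) ` spc X \<alpha>)"
      by (auto intro!: bdd_aboveI)
  qed
  then show ?thesis using pos by (simp add: field_simps)
qed

lemma operator_family_bound:
  assumes F: "operator_family X \<alpha> \<beta> D F" and D: "compact D" and \<alpha>: "low X < \<alpha>" and \<beta>: "low X < \<beta>"
  shows "\<exists>C\<ge>0. \<forall>p\<in>D. \<forall>x\<in>spc X \<alpha>. nrm X \<beta> (F p x) \<le> C * nrm X \<alpha> x"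
proof (rule uniform_boundedness[OF \<alpha>])
  fix p assume "p \<in> D"
  then have b: "bounded_op X \<alpha> \<beta> (F p)" using F by (simp add: operator_family_def)
  show "nrm X \<beta> (F p (x + y)) \<le> nrm X \<beta> (F p x) + nrm X \<beta> (F p y)"
    if "x \<in> spc X \<alpha>" "y \<in> spc X \<alpha>" for x y
    using bounded_opD(1,2)[OF b] that nrm_add[OF \<beta>] by simp
  show "nrm X \<beta> (F p (smult X c x)) = norm c * nrm X \<beta> (F p x)" if "x \<in> spc X \<alpha>" for x c
    using bounded_opD(1,3)[OF b] that nrm_smult[OF \<beta>] by simp
  show "\<exists>C. \<forall>x\<in>spc X \<alpha>. nrm X \<beta> (F p x) \<le> C * nrm X \<alpha> x"
    using bounded_op_bound[OF b \<alpha>] by blast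
next
  fix x assume "x \<in> spc X \<alpha>"
  then have "continuous_on D (\<lambda>p. nrm X \<beta> (F p x))"
    using F cont_into_nrm[OF _ \<beta>] by (auto simp: operator_family_def)
  then have "bounded ((\<lambda>p. nrm X \<beta> (F p x)) ` D)"
    using D compact_continuous_image compact_imp_bounded by blast
  then show "\<exists>C. \<forall>p\<in>D. nrm X \<beta> (F p x) \<le> C"
    by (auto simp: bounded_iff) (meson abs_le_D1)
qed

lemma functional_bound:
  assumes "bounded_functional X \<beta> f" "low X < \<beta>"
  shows "\<exists>C\<ge>0. \<forall>x\<in>spc X \<beta>. norm (f x) \<le> C * nrm X \<beta> x"
proof -
  obtain C where C: "\<forall>x\<in>spc X \<beta>. norm (f x) \<le> C * nrm X \<beta> x"
    using assms unfolding bounded_functional_def by blast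
  have "norm (f x) \<le> max C 0 * nrm X \<beta> x" if x: "x \<in> spc X \<beta>" for x
    using C x mult_right_mono[OF max.cobounded1 nrm_ge0[OF \<open>low X < \<beta>\<close> x], of C 0] by force
  then show ?thesis by (intro exI[of _ "max C 0"]) auto
qed

lemma functional_family_bound:
  assumes f: "functional_family X \<beta> D f" and D: "compact D" and \<beta>: "low X < \<beta>"
  shows "\<exists>C\<ge>0. \<forall>p\<in>D. \<forall>x\<in>spc X \<beta>. norm (f p x) \<le> C * nrm X \<beta> x"
proof (rule uniform_boundedness[OF \<beta>])
  fix p assume "p \<in> D"
  then have b: "bounded_functional X \<beta> (f p)" using f by (simp add: functional_family_def)
  show "norm (f p (x + y)) \<le> norm (f p x) + norm (f p y)"
    if "x \<in> spc X \<beta>" "y \<in> spc X \<beta>" for x y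
    using b that by (simp add: bounded_functional_def norm_triangle_ineq)
  show "norm (f p (smult X c x)) = norm c * norm (f p x)" if "x \<in> spc X \<beta>" for x c
    using b that by (simp add: bounded_functional_def norm_mult)
  show "\<exists>C. \<forall>x\<in>spc X \<beta>. norm (f p x) \<le> C * nrm X \<beta> x"
    using b by (simp add: bounded_functional_def)
next
  fix x assume "x \<in> spc X \<beta>"
  then have "continuous_on D (\<lambda>p. f p x)" using f by (simp add: functional_family_def)
  then have "bounded ((\<lambda>p. f p x) ` D)" using D compact_continuous_image compact_imp_bounded by blast
  then show "\<exists>C. \<forall>p\<in>D. norm (f p x) \<le> C" by (auto simp: bounded_iff)
qed

lemma functional_diff:
  assumes "bounded_functional X \<beta> f" "low X < \<beta>" "x \<in> spc X \<beta>" "y \<in> spc X \<beta>"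
  shows "f (x - y) = f x - f y"
proof -
  have "f (x - y + y) = f (x - y) + f y"
    using assms spc_diff[OF assms(2-4)] unfolding bounded_functional_def by blast
  then show ?thesis by simp
qed

lemma functional_add: "bounded_functional X \<beta> f \<Longrightarrow> x \<in> spc X \<beta> \<Longrightarrow> y \<in> spc X \<beta> \<Longrightarrow> f (x + y) = f x + f y"
  by (simp add: bounded_functional_def)

text \<open>
  Strong continuity alone gives continuity in the parameter for a fixed vector.  The vector may move as
  well because the operators are uniformly bounded over the compact parameter set.
\<close>

lemma operator_family_apply:
  assumes F: "operator_family X \<alpha> \<beta> D F" and D: "compact D" and x: "cont_into X \<alpha> D x"
    and \<alpha>: "low X < \<alpha>" and \<beta>: "low X < \<beta>"
  shows "cont_into X \<beta> D (\<lambda>p. F p (x p))"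
  unfolding cont_into_def
proof (intro ballI conjI)
  fix p assume p: "p \<in> D"
  have b: "bounded_op X \<alpha> \<beta> (F q)" if "q \<in> D" for q using F that by (simp add: operator_family_def)
  have xE: "x q \<in> spc X \<alpha>" if "q \<in> D" for q using x that by (simp add: cont_into_def)
  have FE: "F q y \<in> spc X \<beta>" if "q \<in> D" "y \<in> spc X \<alpha>" for q y using bounded_opD(1)[OF b] that by simp
  show "F p (x p) \<in> spc X \<beta>" using FE xE p by simp
  obtain C where C: "C \<ge> 0" "\<And>p x. p \<in> D \<Longrightarrow> x \<in> spc X \<alpha> \<Longrightarrow> nrm X \<beta> (F p x) \<le> C * nrm X \<alpha> x"
    using operator_family_bound[OF F D \<alpha> \<beta>] by blast
  have "((\<lambda>q. C * nrm X \<alpha> (x q - x p) + nrm X \<beta> (F q (x p) - F p (x p))) \<longlongrightarrow> C * 0 + 0) (at p within D)"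
    using x F p xE by (intro tendsto_intros) (auto simp: operator_family_def cont_into_def)
  then have *: "((\<lambda>q. C * nrm X \<alpha> (x q - x p) + nrm X \<beta> (F q (x p) - F p (x p))) \<longlongrightarrow> 0) (at p within D)" by simp
  have "norm (nrm X \<beta> (F q (x q) - F p (x p)))
      \<le> C * nrm X \<alpha> (x q - x p) + nrm X \<beta> (F q (x p) - F p (x p))" if q: "q \<in> D" for q
  proof -
    have i: "F q (x q) - F q (x p) \<in> spc X \<beta>" "F q (x p) - F p (x p) \<in> spc X \<beta>"
      using FE xE p q spc_diff[OF \<beta>] by auto
    have "nrm X \<beta> (F q (x q) - F p (x p)) \<le> nrm X \<beta> (F q (x q) - F q (x p)) + nrm X \<beta> (F q (x p) - F p (x p))"
      using nrm_add[OF \<beta> i] by simp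
    moreover have "nrm X \<beta> (F q (x q) - F q (x p)) \<le> C * nrm X \<alpha> (x q - x p)"
      using C(2)[OF q spc_diff[OF \<alpha> xE[OF q] xE[OF p]]] bounded_op_diff[OF b[OF q] \<alpha> xE[OF q] xE[OF p]] by simp
    moreover have "F q (x q) - F p (x p) \<in> spc X \<beta>" using FE xE p q spc_diff[OF \<beta>] by auto
    ultimately show ?thesis using nrm_ge0[OF \<beta>] by simp
  qed
  then show "((\<lambda>q. nrm X \<beta> (F q (x q) - F p (x p))) \<longlongrightarrow> 0) (at p within D)"
    by (intro Lim_null_comparison[OF _ *]) (auto simp: eventually_at_filter)
qed

lemma functional_family_apply:
  assumes f: "functional_family X \<beta> D f" and D: "compact D" and x: "cont_into X \<beta> D x"
    and \<beta>: "low X < \<beta>"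
  shows "continuous_on D (\<lambda>p. f p (x p))"
  unfolding continuous_on_def
proof
  fix p assume p: "p \<in> D"
  have b: "bounded_functional X \<beta> (f q)" if "q \<in> D" for q using f that by (simp add: functional_family_def)
  have xE: "x q \<in> spc X \<beta>" if "q \<in> D" for q using x that by (simp add: cont_into_def)
  obtain C where C: "C \<ge> 0" "\<And>p x. p \<in> D \<Longrightarrow> x \<in> spc X \<beta> \<Longrightarrow> norm (f p x) \<le> C * nrm X \<beta> x"
    using functional_family_bound[OF f D \<beta>] by blast
  have "((\<lambda>q. norm (f q (x p) - f p (x p))) \<longlongrightarrow> norm (f p (x p) - f p (x p))) (at p within D)"
    using f xE[OF p] p by (intro tendsto_intros) (auto simp: functional_family_def continuous_on_def)
  then have "((\<lambda>q. C * nrm X \<beta> (x q - x p) + norm (f q (x p) - f p (x p))) \<longlongrightarrow> C * 0 + 0) (at p within D)"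
    using x p by (intro tendsto_intros) (auto simp: cont_into_def)
  then have *: "((\<lambda>q. C * nrm X \<beta> (x q - x p) + norm (f q (x p) - f p (x p))) \<longlongrightarrow> 0) (at p within D)" by simp
  have "norm (f q (x q) - f p (x p)) \<le> C * nrm X \<beta> (x q - x p) + norm (f q (x p) - f p (x p))"
    if q: "q \<in> D" for q
    using C(2)[OF q spc_diff[OF \<beta> xE[OF q] xE[OF p]]] functional_diff[OF b[OF q] \<beta> xE[OF q] xE[OF p]]
      norm_triangle_ineq[of "f q (x q) - f q (x p)" "f q (x p) - f p (x p)"] by simp
  then have "((\<lambda>q. f q (x q) - f p (x p)) \<longlongrightarrow> 0) (at p within D)"
    by (intro Lim_null_comparison[OF _ *]) (auto simp: eventually_at_filter)
  then show "((\<lambda>q. f q (x q)) \<longlongrightarrow> f p (x p)) (at p within D)" by (simp add: Lim_null[symmetric])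
qed

lemma functional_op:
  assumes f: "bounded_functional X \<beta> f" and F: "bounded_op X \<alpha> \<beta> F" and \<alpha>: "low X < \<alpha>" and \<beta>: "low X < \<beta>"
  shows "bounded_functional X \<alpha> (\<lambda>x. f (F x))"
proof -
  obtain C where C: "C \<ge> 0" "\<And>x. x \<in> spc X \<beta> \<Longrightarrow> norm (f x) \<le> C * nrm X \<beta> x"
    using functional_bound[OF f \<beta>] by blast
  obtain C' where C': "\<And>x. x \<in> spc X \<alpha> \<Longrightarrow> nrm X \<beta> (F x) \<le> C' * nrm X \<alpha> x"
    using bounded_op_bound[OF F \<alpha>] by blast
  have "norm (f (F x)) \<le> C * C' * nrm X \<alpha> x" if x: "x \<in> spc X \<alpha>" for x
    using C(2)[OF bounded_opD(1)[OF F x]] mult_left_mono[OF C'[OF x] C(1)] by simp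
  then show ?thesis
    using bounded_opD(1-3)[OF F] f unfolding bounded_functional_def by auto
qed

lemma functional_mono:
  assumes f: "bounded_functional X \<beta> f" and "low X < \<beta>" "\<beta> \<le> \<alpha>"
  shows "bounded_functional X \<alpha> f"
proof -
  obtain C where C: "C \<ge> 0" "\<And>x. x \<in> spc X \<beta> \<Longrightarrow> norm (f x) \<le> C * nrm X \<beta> x"
    using functional_bound[OF f assms(2)] by blast
  have "norm (f x) \<le> C * nrm X \<alpha> x" if x: "x \<in> spc X \<alpha>" for x
    using C(2)[OF spc_mono[OF assms(2,3) x]] mult_left_mono[OF nrm_mono[OF assms(2,3) x] C(1)] by simp
  then show ?thesis using f spc_mono[OF assms(2,3)] unfolding bounded_functional_def by auto
qed

lemma functional_plus:
  assumes "bounded_functional X \<beta> f" "bounded_functional X \<beta> g"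
  shows "bounded_functional X \<beta> (\<lambda>x. f x + g x)"
proof -
  obtain C C' where "\<And>x. x \<in> spc X \<beta> \<Longrightarrow> norm (f x) \<le> C * nrm X \<beta> x"
    "\<And>x. x \<in> spc X \<beta> \<Longrightarrow> norm (g x) \<le> C' * nrm X \<beta> x"
    using assms unfolding bounded_functional_def by blast
  then have "norm (f x + g x) \<le> (C + C') * nrm X \<beta> x" if "x \<in> spc X \<beta>" for x
    using norm_triangle_ineq[of "f x" "g x"] that by (force simp: algebra_simps)
  then have "\<exists>C. \<forall>x\<in>spc X \<beta>. norm (f x + g x) \<le> C * nrm X \<beta> x" by blast
  then show ?thesis using assms unfolding bounded_functional_def by (simp add: algebra_simps)
qed

lemma functional_minus:
  assumes "bounded_functional X \<beta> f" "bounded_functional X \<beta> g"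
  shows "bounded_functional X \<beta> (\<lambda>x. f x - g x)"
proof -
  obtain C C' where "\<And>x. x \<in> spc X \<beta> \<Longrightarrow> norm (f x) \<le> C * nrm X \<beta> x"
    "\<And>x. x \<in> spc X \<beta> \<Longrightarrow> norm (g x) \<le> C' * nrm X \<beta> x"
    using assms unfolding bounded_functional_def by blast
  then have "norm (f x - g x) \<le> (C + C') * nrm X \<beta> x" if "x \<in> spc X \<beta>" for x
    using norm_triangle_ineq4[of "f x" "g x"] that by (force simp: algebra_simps)
  then have "\<exists>C. \<forall>x\<in>spc X \<beta>. norm (f x - g x) \<le> C * nrm X \<beta> x" by blast
  then show ?thesis using assms unfolding bounded_functional_def by (simp add: algebra_simps)
qed

lemma functional_family_minus:
  "functional_family X \<beta> D f \<Longrightarrow> functional_family X \<beta> D g \<Longrightarrow> functional_family X \<beta> D (\<lambda>p x. f p x - g p x)"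
  unfolding functional_family_def by (auto intro: functional_minus continuous_on_diff)

lemma functional_family_subset: "functional_family X \<beta> D f \<Longrightarrow> D' \<subseteq> D \<Longrightarrow> functional_family X \<beta> D' f"
  unfolding functional_family_def by (auto intro: continuous_on_subset)

text \<open>
  The hypothesis tests only the points of \<open>Y\<close> in \<open>spc X \<beta>\<close>, because only these approximate \<open>x\<close>.
\<close>

lemma functional_dense_eq:
  assumes f: "bounded_functional X \<beta> f" and g: "bounded_functional X \<beta> g" and \<beta>: "low X < \<beta>"
    and dense: "stop X \<beta> closure_of Y = spc X \<beta>" and eq: "\<And>y. y \<in> Y \<Longrightarrow> y \<in> spc X \<beta> \<Longrightarrow> f y = g y"
    and x: "x \<in> spc X \<beta>"
  shows "f x = g x"
proof (rule ccontr)
  assume ne: "f x \<noteq> g x"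
  interpret Metric_space "spc X \<beta>" "sdist X \<beta>" by (rule Metric_space_spc[OF \<beta>])
  let ?h = "\<lambda>x. f x - g x"
  have h: "bounded_functional X \<beta> ?h" by (rule functional_minus[OF f g])
  obtain C where C: "C \<ge> 0" "\<And>x. x \<in> spc X \<beta> \<Longrightarrow> norm (?h x) \<le> C * nrm X \<beta> x"
    using functional_bound[OF h \<beta>] by blast
  define e where "e = norm (?h x) / (C + 1)"
  have "e > 0" using ne C(1) by (simp add: e_def)
  have "x \<in> mtopology closure_of Y" using dense x by (simp add: stop_def)
  then obtain y where y: "y \<in> Y" "y \<in> spc X \<beta>" "sdist X \<beta> x y < e"
    using \<open>e > 0\<close> unfolding metric_closure_of by auto
  then have "norm (?h (x - y)) \<le> C * nrm X \<beta> (x - y)" "nrm X \<beta> (x - y) < e"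
    using C(2)[OF spc_diff[OF \<beta> x y(2)]] x by (auto simp: sdist_def)
  moreover have "?h (x - y) = ?h x" using functional_diff[OF h \<beta> x y(2)] eq[OF y(1,2)] by simp
  ultimately have "norm (?h x) \<le> C * e"
    using C(1) mult_left_mono[of "nrm X \<beta> (x - y)" e C] by (metis less_imp_le order_trans)
  also have "\<dots> < (C + 1) * e" using \<open>e > 0\<close> by simp
  also have "\<dots> = norm (?h x)" using C(1) by (simp add: e_def)
  finally show False by simp
qed

text \<open>
  A functional maps the Riemann sums of the integrand to those of the scalar function.
\<close>

lemma has_integral_functional:
  assumes I: "scale_has_integral X \<beta> g J s t" and f: "bounded_functional X \<beta> f" and \<beta>: "low X < \<beta>"
  shows "((\<lambda>r. f (g r)) has_integral f J) {s..t}"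
  unfolding has_integral_real
proof (intro allI impI)
  fix e :: real assume "e > 0"
  obtain C where C: "C \<ge> 0" "\<And>x. x \<in> spc X \<beta> \<Longrightarrow> norm (f x) \<le> C * nrm X \<beta> x"
    using functional_bound[OF f \<beta>] by blast
  have "e / (C + 1) > 0" using \<open>e > 0\<close> C(1) by simp
  then obtain \<gamma> where \<gamma>: "gauge \<gamma>" and less: "\<And>D. D tagged_division_of {s..t} \<Longrightarrow> \<gamma> fine D \<Longrightarrow>
      nrm X \<beta> ((\<Sum>(r,J)\<in>D. smult X (of_real (measure lborel J)) (g r)) - J) < e / (C + 1)"
    using I unfolding scale_has_integral_def by metis
  have J: "J \<in> spc X \<beta>" and gE: "\<And>r. r \<in> {s..t} \<Longrightarrow> g r \<in> spc X \<beta>"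
    using I by (auto simp: scale_has_integral_def)
  show "\<exists>\<gamma>. gauge \<gamma> \<and> (\<forall>D. D tagged_division_of {s..t} \<and> \<gamma> fine D \<longrightarrow>
          norm ((\<Sum>(x, k)\<in>D. measure lborel k *\<^sub>R f (g x)) - f J) < e)"
  proof (intro exI conjI allI impI; (elim conjE)?)
    fix D assume D: "D tagged_division_of {s..t}" "\<gamma> fine D"
    have fin: "finite D" using D(1) by auto
    have tag: "r \<in> {s..t}" if "(r, K) \<in> D" for r K
      using D(1) that by (meson in_mono tag_in_interval tagged_division_ofD(2,3))
    let ?S = "\<lambda>D. \<Sum>(r,J)\<in>D. smult X (of_real (measure lborel J)) (g r)"
    have "?S D' \<in> spc X \<beta> \<and> f (?S D') = (\<Sum>(x, k)\<in>D'. measure lborel k *\<^sub>R f (g x))" if "D' \<subseteq> D" for D'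
      using finite_subset[OF that fin] that
    proof (induction D' rule: finite_induct)
      case empty
      have "f (0 + 0) = f 0 + f 0" using functional_add[OF f] spc_0[OF \<beta>] by blast
      then show ?case using spc_0[OF \<beta>] by simp
    next
      case (insert p D')
      obtain r K where p: "p = (r, K)" by (cases p)
      have gr: "g r \<in> spc X \<beta>" using gE tag insert.prems p by blast
      then show ?case
        using insert spc_smult[OF \<beta> gr] functional_add[OF f] f spc_add[OF \<beta>]
        by (simp add: p bounded_functional_def scaleR_conv_of_real)
    qed
    from this[OF order.refl] have S: "?S D \<in> spc X \<beta>" "f (?S D) = (\<Sum>(x, k)\<in>D. measure lborel k *\<^sub>R f (g x))" by auto
    have "norm ((\<Sum>(x, k)\<in>D. measure lborel k *\<^sub>R f (g x)) - f J) = norm (f (?S D - J))"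
      using functional_diff[OF f \<beta> S(1) J] S(2) by simp
    also have "\<dots> \<le> C * nrm X \<beta> (?S D - J)" by (rule C(2)[OF spc_diff[OF \<beta> S(1) J]])
    also have "\<dots> \<le> C * (e / (C + 1))" using less[OF D] C(1) by (intro mult_left_mono) auto
    also have "\<dots> < e" using \<open>e > 0\<close> C(1) by (simp add: field_simps)
    finally show "norm ((\<Sum>(x, k)\<in>D. measure lborel k *\<^sub>R f (g x)) - f J) < e" .
  qed (rule \<gamma>)
qed

end

context banach_scale_space begin

lemma scale_ops_bounded: "F \<in> scale_ops X \<Longrightarrow> low X < \<beta> \<Longrightarrow> \<beta> < \<gamma> \<Longrightarrow> bounded_op X \<gamma> \<beta> (F \<gamma> \<beta>)"
  unfolding scale_ops_def by blast

lemma scale_ops_in: "F \<in> scale_ops X \<Longrightarrow> low X < \<beta> \<Longrightarrow> \<beta> < \<gamma> \<Longrightarrow> x \<in> spc X \<gamma> \<Longrightarrow> F \<gamma> \<beta> x \<in> spc X \<beta>"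
  using bounded_opD(1)[OF scale_ops_bounded] by blast

text \<open>
  The indices of a member of \<open>L(E)\<close> only record domains: every two of its operators agree wherever both
  are defined, as one sees by comparing them on the smaller of the two source spaces.
\<close>

lemma scale_ops_eq:
  assumes F: "F \<in> scale_ops X" and "low X < \<beta>" "\<beta> < \<gamma>" "low X < \<beta>'" "\<beta>' < \<gamma>'"
    and x: "x \<in> spc X \<gamma>" "x \<in> spc X \<gamma>'"
  shows "F \<gamma> \<beta> x = F \<gamma>' \<beta>' x"
proof -
  define \<delta> where "\<delta> = max \<gamma> \<gamma>'"
  have x\<delta>: "x \<in> spc X \<delta>" using x by (simp add: \<delta>_def max_def)
  have src: "F \<delta> \<rho> x = F \<sigma> \<rho> x" if "low X < \<rho>" "\<rho> < \<sigma>" "\<sigma> \<le> \<delta>" for \<rho> \<sigma>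
    using F that x\<delta> unfolding scale_ops_def by (cases "\<sigma> = \<delta>") auto
  have tgt: "F \<delta> \<rho> x = F \<delta> \<sigma> x" if "low X < \<rho>" "\<rho> < \<sigma>" "\<sigma> < \<delta>" for \<rho> \<sigma>
    using F that x\<delta> unfolding scale_ops_def by blast
  have "F \<delta> \<beta> x = F \<delta> \<beta>' x"
    using tgt[of \<beta> \<beta>'] tgt[of \<beta>' \<beta>] assms(2-5) by (cases \<beta> \<beta>' rule: linorder_cases) (auto simp: \<delta>_def)
  then show ?thesis using src[of \<beta> \<gamma>] src[of \<beta>' \<gamma>'] assms(2-5) by (simp add: \<delta>_def)
qed

end

section \<open>Integrals over triangles and time reversal\<close>

lemma continuous_on_compose_pair:
  assumes "continuous_on T (\<lambda>(r, u). G r u)" "continuous_on S p" "continuous_on S q"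
    and "\<And>s. s \<in> S \<Longrightarrow> (p s, q s) \<in> T"
  shows "continuous_on S (\<lambda>s. G (p s) (q s))"
  using continuous_on_compose2[OF assms(1) continuous_on_Pair[OF assms(2,3)]] assms(4)
  by (auto simp: image_subset_iff)

text \<open>
  Freezing the integrand beyond \<open>x\<close>, that is, replacing \<open>r\<close> by \<open>min r x\<close>, makes the domain of
  integration independent of \<open>x\<close>; the excess over \<open>[x,b]\<close> is explicit.
\<close>

lemma continuous_on_integral_param_upto:
  fixes G :: "real \<Rightarrow> real \<Rightarrow> 'k::banach"
  assumes G: "continuous_on ({a..b} \<times> {a..b}) (\<lambda>(r, u). G r u)"
  shows "continuous_on ({a..b} \<times> {a..b}) (\<lambda>(x, u). integral {a..x} (\<lambda>r. G r u))"
proof -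
  let ?f = "\<lambda>p r. G (min r (fst p)) (snd p)"
  have c: "continuous_on (({a..b} \<times> {a..b}) \<times> cbox a b) (\<lambda>(p, r). ?f p r)"
    unfolding split_beta
    by (rule continuous_on_compose_pair[OF G]) (auto intro!: continuous_intros)
  have "continuous_on ({a..b} \<times> {a..b}) (\<lambda>p. integral {a..b} (?f p) - (b - fst p) *\<^sub>R G (fst p) (snd p))"
    using integral_continuous_on_param[OF c] G
    by (intro continuous_intros) (simp_all add: split_beta)
  moreover have "integral {a..b} (?f p) - (b - fst p) *\<^sub>R G (fst p) (snd p) = (\<lambda>(x, u). integral {a..x} (\<lambda>r. G r u)) p"
    if p: "p \<in> {a..b} \<times> {a..b}" for p
  proof -
    obtain x u where xu: "p = (x, u)" "a \<le> x" "x \<le> b" "u \<in> {a..b}" using p by auto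
    have "continuous_on {a..b} (?f p)"
      using xu by (intro continuous_on_compose_pair[OF G]) (auto intro!: continuous_intros)
    then have "integral {a..b} (?f p) = integral {a..x} (?f p) + integral {x..b} (?f p)"
      using xu Henstock_Kurzweil_Integration.integral_combine[of a x b "?f p"] by (simp add: integrable_continuous_real)
    moreover have "integral {a..x} (?f p) = integral {a..x} (\<lambda>r. G r u)"
      by (rule integral_cong) (simp add: xu)
    moreover have "integral {x..b} (?f p) = integral {x..b} (\<lambda>r. G x u)"
      by (rule integral_cong) (simp add: xu)
    ultimately show ?thesis using xu by simp
  qed
  ultimately show ?thesis by (simp add: continuous_on_eq)
qed

lemma constant_of_quadratic_increments:
  fixes g :: "real \<Rightarrow> 'k::real_normed_vector"
  assumes "a \<le> b" and C: "\<And>x y. a \<le> x \<Longrightarrow> x \<le> y \<Longrightarrow> y \<le> b \<Longrightarrow> norm (g y - g x) \<le> C * (y - x)\<^sup>2"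
  shows "g b = g a"
proof -
  have "(g has_derivative (\<lambda>h. 0)) (at x within {a..b})" if x: "x \<in> {a..b}" for x
    unfolding has_derivative_within_alt
  proof (intro conjI allI impI)
    fix e :: real assume "e > 0"
    show "\<exists>d>0. \<forall>y\<in>{a..b}. norm (y - x) < d \<longrightarrow> norm (g y - g x - 0) \<le> e * norm (y - x)"
    proof (intro exI conjI ballI impI)
      show "e / (\<bar>C\<bar> + 1) > 0" using \<open>e > 0\<close> by simp
      fix y assume y: "y \<in> {a..b}" and d: "norm (y - x) < e / (\<bar>C\<bar> + 1)"
      have "norm (g y - g x) \<le> C * (y - x)\<^sup>2"
        using C[of x y] C[of y x] x y by (cases "x \<le> y") (auto simp: norm_minus_commute power2_commute)
      also have "\<dots> \<le> (\<bar>C\<bar> + 1) * \<bar>y - x\<bar> * \<bar>y - x\<bar>"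
        unfolding mult.assoc abs_mult_self_eq power2_eq_square by (rule mult_right_mono) auto
      also have "\<dots> \<le> e * \<bar>y - x\<bar>"
        using d by (intro mult_right_mono) (auto simp: field_simps)
      finally show "norm (g y - g x - 0) \<le> e * norm (y - x)" by simp
    qed
  qed simp
  then obtain c where "\<And>x. x \<in> {a..b} \<Longrightarrow> g x = c"
    using has_derivative_zero_constant[of "{a..b}" g] by auto
  then show ?thesis using \<open>a \<le> b\<close> by simp
qed

text \<open>
  Cutting \<open>[a,y]\<close> at \<open>x\<close> splits the triangle over it into the triangles over \<open>[a,x]\<close> and \<open>[x,y]\<close> and a
  rectangle, on which the integrals may be exchanged.  Hence the defect of the identity is additive in
  the interval; it is also quadratically small in the length, so it is zero.
\<close>

lemma integral_swap_triangle_of_square: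
  fixes G :: "real \<Rightarrow> real \<Rightarrow> 'k::banach"
  assumes "a \<le> b" and G: "continuous_on ({a..b} \<times> {a..b}) (\<lambda>(r, u). G r u)"
  shows "integral {a..b} (\<lambda>r. integral {a..r} (\<lambda>u. G r u)) = integral {a..b} (\<lambda>u. integral {u..b} (\<lambda>r. G r u))"
proof -
  let ?Q = "{a..b} \<times> {a..b}"
  have Gs: "continuous_on ?Q (\<lambda>(u, r). G r u)"
    unfolding split_beta by (rule continuous_on_compose_pair[OF G]) (auto intro!: continuous_intros)
  define J where "J = (\<lambda>x u. integral {a..x} (\<lambda>r. G r u))"
  define H where "H = (\<lambda>x r. integral {a..x} (\<lambda>u. G r u))"
  have Jc: "continuous_on ?Q (\<lambda>(x, u). J x u)" and Hc: "continuous_on ?Q (\<lambda>(x, r). H x r)"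
    unfolding J_def H_def
    using continuous_on_integral_param_upto[OF G] continuous_on_integral_param_upto[OF Gs] by simp_all
  have J': "continuous_on S (\<lambda>s. J (p s) (q s))" and H': "continuous_on S (\<lambda>s. H (p s) (q s))"
    and G': "continuous_on S (\<lambda>s. G (p s) (q s))"
    if "continuous_on S p" "continuous_on S q" "p ` S \<subseteq> {a..b}" "q ` S \<subseteq> {a..b}"
    for p q :: "real \<Rightarrow> real" and S
    using that by (auto intro!: continuous_on_compose_pair[OF Jc] continuous_on_compose_pair[OF Hc]
        continuous_on_compose_pair[OF G])
  have Gr: "continuous_on S (\<lambda>r. G r u)" "continuous_on S (\<lambda>u. G r u)"
    if "S \<subseteq> {a..b}" "u \<in> {a..b}" "r \<in> {a..b}" for S r u
    using that by (auto intro!: G' continuous_intros)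
  have Jdiff: "integral {x..y} (\<lambda>r. G r u) = J y u - J x u"
    if "a \<le> x" "x \<le> y" "y \<le> b" "u \<in> {a..b}" for x y u
    using Henstock_Kurzweil_Integration.integral_combine[of a x y "\<lambda>r. G r u"] that
      Gr(1)[of "{a..y}" u a] \<open>a \<le> b\<close>
    by (simp add: J_def integrable_continuous_real algebra_simps)
  have Hdiff: "integral {x..y} (\<lambda>u. G r u) = H y r - H x r"
    if "a \<le> x" "x \<le> y" "y \<le> b" "r \<in> {a..b}" for x y r
    using Henstock_Kurzweil_Integration.integral_combine[of a x y "\<lambda>u. G r u"] that
      Gr(2)[of "{a..y}" a r] \<open>a \<le> b\<close>
    by (simp add: H_def integrable_continuous_real algebra_simps)
  obtain C0 where "\<forall>p\<in>?Q. norm ((\<lambda>(r, u). G r u) p) \<le> C0"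
    using compact_continuous_image[OF G] compact_imp_bounded[of "(\<lambda>(r, u). G r u) ` ?Q"]
    by (auto simp: bounded_iff compact_Times)
  then have C0: "norm (G r u) \<le> C0" if "r \<in> {a..b}" "u \<in> {a..b}" for r u using that by auto
  define C where "C = max C0 0"
  have C: "C \<ge> 0" "\<And>r u. r \<in> {a..b} \<Longrightarrow> u \<in> {a..b} \<Longrightarrow> norm (G r u) \<le> C"
    using C0 by (force simp: C_def)+
  define g where "g = (\<lambda>y. integral {a..y} (\<lambda>r. H r r) - integral {a..y} (\<lambda>u. J y u - J u u))"
  have "norm (g y - g x) \<le> 2 * C * (y - x)\<^sup>2" if xy: "a \<le> x" "x \<le> y" "y \<le> b" for x y
  proof -
    have I: "integral {a..y} f = integral {a..x} f + integral {x..y} f" if "continuous_on {a..y} f" for f :: "real \<Rightarrow> 'k"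
      using Henstock_Kurzweil_Integration.integral_combine[of a x y f] xy that by (simp add: integrable_continuous_real)
    have c1: "continuous_on {a..y} (\<lambda>r. H r r)" "continuous_on {a..y} (\<lambda>u. J y u - J u u)"
      "continuous_on {a..x} (\<lambda>u. J x u - J u u)" "continuous_on {a..x} (\<lambda>u. J y u - J x u)"
      "continuous_on {x..y} (\<lambda>r. H x r)" "continuous_on {x..y} (\<lambda>r. H r r - H x r)"
      using xy by (auto intro!: J' H' continuous_intros)
    have swap: "integral {a..x} (\<lambda>u. J y u - J x u) = integral {x..y} (\<lambda>r. H x r)"
    proof -
      have "{a..x} \<times> {x..y} \<subseteq> {a..b} \<times> {a..b}" using xy by auto
      then have "integral {a..x} (\<lambda>u. integral {x..y} (\<lambda>r. G r u)) = integral {x..y} (\<lambda>r. integral {a..x} (\<lambda>u. G r u))"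
        using integral_swap_continuous[of a x x y "\<lambda>u r. G r u"] continuous_on_subset[OF Gs, of "{a..x} \<times> {x..y}"] xy
        by (simp add: cbox_Pair_eq)
      moreover have "integral {a..x} (\<lambda>u. integral {x..y} (\<lambda>r. G r u)) = integral {a..x} (\<lambda>u. J y u - J x u)"
        using xy by (intro integral_cong Jdiff) auto
      ultimately show ?thesis by (simp add: H_def)
    qed
    have "integral {a..x} (\<lambda>u. J y u - J u u) = integral {a..x} (\<lambda>u. J x u - J u u) + integral {a..x} (\<lambda>u. J y u - J x u)"
      using c1 by (subst integral_add[symmetric]) (auto intro: integrable_continuous_real simp: algebra_simps)
    moreover have "integral {x..y} (\<lambda>r. H r r) = integral {x..y} (\<lambda>r. H x r) + integral {x..y} (\<lambda>r. H r r - H x r)"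
      using c1 by (subst integral_add[symmetric]) (auto intro: integrable_continuous_real simp: algebra_simps)
    ultimately have "g y - g x = integral {x..y} (\<lambda>r. H r r - H x r) - integral {x..y} (\<lambda>u. J y u - J u u)"
      using I[OF c1(1)] I[OF c1(2)] swap by (simp add: g_def)
    moreover have "norm (integral {x..y} (\<lambda>r. H r r - H x r)) \<le> (C * (y - x)) * (y - x)"
    proof (rule integral_bound[OF xy(2) c1(6)])
      fix r assume r: "r \<in> {x..y}"
      have "norm (integral {x..r} (\<lambda>u. G r u)) \<le> C * (r - x)"
        using r xy by (intro integral_bound Gr C) auto
      also have "\<dots> \<le> C * (y - x)" using r C(1) by (intro mult_left_mono) auto
      finally show "norm (H r r - H x r) \<le> C * (y - x)" using Hdiff[of x r r] r xy by simp
    qed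
    moreover have "norm (integral {x..y} (\<lambda>u. J y u - J u u)) \<le> (C * (y - x)) * (y - x)"
    proof (rule integral_bound[OF xy(2)])
      show "continuous_on {x..y} (\<lambda>u. J y u - J u u)" by (rule continuous_on_subset[OF c1(2)]) (use xy in auto)
      fix u assume u: "u \<in> {x..y}"
      have "norm (integral {u..y} (\<lambda>r. G r u)) \<le> C * (y - u)"
        using u xy by (intro integral_bound Gr C) auto
      also have "\<dots> \<le> C * (y - x)" using u C(1) by (intro mult_left_mono) auto
      finally show "norm (J y u - J u u) \<le> C * (y - x)" using Jdiff[of u y u] u xy by simp
    qed
    ultimately have "norm (g y - g x) \<le> (C * (y - x)) * (y - x) + (C * (y - x)) * (y - x)"
      by (elim ssubst) (rule order_trans[OF norm_triangle_ineq4 add_mono])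
    then show ?thesis by (simp add: power2_eq_square)
  qed
  then have "g b = g a" by (rule constant_of_quadratic_increments[OF \<open>a \<le> b\<close>])
  then have "integral {a..b} (\<lambda>r. H r r) = integral {a..b} (\<lambda>u. J b u - J u u)" by (simp add: g_def)
  also have "\<dots> = integral {a..b} (\<lambda>u. integral {u..b} (\<lambda>r. G r u))"
    by (intro integral_cong Jdiff[symmetric]) auto
  finally show ?thesis by (simp add: H_def)
qed

text \<open>
  \<open>G (max r u) u\<close> extends \<open>G\<close> continuously from the triangle to the square.
\<close>

lemma integral_swap_triangle:
  fixes G :: "real \<Rightarrow> real \<Rightarrow> 'k::banach"
  assumes "a \<le> b" and G: "continuous_on {(r, u). a \<le> u \<and> u \<le> r \<and> r \<le> b} (\<lambda>(r, u). G r u)"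
  shows "integral {a..b} (\<lambda>r. integral {a..r} (\<lambda>u. G r u)) = integral {a..b} (\<lambda>u. integral {u..b} (\<lambda>r. G r u))"
proof -
  let ?G = "\<lambda>r u. G (max r u) u"
  have "continuous_on ({a..b} \<times> {a..b}) (\<lambda>(r, u). ?G r u)"
    unfolding split_beta by (rule continuous_on_compose_pair[OF G]) (auto intro!: continuous_intros)
  from integral_swap_triangle_of_square[OF assms(1) this]
  have "integral {a..b} (\<lambda>r. integral {a..r} (\<lambda>u. ?G r u)) = integral {a..b} (\<lambda>u. integral {u..b} (\<lambda>r. ?G r u))" .
  moreover have "integral {a..b} (\<lambda>r. integral {a..r} (\<lambda>u. ?G r u)) = integral {a..b} (\<lambda>r. integral {a..r} (\<lambda>u. G r u))"
    by (intro integral_cong) (auto simp: max_def)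
  moreover have "integral {a..b} (\<lambda>u. integral {u..b} (\<lambda>r. ?G r u)) = integral {a..b} (\<lambda>u. integral {u..b} (\<lambda>r. G r u))"
    by (intro integral_cong) (auto simp: max_def)
  ultimately show ?thesis by simp
qed

lemma has_integral_reflect_about:
  fixes f :: "real \<Rightarrow> 'k::real_normed_vector"
  assumes "(f has_integral i) {a..b}"
  shows "((\<lambda>r. f (c - r)) has_integral i) {c - b..c - a}"
proof -
  have "((\<lambda>r. f (- (r - c))) has_integral i) {c - b..c - a}"
    using has_integral_affinity'[of "\<lambda>r. f (- r)" i "- b" "- a" 1 "- c"] assms
    by simp
  then show ?thesis by simp
qed

text \<open>
  Only increments over compact subintervals are used, so \<open>D\<close> may be open or closed at either end.
\<close>

lemma continuously_differentiable_on_of_increments: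
  fixes f :: "real \<Rightarrow> 'k::banach"
  assumes D: "is_interval D"
    and inc: "\<And>x y. x \<in> D \<Longrightarrow> y \<in> D \<Longrightarrow> x \<le> y \<Longrightarrow> continuous_on {x..y} f' \<and> f y - f x = integral {x..y} f'"
  shows "continuously_differentiable_on D f f'"
proof -
  have "(f has_vector_derivative f' x) (at x within D) \<and> continuous (at x within D) f'" if x: "x \<in> D" for x
  proof -
    obtain a where a: "a \<in> D" "a \<le> x" "(\<exists>z\<in>D. z < x) \<Longrightarrow> a < x" using x by (cases "\<exists>z\<in>D. z < x") auto
    obtain b where b: "b \<in> D" "x \<le> b" "(\<exists>z\<in>D. x < z) \<Longrightarrow> x < b" using x by (cases "\<exists>z\<in>D. x < z") auto
    \<comment> \<open>Near \<open>x\<close> the sets \<open>D\<close> and \<open>[a,b]\<close> coincide, also if \<open>x\<close> is an end point of \<open>D\<close>.\<close>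
    define S where "S = {(if a < x then a else x - 1)<..<(if x < b then b else x + 1)}"
    have sub: "{a..b} \<subseteq> D" using D a b unfolding is_interval_1 by (meson atLeastAtMost_iff subsetI)
    have "D \<inter> S - {x} = {a..b} \<inter> S - {x}"
      using sub a b by (fastforce simp: S_def split: if_splits)
    then have at: "at x within D = at x within {a..b}"
      by (intro at_within_nhd[of _ S]) (auto simp: S_def)
    have f'c: "continuous_on {a..b} f'" using inc[of a b] a b by auto
    have "((\<lambda>u. f a + integral {a..u} f') has_vector_derivative f' x) (at x within {a..b})"
      using integral_has_vector_derivative[OF f'c, of x] a b by (auto intro!: derivative_eq_intros)
    then have "(f has_vector_derivative f' x) (at x within {a..b})"
    proof (rule has_vector_derivative_transform[rotated 2])
      show "x \<in> {a..b}" using a b by simp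
      show "f u = f a + integral {a..u} f'" if "u \<in> {a..b}" for u
        using inc[of a u] that a sub by (auto simp: algebra_simps)
    qed
    moreover have "continuous (at x within {a..b}) f'"
      using f'c a b by (simp add: continuous_on_eq_continuous_within)
    ultimately show ?thesis by (simp add: at)
  qed
  then show ?thesis
    by (simp add: continuously_differentiable_on_def continuous_on_eq_continuous_within)
qed

lemma compact_triangle: "compact {(t, s). a \<le> s \<and> s \<le> t \<and> t \<le> (b::real)}"
proof -
  have "{(t, s). a \<le> s \<and> s \<le> t \<and> t \<le> b} = ({a..b} \<times> {a..b}) \<inter> {p. snd p \<le> fst p}"
    by auto
  moreover have "closed {p::real \<times> real. snd p \<le> fst p}"
    by (intro closed_Collect_le continuous_intros)
  ultimately show ?thesis by (simp add: compact_Int_closed compact_Times)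
qed

section \<open>The generator equation\<close>

text \<open>
  The unperturbed problem on a time window, seen through functionals, with the value \<open>l\<close> prescribed at
  the final time \<open>b\<close>.  All assumptions concern the window alone and all integrals are scalar; this makes
  the assumptions invariant under the reversal \<open>r \<mapsto> a + b - r\<close>.
\<close>

locale dual_cauchy = banach_scale_space X for X :: "('k::{real_normed_field,banach}, 'a::ab_group_add) scale_data" +
  fixes A B :: "real \<Rightarrow> real \<Rightarrow> real \<Rightarrow> 'a \<Rightarrow> 'a" and V :: "real \<Rightarrow> real \<Rightarrow> real \<Rightarrow> real \<Rightarrow> 'a \<Rightarrow> 'a"
    and a b \<alpha>' :: real and l :: "'a \<Rightarrow> 'k"
  assumes low: "low X < \<alpha>'" and l: "bounded_functional X \<alpha>' l"
    and A_ops: "\<And>r. r \<in> {a..b} \<Longrightarrow> A r \<in> scale_ops X"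
    and B_ops: "\<And>r. r \<in> {a..b} \<Longrightarrow> B r \<in> scale_ops X"
    and V_ops: "\<And>s t. a \<le> s \<Longrightarrow> s \<le> t \<Longrightarrow> t \<le> b \<Longrightarrow> V t s \<in> scale_ops X"
    and A_fam: "\<And>\<beta> \<gamma>. low X < \<beta> \<Longrightarrow> \<beta> < \<gamma> \<Longrightarrow> operator_family X \<gamma> \<beta> {a..b} (\<lambda>r. A r \<gamma> \<beta>)"
    and B_fam: "\<And>\<beta> \<gamma>. low X < \<beta> \<Longrightarrow> \<beta> < \<gamma> \<Longrightarrow> operator_family X \<gamma> \<beta> {a..b} (\<lambda>r. B r \<gamma> \<beta>)"
    and V_fam: "\<And>\<beta> \<gamma>. low X < \<beta> \<Longrightarrow> \<beta> < \<gamma> \<Longrightarrow>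
      operator_family X \<gamma> \<beta> {(t, s). a \<le> s \<and> s \<le> t \<and> t \<le> b} (\<lambda>(t, s). V t s \<gamma> \<beta>)"
    and V_left: "\<And>\<beta> \<mu> \<gamma> f k s t. low X < \<beta> \<Longrightarrow> \<beta> < \<mu> \<Longrightarrow> \<mu> < \<gamma> \<Longrightarrow> bounded_functional X \<beta> f \<Longrightarrow> k \<in> spc X \<gamma> \<Longrightarrow>
      a \<le> s \<Longrightarrow> s \<le> t \<Longrightarrow> t \<le> b \<Longrightarrow>
      ((\<lambda>r. f (A r \<mu> \<beta> (V r s \<gamma> \<mu> k))) has_integral f (V t s \<gamma> \<beta> k - k)) {s..t}"
    and V_right: "\<And>\<beta> \<mu> \<gamma> f k s t. low X < \<beta> \<Longrightarrow> \<beta> < \<mu> \<Longrightarrow> \<mu> < \<gamma> \<Longrightarrow> bounded_functional X \<beta> f \<Longrightarrow> k \<in> spc X \<gamma> \<Longrightarrow>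
      a \<le> s \<Longrightarrow> s \<le> t \<Longrightarrow> t \<le> b \<Longrightarrow>
      ((\<lambda>r. f (V t r \<mu> \<beta> (A r \<gamma> \<mu> k))) has_integral f (V t s \<gamma> \<beta> k - k)) {s..t}"
begin

abbreviation Triangle where "Triangle \<equiv> {(t, s). a \<le> s \<and> s \<le> t \<and> t \<le> b}"

text \<open>
  The variation of constants formula for the functionals \<open>f s\<close> on \<open>spc X \<beta>\<close>, tested with the vectors of
  the smaller space \<open>spc X \<gamma>\<close>.  The functionals \<open>f s = l \<circ> W(b,s)\<close> are the main example.
\<close>

definition duhamel :: "real \<Rightarrow> real \<Rightarrow> (real \<Rightarrow> 'a \<Rightarrow> 'k) \<Rightarrow> bool" where
  "duhamel \<beta> \<gamma> f \<longleftrightarrow> (\<forall>s\<in>{a..b}. \<forall>k\<in>spc X \<gamma>.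
     ((\<lambda>r. f r (scale_comp (B r) (V r s) \<gamma> \<beta> k)) has_integral f s k - l (V b s \<gamma> \<alpha>' k)) {s..b})"

text \<open>
  The formula at \<open>\<gamma>\<close> is expanded by the integral equation of \<open>V\<close>.  After the exchange of integrals the formula
  at the intermediate index \<open>\<nu>\<close>, applied to \<open>A u \<gamma> \<nu> k\<close>, evaluates the inner integral.
\<close>

lemma generator_equation_of_duhamel:
  assumes \<beta>: "\<alpha>' < \<beta>" "\<beta> < \<nu>" "\<nu> < \<gamma>" and f: "functional_family X \<beta> {a..b} f"
    and d: "duhamel \<beta> \<nu> f" "duhamel \<beta> \<gamma> f" and k: "k \<in> spc X \<gamma>" and s: "s \<in> {a..b}"
  shows "continuous_on {a..b} (\<lambda>u. f u (A u \<gamma> \<beta> k + B u \<gamma> \<beta> k))"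
    and "((\<lambda>u. f u (A u \<gamma> \<beta> k + B u \<gamma> \<beta> k)) has_integral f s k - l k) {s..b}"
proof -
  obtain \<mu> where \<mu>: "\<beta> < \<mu>" "\<mu> < \<nu>" using dense[OF \<beta>(2)] by blast
  have lo: "low X < \<beta>" "low X < \<mu>" "low X < \<nu>" "low X < \<gamma>" using low \<beta> \<mu> by linarith+
  have fb: "bounded_functional X \<beta> (f r)" if "r \<in> {a..b}" for r using f that by (simp add: functional_family_def)
  have Ain: "A u \<gamma> \<rho> k \<in> spc X \<rho>" and Bin: "B u \<gamma> \<rho> k \<in> spc X \<rho>" if "u \<in> {a..b}" "low X < \<rho>" "\<rho> < \<gamma>" for u \<rho>
    using scale_ops_in[OF A_ops] scale_ops_in[OF B_ops] that k by auto
  have Acont: "cont_into X \<rho> {a..b} (\<lambda>u. A u \<gamma> \<rho> k)" and Bcont: "cont_into X \<rho> {a..b} (\<lambda>u. B u \<gamma> \<rho> k)"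
    if "low X < \<rho>" "\<rho> < \<gamma>" for \<rho>
    using A_fam[OF that] B_fam[OF that] k by (simp_all add: operator_family_def)
  define G where "G = (\<lambda>r u. f r (B r \<mu> \<beta> (V r u \<nu> \<mu> (A u \<gamma> \<nu> k))))"
  have Gcont: "continuous_on Triangle (\<lambda>(r, u). G r u)"
  proof -
    have "cont_into X \<nu> Triangle (\<lambda>p. A (snd p) \<gamma> \<nu> k)"
      by (rule cont_into_compose[OF Acont]) (use lo \<beta> in \<open>auto intro!: continuous_intros\<close>)
    from operator_family_apply[OF V_fam[OF lo(2) \<mu>(2)] compact_triangle this lo(3) lo(2)]
    have x: "cont_into X \<mu> Triangle (\<lambda>p. V (fst p) (snd p) \<nu> \<mu> (A (snd p) \<gamma> \<nu> k))"
      by (simp add: split_beta)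
    have "operator_family X \<mu> \<beta> Triangle (\<lambda>p. B (fst p) \<mu> \<beta>)"
      by (rule operator_family_compose[OF B_fam[OF lo(1) \<mu>(1)]]) (use lo in \<open>auto intro!: continuous_intros\<close>)
    from operator_family_apply[OF this compact_triangle x lo(2) lo(1)]
    have y: "cont_into X \<beta> Triangle (\<lambda>p. B (fst p) \<mu> \<beta> (V (fst p) (snd p) \<nu> \<mu> (A (snd p) \<gamma> \<nu> k)))" .
    have "functional_family X \<beta> Triangle (\<lambda>p. f (fst p))"
      by (rule functional_family_compose[OF f]) (auto intro!: continuous_intros)
    from functional_family_apply[OF this compact_triangle y lo(1)]
    show ?thesis by (simp add: G_def split_beta)
  qed
  define gA where "gA = (\<lambda>u. f u (A u \<gamma> \<beta> k))"
  define gB where "gB = (\<lambda>u. f u (B u \<gamma> \<beta> k))"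
  have cA: "continuous_on {a..b} gA" and cB: "continuous_on {a..b} gB"
    unfolding gA_def gB_def using \<beta>
    by (auto intro!: functional_family_apply[OF f _ _ lo(1)] Acont[OF lo(1)] Bcont[OF lo(1)])
  have eq: "f u (A u \<gamma> \<beta> k + B u \<gamma> \<beta> k) = gA u + gB u" if "u \<in> {a..b}" for u
    unfolding gA_def gB_def using Ain Bin that \<beta> lo by (intro functional_add[OF fb]) auto
  show "continuous_on {a..b} (\<lambda>u. f u (A u \<gamma> \<beta> k + B u \<gamma> \<beta> k))"
    using continuous_on_add[OF cA cB] by (rule continuous_on_eq) (simp add: eq)
  have iA: "gA integrable_on {s..b}" and iB: "gB integrable_on {s..b}"
    using s by (auto intro!: integrable_continuous_real continuous_on_subset[OF cA] continuous_on_subset[OF cB])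
  have inner_u: "integral {s..r} (G r) = f r (scale_comp (B r) (V r s) \<gamma> \<beta> k) - gB r" if r: "r \<in> {s..b}" for r
  proof -
    have r': "r \<in> {a..b}" using r s by auto
    have Vr: "V r s \<in> scale_ops X" using V_ops r s by auto
    have bo: "bounded_op X \<mu> \<beta> (B r \<mu> \<beta>)" using scale_ops_bounded[OF B_ops[OF r'] lo(1) \<mu>(1)] .
    have bf: "bounded_functional X \<mu> (\<lambda>y. f r (B r \<mu> \<beta> y))" by (rule functional_op[OF fb[OF r'] bo lo(2) lo(1)])
    have "((\<lambda>u. f r (B r \<mu> \<beta> (V r u \<nu> \<mu> (A u \<gamma> \<nu> k)))) has_integral f r (B r \<mu> \<beta> (V r s \<gamma> \<mu> k - k))) {s..r}"
      using V_right[OF lo(2) \<mu>(2) \<beta>(3) bf k, of s r] s r by auto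
    then have "integral {s..r} (G r) = f r (B r \<mu> \<beta> (V r s \<gamma> \<mu> k - k))"
      unfolding G_def by (rule integral_unique)
    also have "\<dots> = f r (B r \<mu> \<beta> (V r s \<gamma> \<mu> k)) - f r (B r \<mu> \<beta> k)"
      using functional_diff[OF bf lo(2)] scale_ops_in[OF Vr lo(2) _ k] spc_mono[OF lo(2) _ k] \<beta> \<mu> by auto
    also have "B r \<mu> \<beta> (V r s \<gamma> \<mu> k) = scale_comp (B r) (V r s) \<gamma> \<beta> k"
      using scale_comp_eq[OF B_ops[OF r'] Vr lo(1) \<mu>(1) _ k] \<mu> \<beta> by simp
    also have "B r \<mu> \<beta> k = B r \<gamma> \<beta> k"
      using scale_ops_eq[OF B_ops[OF r'] lo(1) \<mu>(1) lo(1), of \<gamma> k] spc_mono[OF lo(2) _ k] k \<mu> \<beta> by auto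
    finally show ?thesis by (simp add: gB_def)
  qed
  have inner_r: "integral {u..b} (\<lambda>r. G r u) = gA u - l (V b u \<nu> \<alpha>' (A u \<gamma> \<nu> k))" if u: "u \<in> {s..b}" for u
  proof -
    have u': "u \<in> {a..b}" using u s by auto
    have x: "A u \<gamma> \<nu> k \<in> spc X \<nu>" using Ain u' lo \<beta> by auto
    have "((\<lambda>r. f r (scale_comp (B r) (V r u) \<nu> \<beta> (A u \<gamma> \<nu> k))) has_integral
        f u (A u \<gamma> \<nu> k) - l (V b u \<nu> \<alpha>' (A u \<gamma> \<nu> k))) {u..b}"
      using d(1) u' x by (auto simp: duhamel_def)
    moreover have "scale_comp (B r) (V r u) \<nu> \<beta> (A u \<gamma> \<nu> k) = B r \<mu> \<beta> (V r u \<nu> \<mu> (A u \<gamma> \<nu> k))" if "r \<in> {u..b}" for r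
      using scale_comp_eq[OF B_ops V_ops lo(1) \<mu> x] that u' by auto
    ultimately have "((\<lambda>r. G r u) has_integral f u (A u \<gamma> \<nu> k) - l (V b u \<nu> \<alpha>' (A u \<gamma> \<nu> k))) {u..b}"
      unfolding G_def by (subst has_integral_cong) auto
    moreover have "A u \<gamma> \<nu> k = A u \<gamma> \<beta> k"
      using scale_ops_eq[OF A_ops[OF u'] lo(3) _ lo(1) _ k k] \<beta> by auto
    ultimately show ?thesis unfolding gA_def by (simp add: integral_unique)
  qed
  have lV: "((\<lambda>u. l (V b u \<nu> \<alpha>' (A u \<gamma> \<nu> k))) has_integral l (V b s \<gamma> \<alpha>' k - k)) {s..b}"
    using V_right[OF low _ \<beta>(3) l k, of s b] s \<beta> by auto
  have "integral {s..b} (\<lambda>r. integral {s..r} (G r)) = integral {s..b} (\<lambda>u. integral {u..b} (\<lambda>r. G r u))"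
    by (rule integral_swap_triangle) (use s in \<open>auto intro: continuous_on_subset[OF Gcont]\<close>)
  moreover have "((\<lambda>r. f r (scale_comp (B r) (V r s) \<gamma> \<beta> k) - gB r) has_integral
      (f s k - l (V b s \<gamma> \<alpha>' k)) - integral {s..b} gB) {s..b}"
    using d(2) s k by (intro has_integral_diff integrable_integral[OF iB]) (auto simp: duhamel_def)
  then have "integral {s..b} (\<lambda>r. integral {s..r} (G r)) = (f s k - l (V b s \<gamma> \<alpha>' k)) - integral {s..b} gB"
    by (subst integral_cong[OF inner_u]) (auto intro: integral_unique)
  moreover have "((\<lambda>u. gA u - l (V b u \<nu> \<alpha>' (A u \<gamma> \<nu> k))) has_integral
      integral {s..b} gA - l (V b s \<gamma> \<alpha>' k - k)) {s..b}"
    by (intro has_integral_diff integrable_integral[OF iA] lV)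
  then have "integral {s..b} (\<lambda>u. integral {u..b} (\<lambda>r. G r u)) = integral {s..b} gA - l (V b s \<gamma> \<alpha>' k - k)"
    by (subst integral_cong[OF inner_r]) (auto intro: integral_unique)
  moreover have "l (V b s \<gamma> \<alpha>' k - k) = l (V b s \<gamma> \<alpha>' k) - l k"
    using s \<beta> by (intro functional_diff[OF l low] scale_ops_in[OF V_ops _ _ k] spc_mono[OF low _ k] low) auto
  ultimately have val: "integral {s..b} gA + integral {s..b} gB = f s k - l k" by (simp add: algebra_simps)
  have "((\<lambda>u. gA u + gB u) has_integral f s k - l k) {s..b}"
    unfolding val[symmetric] by (intro has_integral_add integrable_integral iA iB)
  then show "((\<lambda>u. f u (A u \<gamma> \<beta> k + B u \<gamma> \<beta> k)) has_integral f s k - l k) {s..b}"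
    by (rule has_integral_eq[rotated]) (use s in \<open>auto simp: eq\<close>)
qed

end

section \<open>Weak solutions satisfy the variation of constants formula\<close>

context dual_cauchy begin

lemma generator_bounded_op:
  assumes \<beta>: "low X < \<beta>" "\<beta> < \<mu>" and r: "r \<in> {a..b}"
  shows "bounded_op X \<mu> \<beta> (A r \<mu> \<beta>)" "bounded_op X \<mu> \<beta> (B r \<mu> \<beta>)"
  using scale_ops_bounded[OF A_ops[OF r] \<beta>] scale_ops_bounded[OF B_ops[OF r] \<beta>] .

text \<open>
  The index loss of \<open>A + B\<close> is compensated by testing with the smaller space \<open>spc X \<mu>\<close>.
\<close>

lemma functional_generator:
  assumes f: "functional_family X \<beta> {a..b} f" and \<beta>: "low X < \<beta>" "\<beta> < \<mu>" and r: "r \<in> {a..b}"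
  shows "bounded_functional X \<mu> (\<lambda>x. f r (A r \<mu> \<beta> x + B r \<mu> \<beta> x))"
proof -
  have fb: "bounded_functional X \<beta> (f r)" using f r by (simp add: functional_family_def)
  have \<mu>: "low X < \<mu>" using \<beta> by simp
  note ops = generator_bounded_op[OF \<beta> r]
  have eq: "f r (A r \<mu> \<beta> x + B r \<mu> \<beta> x) = f r (A r \<mu> \<beta> x) + f r (B r \<mu> \<beta> x)" if "x \<in> spc X \<mu>" for x
    using functional_add[OF fb] bounded_opD(1)[OF ops(1) that] bounded_opD(1)[OF ops(2) that] .
  have "bounded_functional X \<mu> (\<lambda>x. f r (A r \<mu> \<beta> x) + f r (B r \<mu> \<beta> x))"
    by (intro functional_plus functional_op[OF fb _ \<mu> \<beta>(1)] ops)
  then show ?thesis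
    unfolding bounded_functional_def using eq spc_add[OF \<mu>] spc_smult[OF \<mu>] by simp
qed

lemma functional_family_generator:
  assumes f: "functional_family X \<beta> {a..b} f" and \<beta>: "low X < \<beta>" "\<beta> < \<mu>"
  shows "functional_family X \<mu> {a..b} (\<lambda>r x. f r (A r \<mu> \<beta> x + B r \<mu> \<beta> x))"
  unfolding functional_family_def
proof (intro conjI ballI)
  show "bounded_functional X \<mu> (\<lambda>x. f r (A r \<mu> \<beta> x + B r \<mu> \<beta> x))" if "r \<in> {a..b}" for r
    by (rule functional_generator[OF f \<beta> that])
  show "continuous_on {a..b} (\<lambda>r. f r (A r \<mu> \<beta> k + B r \<mu> \<beta> k))" if "k \<in> spc X \<mu>" for k
    using A_fam[OF \<beta>] B_fam[OF \<beta>] that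
    by (intro functional_family_apply[OF f compact_Icc _ \<beta>(1)] cont_into_add \<beta>) (simp_all add: operator_family_def)
qed

text \<open>
  Both sides are bounded functionals on \<open>spc X \<mu>\<close>; for the integral this uses the uniform bound on the
  functionals \<open>f r\<close> over the window.
\<close>

lemma weak_equation_of_dense:
  assumes f: "functional_family X \<beta> {a..b} f" and \<beta>: "\<alpha>' \<le> \<beta>" "\<beta> < \<mu>"
    and dense: "stop X \<mu> closure_of Y = spc X \<mu>"
    and eq: "\<And>y. y \<in> Y \<Longrightarrow> f s y = l y + integral {s..b} (\<lambda>r. f r (A r \<mu> \<beta> y + B r \<mu> \<beta> y))"
    and s: "s \<in> {a..b}" and k: "k \<in> spc X \<mu>"
  shows "f s k = l k + integral {s..b} (\<lambda>r. f r (A r \<mu> \<beta> k + B r \<mu> \<beta> k))"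
proof -
  have lo: "low X < \<beta>" "low X < \<mu>" using low \<beta> by linarith+
  define g where "g = (\<lambda>r x. f r (A r \<mu> \<beta> x + B r \<mu> \<beta> x))"
  have g: "functional_family X \<mu> {a..b} g" unfolding g_def by (rule functional_family_generator[OF f lo(1) \<beta>(2)])
  have gb: "bounded_functional X \<mu> (g r)" if "r \<in> {s..b}" for r using g that s by (auto simp: functional_family_def)
  have gc: "continuous_on {s..b} (\<lambda>r. g r x)" if "x \<in> spc X \<mu>" for x
    using g that s by (auto simp: functional_family_def intro: continuous_on_subset)
  have gi: "(\<lambda>r. g r x) integrable_on {s..b}" if "x \<in> spc X \<mu>" for x
    using gc[OF that] by (rule integrable_continuous_real)
  obtain C where C: "C \<ge> 0" "\<And>r x. r \<in> {a..b} \<Longrightarrow> x \<in> spc X \<mu> \<Longrightarrow> norm (g r x) \<le> C * nrm X \<mu> x"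
    using functional_family_bound[OF g compact_Icc lo(2)] by blast
  have I: "bounded_functional X \<mu> (\<lambda>x. integral {s..b} (\<lambda>r. g r x))"
    unfolding bounded_functional_def
  proof (intro conjI ballI allI exI)
    fix x y assume xy: "x \<in> spc X \<mu>" "y \<in> spc X \<mu>"
    have "integral {s..b} (\<lambda>r. g r (x + y)) = integral {s..b} (\<lambda>r. g r x + g r y)"
      using xy functional_add[OF gb] by (intro integral_cong) auto
    then show "integral {s..b} (\<lambda>r. g r (x + y)) = integral {s..b} (\<lambda>r. g r x) + integral {s..b} (\<lambda>r. g r y)"
      using integral_add[OF gi[OF xy(1)] gi[OF xy(2)]] by simp
  next
    fix c x assume x: "x \<in> spc X \<mu>"
    have "integral {s..b} (\<lambda>r. g r (smult X c x)) = integral {s..b} (\<lambda>r. c * g r x)"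
      using x gb by (intro integral_cong) (auto simp: bounded_functional_def)
    then show "integral {s..b} (\<lambda>r. g r (smult X c x)) = c * integral {s..b} (\<lambda>r. g r x)"
      using integral_mult_right[of "{s..b}" c "\<lambda>r. g r x"] by simp
  next
    fix x assume x: "x \<in> spc X \<mu>"
    have "norm (integral {s..b} (\<lambda>r. g r x)) \<le> C * nrm X \<mu> x * (b - s)"
      using s x C(2) by (intro integral_bound gc) auto
    then show "norm (integral {s..b} (\<lambda>r. g r x)) \<le> C * (b - s) * nrm X \<mu> x" by (simp add: algebra_simps)
  qed
  have fb: "bounded_functional X \<beta> (f s)" using f s by (simp add: functional_family_def)
  have "f s k = l k + integral {s..b} (\<lambda>r. g r k)"
    using eq \<beta>
    by (intro functional_dense_eq[OF functional_mono[OF fb lo(1)] functional_plus[OF functional_mono[OF l low] I] lo(2) dense _ k])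
       (auto simp: g_def)
  then show ?thesis by (simp add: g_def)
qed

text \<open>
  Apply the weak equation to the vectors \<open>A(u)V(u,s)k\<close> and integrate over \<open>u\<close>.  By the first integral
  equation of \<open>V\<close> the inner integrals over \<open>u\<close> collapse to \<open>V(r,s)k - k\<close>.  The terms with \<open>A\<close> then cancel and
  the terms with \<open>B\<close> form the variation of constants formula.
\<close>

lemma duhamel_of_weak_equation:
  assumes f: "functional_family X \<beta> {a..b} f" and \<beta>: "\<alpha>' \<le> \<beta>" "\<beta> < \<gamma>"
    and weak: "\<And>\<mu> s x. \<beta> < \<mu> \<Longrightarrow> s \<in> {a..b} \<Longrightarrow> x \<in> spc X \<mu> \<Longrightarrow>
      f s x = l x + integral {s..b} (\<lambda>r. f r (A r \<mu> \<beta> x + B r \<mu> \<beta> x))"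
  shows "duhamel \<beta> \<gamma> f"
  unfolding duhamel_def
proof (intro ballI)
  fix s k assume s: "s \<in> {a..b}" and k: "k \<in> spc X \<gamma>"
  obtain \<nu> where \<nu>: "\<beta> < \<nu>" "\<nu> < \<gamma>" using dense[OF \<beta>(2)] by blast
  obtain \<mu> where \<mu>: "\<beta> < \<mu>" "\<mu> < \<nu>" using dense[OF \<nu>(1)] by blast
  have lo: "low X < \<beta>" "low X < \<mu>" "low X < \<nu>" "low X < \<gamma>" using low \<beta> \<mu> \<nu> by linarith+
  have fb: "bounded_functional X \<beta> (f r)" if "r \<in> {a..b}" for r using f that by (simp add: functional_family_def)
  have sub: "{s..b} \<subseteq> {a..b}" using s by auto
  let ?T = "{(t, u). s \<le> u \<and> u \<le> t \<and> t \<le> b}"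
  have Vin: "V u s \<gamma> \<rho> k \<in> spc X \<rho>" if "u \<in> {s..b}" "low X < \<rho>" "\<rho> < \<gamma>" for u \<rho>
    using scale_ops_in[OF V_ops _ _ k] that s by auto
  have Vcont: "cont_into X \<rho> {s..b} (\<lambda>u. V u s \<gamma> \<rho> k)" if "low X < \<rho>" "\<rho> < \<gamma>" for \<rho>
  proof -
    have "cont_into X \<rho> Triangle (\<lambda>p. (\<lambda>(t, s). V t s \<gamma> \<rho>) p k)"
      using V_fam[OF that] k by (simp add: operator_family_def)
    moreover have "continuous_on {s..b} (\<lambda>u. (u, s))" by (intro continuous_intros)
    moreover have "(\<lambda>u. (u, s)) ` {s..b} \<subseteq> Triangle" using s by auto
    ultimately have "cont_into X \<rho> {s..b} (\<lambda>u. (\<lambda>(t, s). V t s \<gamma> \<rho>) (u, s) k)"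
      by (rule cont_into_compose[OF _ _ _ that(1)])
    then show ?thesis by simp
  qed
  define x where "x = (\<lambda>u. A u \<nu> \<mu> (V u s \<gamma> \<nu> k))"
  have xc: "cont_into X \<mu> {s..b} x"
  proof -
    have "operator_family X \<nu> \<mu> {s..b} (\<lambda>u. A u \<nu> \<mu>)"
      using operator_family_compose[OF A_fam[OF lo(2) \<mu>(2)], of "{s..b}" "\<lambda>u. u"] sub lo by auto
    from operator_family_apply[OF this compact_Icc Vcont lo(3) lo(2)] lo \<nu> show ?thesis by (simp add: x_def)
  qed
  have xin: "x u \<in> spc X \<mu>" if "u \<in> {s..b}" for u using cont_into_in[OF xc that] .
  define gen where "gen = (\<lambda>r y. f r (A r \<mu> \<beta> y + B r \<mu> \<beta> y))"
  have gen: "functional_family X \<mu> {a..b} gen" unfolding gen_def by (rule functional_family_generator[OF f lo(1) \<mu>(1)])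
  have genb: "bounded_functional X \<mu> (gen r)" if "r \<in> {s..b}" for r using gen that sub by (auto simp: functional_family_def)
  have Gcont: "continuous_on ?T (\<lambda>(r, u). gen r (x u))"
  proof -
    have "cont_into X \<mu> ?T (\<lambda>p. x (snd p))"
      by (rule cont_into_compose[OF xc _ _ lo(2)]) (auto intro!: continuous_intros)
    moreover have "functional_family X \<mu> ?T (\<lambda>p. gen (fst p))"
      using s by (intro functional_family_compose[OF gen]) (auto intro!: continuous_intros)
    ultimately show ?thesis
      using functional_family_apply[OF _ compact_triangle _ lo(2)] by (fastforce simp: split_beta)
  qed
  define Z where "Z = (\<lambda>r. f r (scale_comp (B r) (V r s) \<gamma> \<beta> k))"
  have inner_u: "integral {s..r} (\<lambda>u. gen r (x u)) = f r (x r) + Z r - gen r k" if r: "r \<in> {s..b}" for r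
  proof -
    have r': "r \<in> {a..b}" using r s by auto
    have Vr: "V r s \<in> scale_ops X" using V_ops r s by auto
    have "((\<lambda>u. gen r (x u)) has_integral gen r (V r s \<gamma> \<mu> k - k)) {s..r}"
      unfolding x_def using V_left[OF lo(2) \<mu>(2) \<nu>(2) genb[OF r] k, of s r] r s by auto
    then have "integral {s..r} (\<lambda>u. gen r (x u)) = gen r (V r s \<gamma> \<mu> k - k)"
      by (rule integral_unique)
    also have "\<dots> = gen r (V r s \<gamma> \<mu> k) - gen r k"
      using functional_diff[OF genb[OF r] lo(2)] Vin[OF r lo(2)] spc_mono[OF lo(2) _ k] \<mu> \<nu> by auto
    also have "gen r (V r s \<gamma> \<mu> k) = f r (A r \<mu> \<beta> (V r s \<gamma> \<mu> k)) + f r (B r \<mu> \<beta> (V r s \<gamma> \<mu> k))"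
    proof -
      have "V r s \<gamma> \<mu> k \<in> spc X \<mu>" using Vin[OF r lo(2)] \<mu> \<nu> by auto
      then show ?thesis unfolding gen_def
        using functional_add[OF fb[OF r']] generator_bounded_op[OF lo(1) \<mu>(1) r', THEN bounded_opD(1)] by blast
    qed
    also have "A r \<mu> \<beta> (V r s \<gamma> \<mu> k) = x r"
    proof -
      have "V r s \<gamma> \<mu> k = V r s \<gamma> \<nu> k"
        using scale_ops_eq[OF Vr lo(2) _ lo(3) \<nu>(2) k k] \<mu> \<nu> by auto
      moreover have "V r s \<gamma> \<nu> k \<in> spc X \<nu>" using Vin[OF r lo(3) \<nu>(2)] .
      ultimately show ?thesis unfolding x_def
        using scale_ops_eq[OF A_ops[OF r'] lo(1) \<mu>(1) lo(2) \<mu>(2)] spc_mono[OF lo(2), of \<nu>] \<mu> by auto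
    qed
    also have "B r \<mu> \<beta> (V r s \<gamma> \<mu> k) = scale_comp (B r) (V r s) \<gamma> \<beta> k"
      using scale_comp_eq[OF B_ops[OF r'] Vr lo(1) \<mu>(1) _ k] \<mu> \<nu> by simp
    finally show ?thesis by (simp add: Z_def)
  qed
  have inner_r: "integral {u..b} (\<lambda>r. gen r (x u)) = f u (x u) - l (x u)" if u: "u \<in> {s..b}" for u
    using weak[OF \<mu>(1) _ xin[OF u]] u sub by (auto simp: gen_def)
  have fx: "(\<lambda>u. f u (x u)) integrable_on {s..b}"
    by (intro integrable_continuous_real functional_family_apply[OF functional_family_subset[OF f sub] compact_Icc _ lo(1)]
        cont_into_mono[OF xc lo(1)]) (use \<mu> in auto)
  have kin: "k \<in> spc X \<mu>" using spc_mono[OF lo(2) _ k] \<mu> \<nu> by auto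
  have gk: "(\<lambda>r. gen r k) integrable_on {s..b}"
    using gen kin sub by (auto simp: functional_family_def intro!: integrable_continuous_real intro: continuous_on_subset)
  have gkval: "integral {s..b} (\<lambda>r. gen r k) = f s k - l k"
    using weak[OF \<mu>(1) s kin] by (simp add: gen_def)
  have lV: "((\<lambda>u. l (x u)) has_integral l (V b s \<gamma> \<alpha>' k) - l k) {s..b}"
  proof -
    have lm: "bounded_functional X \<mu> l" using functional_mono[OF l low] \<beta> \<mu> by auto
    have Vb: "V b s \<gamma> \<mu> k \<in> spc X \<mu>" using Vin[of b \<mu>] lo \<mu> \<nu> s by auto
    have "((\<lambda>u. l (x u)) has_integral l (V b s \<gamma> \<mu> k - k)) {s..b}"
      unfolding x_def using V_left[OF lo(2) \<mu>(2) \<nu>(2) lm k, of s b] s by auto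
    moreover have "l (V b s \<gamma> \<mu> k - k) = l (V b s \<gamma> \<mu> k) - l k"
      by (rule functional_diff[OF lm lo(2) Vb kin])
    moreover have "V b s \<gamma> \<mu> k = V b s \<gamma> \<alpha>' k"
      using scale_ops_eq[OF V_ops lo(2) _ low _ k k, of s b] s \<beta> \<mu> \<nu> by auto
    ultimately show ?thesis by simp
  qed
  have Zi: "Z integrable_on {s..b}"
  proof -
    have "operator_family X \<mu> \<beta> {s..b} (\<lambda>r. B r \<mu> \<beta>)"
      using operator_family_compose[OF B_fam[OF lo(1) \<mu>(1)], of "{s..b}" "\<lambda>u. u"] sub lo by auto
    from operator_family_apply[OF this compact_Icc Vcont lo(2) lo(1)] \<mu> \<nu> lo
    have "cont_into X \<beta> {s..b} (\<lambda>r. B r \<mu> \<beta> (V r s \<gamma> \<mu> k))" by simp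
    from functional_family_apply[OF functional_family_subset[OF f sub] compact_Icc this lo(1)]
    have "continuous_on {s..b} (\<lambda>r. f r (B r \<mu> \<beta> (V r s \<gamma> \<mu> k)))" .
    moreover have "B r \<mu> \<beta> (V r s \<gamma> \<mu> k) = scale_comp (B r) (V r s) \<gamma> \<beta> k" if "r \<in> {s..b}" for r
      using scale_comp_eq[OF B_ops V_ops lo(1) \<mu>(1) _ k, of r s r] that s \<mu> \<nu> by auto
    ultimately have "continuous_on {s..b} Z" unfolding Z_def by (auto elim: continuous_on_eq)
    then show ?thesis by (rule integrable_continuous_real)
  qed
  have "integral {s..b} (\<lambda>r. integral {s..r} (\<lambda>u. gen r (x u))) = integral {s..b} (\<lambda>u. integral {u..b} (\<lambda>r. gen r (x u)))"
    by (rule integral_swap_triangle[OF _ Gcont]) (use s in auto)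
  moreover have "integral {s..b} (\<lambda>r. integral {s..r} (\<lambda>u. gen r (x u)))
      = integral {s..b} (\<lambda>u. f u (x u)) + integral {s..b} Z - (f s k - l k)"
    unfolding gkval[symmetric]
    by (subst integral_cong[OF inner_u], assumption)
       (intro integral_unique has_integral_diff has_integral_add integrable_integral fx Zi gk)
  moreover have "integral {s..b} (\<lambda>u. integral {u..b} (\<lambda>r. gen r (x u)))
      = integral {s..b} (\<lambda>u. f u (x u)) - (l (V b s \<gamma> \<alpha>' k) - l k)"
    by (subst integral_cong[OF inner_r], assumption)
       (intro integral_unique has_integral_diff integrable_integral fx lV)
  ultimately have "integral {s..b} Z = f s k - l (V b s \<gamma> \<alpha>' k)" by (simp add: algebra_simps)
  with integrable_integral[OF Zi]
  show "((\<lambda>r. f r (scale_comp (B r) (V r s) \<gamma> \<beta> k)) has_integral f s k - l (V b s \<gamma> \<alpha>' k)) {s..b}"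
    by (simp add: Z_def)
qed

end

section \<open>Uniqueness for the homogeneous Volterra equation\<close>

context dual_cauchy begin

text \<open>
  In the step from \<open>n\<close> to \<open>n + 1\<close> the operator \<open>B(r)V(r,s)\<close> uses up the fraction \<open>1/(n+1)\<close> of the gap
  \<open>\<gamma> - \<beta>\<close>, and the induction hypothesis the remaining \<open>n/(n+1)\<close>.  This is the choice for which the two
  losses combine to a geometric bound, at the price of \<open>(1 + 1/n)\<^sup>n \<le> exp 1\<close>.  For \<open>n = 0\<close> no gap is needed,
  so \<open>\<gamma> = \<beta>\<close> is admitted there.
\<close>

lemma volterra_iterate_bound:
  assumes \<beta>: "low X < \<beta>" "\<beta> < c" and m: "functional_family X \<beta> {a..b} m"
    and eq: "\<And>\<gamma> s k. \<beta> < \<gamma> \<Longrightarrow> \<gamma> \<le> c \<Longrightarrow> s \<in> {a..b} \<Longrightarrow> k \<in> spc X \<gamma> \<Longrightarrow>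
      ((\<lambda>r. m r (scale_comp (B r) (V r s) \<gamma> \<beta> k)) has_integral m s k) {s..b}"
    and L: "L > 0" "\<And>\<rho> \<gamma> s r k. \<beta> \<le> \<rho> \<Longrightarrow> \<rho> < \<gamma> \<Longrightarrow> \<gamma> \<le> c \<Longrightarrow> a \<le> s \<Longrightarrow> s \<le> r \<Longrightarrow> r \<le> b \<Longrightarrow> k \<in> spc X \<gamma> \<Longrightarrow>
      nrm X \<rho> (scale_comp (B r) (V r s) \<gamma> \<rho> k) \<le> L / (\<gamma> - \<rho>) * nrm X \<gamma> k"
    and C: "C \<ge> 0" "\<And>r x. r \<in> {a..b} \<Longrightarrow> x \<in> spc X \<beta> \<Longrightarrow> norm (m r x) \<le> C * nrm X \<beta> x"
    and e: "e \<in> {a..b}" "\<And>r x. r \<in> {e..b} \<Longrightarrow> x \<in> spc X \<beta> \<Longrightarrow> m r x = 0"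
  shows "\<beta> \<le> \<gamma> \<Longrightarrow> \<gamma> \<le> c \<Longrightarrow> n = 0 \<or> \<beta> < \<gamma> \<Longrightarrow> s \<in> {a..e} \<Longrightarrow> k \<in> spc X \<gamma> \<Longrightarrow>
    norm (m s k) \<le> C * (L * exp 1 * (e - s) / (\<gamma> - \<beta>)) ^ n * nrm X \<gamma> k"
proof (induction n arbitrary: \<gamma> s k)
  case 0
  have "norm (m s k) \<le> C * nrm X \<beta> k"
    using 0 e by (intro C(2) spc_mono[OF \<beta>(1) _ 0(5)]) auto
  also have "\<dots> \<le> C * nrm X \<gamma> k" using nrm_mono[OF \<beta>(1) 0(1,5)] C(1) by (rule mult_left_mono)
  finally show ?case by simp
next
  case (Suc n)
  then have \<gamma>: "\<beta> < \<gamma>" "\<gamma> \<le> c" and s: "a \<le> s" "s \<le> e" "e \<le> b" and k: "k \<in> spc X \<gamma>" using e(1) by auto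
  \<comment> \<open>The gap is cut into \<open>n + 1\<close> pieces of length \<open>h\<close>; the last one, from \<open>\<rho>\<close> to \<open>\<gamma>\<close>, is for \<open>B(r)V(r,s)\<close>.\<close>
  define h where "h = (\<gamma> - \<beta>) / (n + 1)"
  define \<rho> where "\<rho> = \<beta> + h * n"
  have h: "h > 0" "\<gamma> - \<beta> = h * (n + 1)" using \<gamma> by (simp_all add: h_def)
  have \<rho>: "\<beta> \<le> \<rho>" "\<rho> < \<gamma>" "n = 0 \<or> \<beta> < \<rho>" "\<gamma> - \<rho> = h" "\<rho> - \<beta> = h * n"
    using h by (auto simp: \<rho>_def algebra_simps zero_less_mult_iff)
  have lo: "low X < \<gamma>" "low X < \<rho>" using \<beta> \<gamma> \<rho> by linarith+
  let ?z = "\<lambda>r. scale_comp (B r) (V r s) \<gamma> \<beta> k"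
  let ?q = "\<lambda>r. L * exp 1 * (e - r) / (\<gamma> - \<beta>)"
  have z: "?z r = scale_comp (B r) (V r s) \<gamma> \<rho> k" "?z r \<in> spc X \<rho>" if r: "r \<in> {s..b}" for r
  proof -
    obtain \<sigma> where \<sigma>: "\<rho> < \<sigma>" "\<sigma> < \<gamma>" using dense[OF \<rho>(2)] by blast
    have los: "low X < \<sigma>" using lo \<sigma> by linarith
    have Br: "B r \<in> scale_ops X" and Vr: "V r s \<in> scale_ops X" using B_ops V_ops r s by auto
    have Vk: "V r s \<gamma> \<sigma> k \<in> spc X \<sigma>" by (rule scale_ops_in[OF Vr los \<sigma>(2) k])
    have 1: "?z r = B r \<sigma> \<beta> (V r s \<gamma> \<sigma> k)" using scale_comp_eq[OF Br Vr \<beta>(1) _ \<sigma>(2) k] \<rho> \<sigma> by auto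
    have 2: "scale_comp (B r) (V r s) \<gamma> \<rho> k = B r \<sigma> \<rho> (V r s \<gamma> \<sigma> k)" by (rule scale_comp_eq[OF Br Vr lo(2) \<sigma> k])
    have 3: "B r \<sigma> \<beta> (V r s \<gamma> \<sigma> k) = B r \<sigma> \<rho> (V r s \<gamma> \<sigma> k)"
      using scale_ops_eq[OF Br \<beta>(1) _ lo(2) \<sigma>(1) Vk Vk] \<rho> \<sigma> by auto
    show "?z r = scale_comp (B r) (V r s) \<gamma> \<rho> k" using 1 2 3 by simp
    show "?z r \<in> spc X \<rho>" using 1 3 scale_ops_in[OF Br lo(2) \<sigma>(1) Vk] by simp
  qed
  define w where "w = L * exp 1 / (\<gamma> - \<beta>)"
  have q: "?q r = w * (e - r)" for r by (simp add: w_def)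
  have w: "w = exp 1 * (L / h) / (n + 1)" using h(1) unfolding w_def h(2) by simp
  define Q where "Q = C * w ^ n * exp 1 * (L / h * nrm X \<gamma> k)"
  have bound: "norm (m r (?z r)) \<le> Q * (e - r) ^ n" if r: "r \<in> {s..e}" for r
  proof -
    have rb: "r \<in> {s..b}" using r s by auto
    have 1: "norm (m r (?z r)) \<le> C * (L * exp 1 * (e - r) / (\<rho> - \<beta>)) ^ n * nrm X \<rho> (?z r)"
      using \<rho> \<gamma> r s by (intro Suc.IH z(2)[OF rb]) auto
    have 2: "(L * exp 1 * (e - r) / (\<rho> - \<beta>)) ^ n \<le> ?q r ^ n * exp 1"
    proof (cases "n = 0")
      case False
      have "L * exp 1 * (e - r) / (\<rho> - \<beta>) = ?q r * (1 + 1 / n)"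
      proof -
        have aux: "p / (h * n) = p / (h * (n + 1)) * (1 + 1 / n)" for p :: real
        proof -
          have "1 + 1 / real n = (n + 1) / n" using False by (simp add: field_simps)
          then show ?thesis by simp
        qed
        show ?thesis unfolding \<rho>(5) h(2) by (rule aux)
      qed
      then have "(L * exp 1 * (e - r) / (\<rho> - \<beta>)) ^ n = (?q r * (1 + 1 / n)) ^ n" by (rule arg_cong)
      also have "\<dots> = ?q r ^ n * (1 + 1 / n) ^ n" by (rule power_mult_distrib)
      also have "\<dots> \<le> ?q r ^ n * exp 1"
        using exp_ge_one_plus_x_over_n_power_n[of n 1] False r L(1) \<gamma>
        by (intro mult_left_mono) auto
      finally show ?thesis .
    qed simp
    have 3: "nrm X \<rho> (?z r) \<le> L / h * nrm X \<gamma> k"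
      using L(2)[OF \<rho>(1,2) \<gamma>(2), of s r k] s rb k \<rho>(4) z(1)[OF rb] by auto
    have "0 \<le> ?q r" using L(1) \<gamma> r by simp
    then have "C * (L * exp 1 * (e - r) / (\<rho> - \<beta>)) ^ n * nrm X \<rho> (?z r)
        \<le> C * (?q r ^ n * exp 1) * (L / h * nrm X \<gamma> k)"
      using C(1) nrm_ge0[OF lo(2) z(2)[OF rb]] by (intro mult_mono mult_left_mono 2 3) auto
    with 1 have "norm (m r (?z r)) \<le> C * (?q r ^ n * exp 1) * (L / h * nrm X \<gamma> k)" by (rule order_trans)
    then show ?thesis unfolding q power_mult_distrib Q_def by (simp add: mult_ac)
  qed
  have I: "((\<lambda>r. m r (?z r)) has_integral m s k) {s..b}" using eq[OF \<gamma> _ k, of s] s by auto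
  then have int: "(\<lambda>r. m r (?z r)) integrable_on {s..b}" by blast
  have "m s k = integral {s..e} (\<lambda>r. m r (?z r)) + integral {e..b} (\<lambda>r. m r (?z r))"
    using Henstock_Kurzweil_Integration.integral_combine[OF s(2,3) int] integral_unique[OF I] by simp
  also have "integral {e..b} (\<lambda>r. m r (?z r)) = 0"
  proof -
    have "m r (?z r) = 0" if "r \<in> {e..b}" for r
      using e(2)[OF that spc_mono[OF \<beta>(1) \<rho>(1) z(2)]] that s by auto
    then have "integral {e..b} (\<lambda>r. m r (?z r)) = integral {e..b} (\<lambda>_. 0)" by (rule integral_cong)
    then show ?thesis by simp
  qed
  finally have "norm (m s k) = norm (integral {s..e} (\<lambda>r. m r (?z r)))" by simp
  also have "\<dots> \<le> integral {s..e} (\<lambda>r. Q * (e - r) ^ n)"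
    using bound s by (intro integral_norm_bound_integral integrable_subinterval_real[OF int]
        integrable_continuous_real continuous_intros) auto
  also have "\<dots> = Q * (e - s) ^ Suc n / (n + 1)"
  proof -
    have "((\<lambda>r. - Q / real (Suc n) * (e - r) ^ Suc n) has_vector_derivative Q * (e - r) ^ n) (at r within {s..e})" for r
      unfolding has_real_derivative_iff_has_vector_derivative[symmetric]
      by (rule derivative_eq_intros refl)+ (simp del: of_nat_Suc)
    from fundamental_theorem_of_calculus[OF s(2) this]
    have "((\<lambda>r. Q * (e - r) ^ n) has_integral Q * (e - s) ^ Suc n / (n + 1)) {s..e}" by simp
    then show ?thesis by (rule integral_unique)
  qed
  also have "\<dots> = C * ?q s ^ Suc n * nrm X \<gamma> k"
  proof -
    have "w ^ Suc n = w ^ n * (exp 1 * (L / h) / (n + 1))" by (subst w[symmetric]) (rule power_Suc2)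
    then show ?thesis unfolding q power_mult_distrib Q_def by simp
  qed
  finally show ?case .
qed

text \<open>
  For \<open>e - s \<le> \<tau>\<close> the base of the geometric bound is at most \<open>1/2\<close>, so \<open>m s\<close> vanishes on \<open>spc X c\<close> and by
  density on \<open>spc X \<beta>\<close>.  As \<open>\<tau>\<close> does not depend on \<open>e\<close>, this propagates from \<open>b\<close> down to \<open>a\<close>.
\<close>

lemma volterra_unique:
  assumes \<beta>: "low X < \<beta>" "\<beta> < c" and m: "functional_family X \<beta> {a..b} m"
    and eq: "\<And>\<gamma> s k. \<beta> < \<gamma> \<Longrightarrow> \<gamma> \<le> c \<Longrightarrow> s \<in> {a..b} \<Longrightarrow> k \<in> spc X \<gamma> \<Longrightarrow>
      ((\<lambda>r. m r (scale_comp (B r) (V r s) \<gamma> \<beta> k)) has_integral m s k) {s..b}"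
    and L: "L > 0" "\<And>\<rho> \<gamma> s r k. \<beta> \<le> \<rho> \<Longrightarrow> \<rho> < \<gamma> \<Longrightarrow> \<gamma> \<le> c \<Longrightarrow> a \<le> s \<Longrightarrow> s \<le> r \<Longrightarrow> r \<le> b \<Longrightarrow> k \<in> spc X \<gamma> \<Longrightarrow>
      nrm X \<rho> (scale_comp (B r) (V r s) \<gamma> \<rho> k) \<le> L / (\<gamma> - \<rho>) * nrm X \<gamma> k"
    and dense: "stop X \<beta> closure_of spc X c = spc X \<beta>"
    and s: "s \<in> {a..b}" and k: "k \<in> spc X \<beta>"
  shows "m s k = 0"
proof -
  obtain C where C: "C \<ge> 0" "\<And>r x. r \<in> {a..b} \<Longrightarrow> x \<in> spc X \<beta> \<Longrightarrow> norm (m r x) \<le> C * nrm X \<beta> x"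
    using functional_family_bound[OF m compact_Icc \<beta>(1)] by blast
  have zero_functional: "bounded_functional X \<beta> (\<lambda>_. 0)" unfolding bounded_functional_def by (auto intro!: exI[of _ 0])
  have from_c: "m s k = 0" if s: "s \<in> {a..b}" and z: "\<And>k. k \<in> spc X c \<Longrightarrow> m s k = 0" and k: "k \<in> spc X \<beta>" for s k
  proof -
    have "bounded_functional X \<beta> (m s)" using m s by (simp add: functional_family_def)
    then show ?thesis by (rule functional_dense_eq[OF _ zero_functional \<beta>(1) dense _ k]) (rule z)
  qed
  define \<tau> where "\<tau> = (c - \<beta>) / (2 * L * exp 1)"
  have \<tau>: "\<tau> > 0" using \<beta> L(1) by (simp add: \<tau>_def)
  have "m s k = 0" if "s \<in> {a..b}" "b - s \<le> real j * \<tau>" "k \<in> spc X \<beta>" for j s k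
    using that
  proof (induction j arbitrary: s k)
    case 0
    then have sb: "s = b" by auto
    show ?case
    proof (rule from_c[OF 0(1) _ 0(3)])
      fix k assume "k \<in> spc X c"
      then have "((\<lambda>r. m r (scale_comp (B r) (V r b) c \<beta> k)) has_integral m b k) {b..b}"
        using eq[OF \<beta>(2) order.refl, of b k] 0 sb by auto
      from integral_unique[OF this] show "m s k = 0" using sb by simp
    qed
  next
    case (Suc j)
    define e where "e = min b (s + \<tau>)"
    have e: "e \<in> {a..b}" "s \<le> e" "e - s \<le> \<tau>" "b - e \<le> real j * \<tau>"
      using Suc.prems(1,2) \<tau> by (auto simp: e_def min_def algebra_simps)
    have zero: "m r x = 0" if "r \<in> {e..b}" "x \<in> spc X \<beta>" for r x
      using Suc.IH[of r x] that e by auto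
    show ?case
    proof (rule from_c[OF Suc.prems(1) _ Suc.prems(3)])
      fix k assume k: "k \<in> spc X c"
      have "norm (m s k) \<le> C * nrm X c k * (1 / 2) ^ n" for n
      proof -
        have "norm (m s k) \<le> C * (L * exp 1 * (e - s) / (c - \<beta>)) ^ n * nrm X c k"
          by (rule volterra_iterate_bound[OF \<beta> m eq L C e(1) zero _ _ _ _ k])
             (use Suc.prems(1) e(2) \<beta> in simp_all)
        also have "\<dots> \<le> C * (1 / 2) ^ n * nrm X c k"
        proof -
          have "L * exp 1 * (e - s) \<le> L * exp 1 * \<tau>" using e(3) L(1) by (intro mult_left_mono) auto
          also have "\<dots> = (c - \<beta>) / 2" using L(1) by (simp add: \<tau>_def)
          finally have "L * exp 1 * (e - s) / (c - \<beta>) \<le> 1 / 2" using \<beta> by (simp add: field_simps)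
          moreover have "0 \<le> L * exp 1 * (e - s) / (c - \<beta>)" using L(1) e(2) \<beta> by simp
          moreover have "0 \<le> nrm X c k" using nrm_ge0[OF _ k] \<beta> by auto
          ultimately show ?thesis using C(1) by (intro mult_right_mono mult_left_mono power_mono) auto
        qed
        finally show ?thesis by (simp add: mult_ac)
      qed
      moreover have "(\<lambda>n. C * nrm X c k * (1 / 2 :: real) ^ n) \<longlonglongrightarrow> C * nrm X c k * 0"
        by (intro tendsto_intros LIMSEQ_power_zero) simp
      ultimately have "norm (m s k) \<le> 0"
        by (intro LIMSEQ_le_const[of "\<lambda>n. C * nrm X c k * (1 / 2 :: real) ^ n" 0]) auto
      then show "m s k = 0" by simp
    qed
  qed
  moreover obtain j where "b - s \<le> real j * \<tau>" using reals_Archimedean3[OF \<tau>] less_imp_le by blast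
  ultimately show ?thesis using s k by blast
qed

end

section \<open>Perturbed families on a compact time window\<close>

text \<open>
  Here \<open>U s \<gamma>\<close> stands for \<open>W(b,s)\<close> from \<open>spc X \<gamma>\<close> to \<open>spc X \<alpha>'\<close>, and \<open>\<Gamma>\<close> for the indices \<open>\<gamma>\<close> with
  \<open>b - a < T(\<alpha>',\<gamma>)\<close>.  That \<open>\<Gamma>\<close> is open provides the intermediate indices below.
\<close>

locale perturbed_dual_cauchy = dual_cauchy +
  fixes U :: "real \<Rightarrow> real \<Rightarrow> 'b \<Rightarrow> 'b" and \<Gamma> :: "real set"
  assumes \<Gamma>: "open \<Gamma>" "\<Gamma> \<subseteq> {\<alpha>'<..}"
    and U_fam: "\<And>\<gamma>. \<gamma> \<in> \<Gamma> \<Longrightarrow> operator_family X \<gamma> \<alpha>' {a..b} (\<lambda>s. U s \<gamma>)"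
    and U_eq: "\<And>\<beta> \<gamma> s k. \<beta> \<in> \<Gamma> \<Longrightarrow> \<gamma> \<in> \<Gamma> \<Longrightarrow> \<beta> < \<gamma> \<Longrightarrow> s \<in> {a..b} \<Longrightarrow> k \<in> spc X \<gamma> \<Longrightarrow> U s \<gamma> k = U s \<beta> k"
    and U_duhamel: "\<And>\<beta> \<gamma> s k. \<beta> \<in> \<Gamma> \<Longrightarrow> \<gamma> \<in> \<Gamma> \<Longrightarrow> \<beta> < \<gamma> \<Longrightarrow> s \<in> {a..b} \<Longrightarrow> k \<in> spc X \<gamma> \<Longrightarrow>
      ((\<lambda>r. l (U r \<beta> (scale_comp (B r) (V r s) \<gamma> \<beta> k))) has_integral l (U s \<gamma> k) - l (V b s \<gamma> \<alpha>' k)) {s..b}"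
begin

lemma U_functional_family:
  assumes "\<beta> \<in> \<Gamma>"
  shows "functional_family X \<beta> {a..b} (\<lambda>s k. l (U s \<beta> k))"
proof -
  have lo: "low X < \<beta>" using \<Gamma> assms low by auto
  have lf: "functional_family X \<alpha>' {a..b} (\<lambda>_. l)" using l by (simp add: functional_family_def)
  show ?thesis
    using U_fam[OF assms] functional_op[OF l _ lo low] functional_family_apply[OF lf compact_Icc _ low]
    unfolding operator_family_def functional_family_def by blast
qed

lemma U_satisfies_duhamel: "\<beta> \<in> \<Gamma> \<Longrightarrow> \<gamma> \<in> \<Gamma> \<Longrightarrow> \<beta> < \<gamma> \<Longrightarrow> duhamel \<beta> \<gamma> (\<lambda>s k. l (U s \<beta> k))"
  unfolding duhamel_def using U_duhamel U_eq by simp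

lemma generator_equation:
  assumes \<beta>: "\<beta> \<in> \<Gamma>" and \<gamma>: "\<gamma> \<in> \<Gamma>" "\<beta> < \<gamma>" and k: "k \<in> spc X \<gamma>"
    and xy: "a \<le> x" "x \<le> y" "y \<le> b"
  shows "continuous_on {x..y} (\<lambda>u. l (U u \<beta> (A u \<gamma> \<beta> k + B u \<gamma> \<beta> k)))"
    and "l (U x \<gamma> k) - l (U y \<gamma> k) = integral {x..y} (\<lambda>u. l (U u \<beta> (A u \<gamma> \<beta> k + B u \<gamma> \<beta> k)))"
proof -
  let ?g = "\<lambda>u. l (U u \<beta> (A u \<gamma> \<beta> k + B u \<gamma> \<beta> k))"
  obtain e where e: "e > 0" "\<And>\<nu>. dist \<nu> \<gamma> < e \<Longrightarrow> \<nu> \<in> \<Gamma>" using \<Gamma>(1) \<gamma>(1) by (meson open_dist)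
  \<comment> \<open>An index of \<open>\<Gamma>\<close> strictly between \<open>\<beta>\<close> and \<open>\<gamma>\<close>, close enough to \<open>\<gamma>\<close>.\<close>
  define \<nu> where "\<nu> = max (\<gamma> - e / 2) ((\<beta> + \<gamma>) / 2)"
  have \<nu>: "\<beta> < \<nu>" "\<nu> < \<gamma>" "\<nu> \<in> \<Gamma>" using e(1) \<gamma>(2) by (auto simp: \<nu>_def dist_real_def max_def intro!: e(2))
  have \<beta>': "\<alpha>' < \<beta>" using \<Gamma> \<beta> by auto
  note gen = generator_equation_of_duhamel[OF \<beta>' \<nu>(1,2) U_functional_family[OF \<beta>] U_satisfies_duhamel[OF \<beta> \<nu>(3,1)] U_satisfies_duhamel[OF \<beta> \<gamma>] k]
  have c: "continuous_on {a..b} ?g" using gen(1)[of a] xy by auto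
  show "continuous_on {x..y} ?g" by (rule continuous_on_subset[OF c]) (use xy in auto)
  have "(?g has_integral l (U s \<gamma> k) - l k) {s..b}" if "s \<in> {a..b}" for s
    using gen(2)[OF that] U_eq[OF \<beta> \<gamma> that k] by simp
  from integral_unique[OF this[of x]] integral_unique[OF this[of y]] xy
  have i: "integral {x..b} ?g = l (U x \<gamma> k) - l k" "integral {y..b} ?g = l (U y \<gamma> k) - l k" by auto
  have i3: "integral {x..y} ?g + integral {y..b} ?g = integral {x..b} ?g"
    using xy by (intro Henstock_Kurzweil_Integration.integral_combine integrable_continuous_real
        continuous_on_subset[OF c]) auto
  have "l (U x \<gamma> k) - l (U y \<gamma> k) = integral {x..b} ?g - integral {y..b} ?g" unfolding i by simp
  also have "\<dots> = integral {x..y} ?g" unfolding i3[symmetric] by simp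
  finally show "l (U x \<gamma> k) - l (U y \<gamma> k) = integral {x..y} ?g" .
qed

text \<open>
  The difference of \<open>f\<close> and \<open>l \<circ> U\<close> solves the homogeneous Volterra equation for test vectors in
  \<open>spc X \<gamma>\<close>, \<open>\<beta> < \<gamma> \<le> c\<close>, where \<open>c\<close> is chosen so near to \<open>\<beta>\<close> that all these \<open>\<gamma>\<close> lie in \<open>\<Gamma>\<close>.
\<close>

lemma weak_solution_unique:
  assumes \<beta>: "\<beta> \<in> \<Gamma>" and f: "functional_family X \<beta> {a..b} f"
    and Y: "Y \<subseteq> (\<Inter>\<mu>\<in>{low X<..}. spc X \<mu>)" "\<And>\<mu>. low X < \<mu> \<Longrightarrow> stop X \<mu> closure_of Y = spc X \<mu>"
    and weak: "\<And>\<mu> s y. \<beta> < \<mu> \<Longrightarrow> s \<in> {a..b} \<Longrightarrow> y \<in> Y \<Longrightarrow>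
      f s y = l y + integral {s..b} (\<lambda>r. f r (A r \<mu> \<beta> y + B r \<mu> \<beta> y))"
    and K: "1 \<le> K" "\<And>\<rho> \<gamma> s t k. low X < \<rho> \<Longrightarrow> \<rho> < \<gamma> \<Longrightarrow> a \<le> s \<Longrightarrow> s \<le> t \<Longrightarrow> t \<le> b \<Longrightarrow> k \<in> spc X \<gamma> \<Longrightarrow>
      nrm X \<rho> (V t s \<gamma> \<rho> k) \<le> K * nrm X \<gamma> k"
    and M: "mono_on {low X<..} M" "\<And>\<gamma>. low X < \<gamma> \<Longrightarrow> 0 \<le> M \<gamma>"
      "\<And>\<rho> \<gamma> r k. low X < \<rho> \<Longrightarrow> \<rho> < \<gamma> \<Longrightarrow> r \<in> {a..b} \<Longrightarrow> k \<in> spc X \<gamma> \<Longrightarrow>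
      nrm X \<rho> (B r \<gamma> \<rho> k) \<le> M \<gamma> / (\<gamma> - \<rho>) * nrm X \<gamma> k"
    and s: "s \<in> {a..b}" and k: "k \<in> spc X \<beta>"
  shows "f s k = l (U s \<beta> k)"
proof -
  obtain e where e: "e > 0" "\<And>\<nu>. dist \<nu> \<beta> < e \<Longrightarrow> \<nu> \<in> \<Gamma>" using \<Gamma>(1) \<beta> by (meson open_dist)
  \<comment> \<open>Half of \<open>e\<close>, so that the closed interval up to \<open>c\<close> stays inside the open ball.\<close>
  define c where "c = \<beta> + e / 2"
  have c: "\<beta> < c" using e(1) by (simp add: c_def)
  have in\<Gamma>: "\<gamma> \<in> \<Gamma>" if "\<beta> < \<gamma>" "\<gamma> \<le> c" for \<gamma> using that e(1) by (intro e(2)) (auto simp: c_def dist_real_def)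
  have \<beta>': "\<alpha>' < \<beta>" using \<Gamma> \<beta> by auto
  have lo: "low X < \<beta>" "low X < c" using low \<beta>' c by linarith+
  have weak': "f s x = l x + integral {s..b} (\<lambda>r. f r (A r \<mu> \<beta> x + B r \<mu> \<beta> x))"
    if "\<beta> < \<mu>" "s \<in> {a..b}" "x \<in> spc X \<mu>" for \<mu> s x
  proof (rule weak_equation_of_dense[OF f _ that(1) Y(2) weak[OF that(1,2)] that(2,3)])
    show "\<alpha>' \<le> \<beta>" "low X < \<mu>" using \<beta>' lo that(1) by auto
  qed
  have df: "duhamel \<beta> \<gamma> f" if "\<beta> < \<gamma>" for \<gamma>
    by (rule duhamel_of_weak_equation[OF f less_imp_le[OF \<beta>'] that weak'])
  define m where "m = (\<lambda>s k. f s k - l (U s \<beta> k))"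
  have m: "functional_family X \<beta> {a..b} m" unfolding m_def by (intro functional_family_minus f U_functional_family \<beta>)
  have eq: "((\<lambda>r. m r (scale_comp (B r) (V r s) \<gamma> \<beta> k)) has_integral m s k) {s..b}"
    if g: "\<beta> < \<gamma>" "\<gamma> \<le> c" and s: "s \<in> {a..b}" and k: "k \<in> spc X \<gamma>" for \<gamma> s k
  proof -
    have "((\<lambda>r. f r (scale_comp (B r) (V r s) \<gamma> \<beta> k)) has_integral f s k - l (V b s \<gamma> \<alpha>' k)) {s..b}"
      using df[OF g(1)] s k by (simp add: duhamel_def)
    moreover have "((\<lambda>r. l (U r \<beta> (scale_comp (B r) (V r s) \<gamma> \<beta> k))) has_integral l (U s \<beta> k) - l (V b s \<gamma> \<alpha>' k)) {s..b}"
      using U_satisfies_duhamel[OF \<beta> in\<Gamma>[OF g] g(1)] s k by (simp add: duhamel_def)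
    ultimately have "((\<lambda>r. f r (scale_comp (B r) (V r s) \<gamma> \<beta> k) - l (U r \<beta> (scale_comp (B r) (V r s) \<gamma> \<beta> k)))
        has_integral (f s k - l (V b s \<gamma> \<alpha>' k)) - (l (U s \<beta> k) - l (V b s \<gamma> \<alpha>' k))) {s..b}"
      by (rule has_integral_diff)
    then show ?thesis by (simp add: m_def)
  qed
  \<comment> \<open>The factor 2 comes from composing through the midpoint; the summand 1 makes \<open>L\<close> positive.\<close>
  define L where "L = 2 * K * M c + 1"
  have Mc: "0 \<le> M c" using M(2) lo by simp
  have L: "L > 0" using K(1) Mc by (simp add: L_def add_nonneg_pos)
  have Lb: "nrm X \<rho> (scale_comp (B r) (V r s) \<gamma> \<rho> k) \<le> L / (\<gamma> - \<rho>) * nrm X \<gamma> k"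
    if \<rho>: "\<beta> \<le> \<rho>" "\<rho> < \<gamma>" "\<gamma> \<le> c" and r: "a \<le> s" "s \<le> r" "r \<le> b" and k: "k \<in> spc X \<gamma>" for \<rho> \<gamma> s r k
  proof -
    define \<sigma> where "\<sigma> = (\<gamma> + \<rho>) / 2"
    have \<sigma>: "\<rho> < \<sigma>" "\<sigma> < \<gamma>" "\<sigma> - \<rho> = (\<gamma> - \<rho>) / 2" using \<rho> by (auto simp: \<sigma>_def field_simps)
    have lo': "low X < \<rho>" "low X < \<sigma>" "low X < \<gamma>" using lo \<rho> \<sigma> by linarith+
    have Vk: "V r s \<gamma> \<sigma> k \<in> spc X \<sigma>" using r by (intro scale_ops_in[OF V_ops _ _ k] lo' \<sigma>) auto
    have "nrm X \<rho> (scale_comp (B r) (V r s) \<gamma> \<rho> k) = nrm X \<rho> (B r \<sigma> \<rho> (V r s \<gamma> \<sigma> k))"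
      by (simp add: scale_comp_def \<sigma>_def)
    also have "\<dots> \<le> M \<sigma> / (\<sigma> - \<rho>) * nrm X \<sigma> (V r s \<gamma> \<sigma> k)"
      using r by (intro M(3) lo' \<sigma> Vk) auto
    also have "\<dots> \<le> M c / (\<sigma> - \<rho>) * (K * nrm X \<gamma> k)"
    proof (rule mult_mono)
      show "M \<sigma> / (\<sigma> - \<rho>) \<le> M c / (\<sigma> - \<rho>)"
        using mono_onD[OF M(1), of \<sigma> c] lo lo' \<sigma> \<rho> by (intro divide_right_mono) auto
      show "nrm X \<sigma> (V r s \<gamma> \<sigma> k) \<le> K * nrm X \<gamma> k" using r by (intro K(2) lo' \<sigma> k)
      show "0 \<le> M c / (\<sigma> - \<rho>)" using Mc \<sigma> by simp
      show "0 \<le> nrm X \<sigma> (V r s \<gamma> \<sigma> k)" by (rule nrm_ge0[OF lo'(2) Vk])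
    qed
    also have "\<dots> = (2 * K * M c) / (\<gamma> - \<rho>) * nrm X \<gamma> k" by (simp add: \<sigma>(3))
    also have "\<dots> \<le> L / (\<gamma> - \<rho>) * nrm X \<gamma> k"
      using \<rho> nrm_ge0[OF lo'(3) k] by (intro mult_right_mono divide_right_mono) (auto simp: L_def)
    finally show ?thesis .
  qed
  have dense: "stop X \<beta> closure_of spc X c = spc X \<beta>"
  proof
    interpret Metric_space "spc X \<beta>" "sdist X \<beta>" by (rule Metric_space_spc[OF lo(1)])
    show "stop X \<beta> closure_of spc X c \<subseteq> spc X \<beta>"
      using closure_of_subset_topspace[of mtopology] by (simp add: stop_def)
    have "Y \<subseteq> spc X c" using Y(1) lo by auto
    then show "spc X \<beta> \<subseteq> stop X \<beta> closure_of spc X c"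
      using closure_of_mono[of Y "spc X c" "stop X \<beta>"] Y(2)[OF lo(1)] by auto
  qed
  have "m s k = 0" by (rule volterra_unique[OF lo(1) c m eq L Lb dense s k])
  then show ?thesis by (simp add: m_def)
qed

end

section \<open>Admissible indices\<close>

text \<open>
  Free of division, this form also covers \<open>M \<gamma> = 0\<close>, where \<open>T(\<alpha>',\<gamma>) = \<infinity>\<close>.
\<close>

lemma less_Tmax_iff:
  assumes "1 \<le> K" "0 \<le> M \<gamma>" "\<alpha>' < \<gamma>" "0 \<le> d"
  shows "ereal d < Tmax K M \<alpha>' \<gamma> \<longleftrightarrow> d * (2 * K * exp 1 * M \<gamma>) < \<gamma> - \<alpha>'"
proof (cases "M \<gamma> = 0")
  case False
  then have "0 < 2 * K * exp 1 * M \<gamma>" using assms by simp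
  then show ?thesis using False assms by (simp add: Tmax_cases[OF assms(3)] pos_less_divide_eq)
qed (use assms in \<open>simp add: Tmax_cases[OF assms(3)]\<close>)

lemma open_Tmax:
  assumes "1 \<le> K" "continuous_on {w<..} M" "\<And>\<gamma>. w < \<gamma> \<Longrightarrow> 0 \<le> M \<gamma>" "w < \<alpha>'" "0 \<le> d"
  shows "open {\<gamma>. \<alpha>' < \<gamma> \<and> ereal d < Tmax K M \<alpha>' \<gamma>}"
proof -
  have "continuous_on {\<alpha>'<..} (\<lambda>\<gamma>. d * (2 * K * exp 1 * M \<gamma>) - (\<gamma> - \<alpha>'))"
    by (intro continuous_intros continuous_on_subset[OF assms(2)]) (use assms(4) in auto)
  then have "open ({\<alpha>'<..} \<inter> (\<lambda>\<gamma>. d * (2 * K * exp 1 * M \<gamma>) - (\<gamma> - \<alpha>')) -` {..<0})"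
    by (intro continuous_open_preimage) auto
  moreover have "{\<alpha>'<..} \<inter> (\<lambda>\<gamma>. d * (2 * K * exp 1 * M \<gamma>) - (\<gamma> - \<alpha>')) -` {..<0}
      = {\<gamma>. \<alpha>' < \<gamma> \<and> ereal d < Tmax K M \<alpha>' \<gamma>}"
    using assms by (auto simp: less_Tmax_iff)
  ultimately show ?thesis by simp
qed

lemma Tmax_not_MInf: "\<alpha>' < \<alpha> \<Longrightarrow> Tmax K M \<alpha>' \<alpha> \<noteq> - \<infinity>"
  by (simp add: Tmax_cases)

lemma ereal_minus_less_iff: "m \<noteq> - \<infinity> \<Longrightarrow> ereal t - m < ereal s \<longleftrightarrow> ereal (t - s) < m"
  by (cases m) auto

lemma ereal_less_add_iff: "m \<noteq> - \<infinity> \<Longrightarrow> ereal t < ereal s + m \<longleftrightarrow> ereal (t - s) < m"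
  by (cases m) auto

section \<open>The forward and the backward family as window problems\<close>

context banach_scale_space begin

lemma operator_family_of_strongly_continuous:
  assumes "\<And>p. p \<in> D \<Longrightarrow> bounded_op X \<alpha> \<beta> (F p)" "strongly_continuous X \<alpha> \<beta> D F" "low X < \<beta>"
  shows "operator_family X \<alpha> \<beta> D F"
  unfolding operator_family_def using strongly_continuousD[OF assms(2,3)] assms(1) by blast

lemma bounded_op_sub:
  assumes F: "bounded_op X \<alpha> \<beta> F" and G: "bounded_op X \<alpha> \<beta> G" and lo: "low X < \<alpha>" "low X < \<beta>"
  shows "bounded_op X \<alpha> \<beta> (\<lambda>x. F x - G x)"
proof -
  interpret vector_space "smult X" by (rule vector_space_smult)
  obtain C D where C: "\<And>x. x \<in> spc X \<alpha> \<Longrightarrow> nrm X \<beta> (F x) \<le> C * nrm X \<alpha> x"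
    and D: "\<And>x. x \<in> spc X \<alpha> \<Longrightarrow> nrm X \<beta> (G x) \<le> D * nrm X \<alpha> x"
    using bounded_op_bound[OF F lo(1)] bounded_op_bound[OF G lo(1)] by blast
  have "nrm X \<beta> (F x - G x) \<le> (C + D) * nrm X \<alpha> x" if x: "x \<in> spc X \<alpha>" for x
  proof -
    have i: "F x \<in> spc X \<beta>" "G x \<in> spc X \<beta>" using bounded_opD(1)[OF F x] bounded_opD(1)[OF G x] .
    have "nrm X \<beta> (F x - G x) \<le> nrm X \<beta> (F x) + nrm X \<beta> (G x)"
      using nrm_add[OF lo(2) i(1) spc_minus[OF lo(2) i(2)]] nrm_minus[OF lo(2) i(2)] by simp
    then show ?thesis using C[OF x] D[OF x] by (simp add: algebra_simps)
  qed
  then have "\<exists>C. \<forall>x\<in>spc X \<alpha>. nrm X \<beta> (F x - G x) \<le> C * nrm X \<alpha> x" by blast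
  then show ?thesis
    using bounded_opD[OF F] bounded_opD[OF G] spc_diff[OF lo(2)]
    unfolding bounded_op_def by (simp add: scale_right_diff_distrib)
qed

end

locale perturbed_generator = banach_scale_space X for X :: "('k::{real_normed_field,banach}, 'a::ab_group_add) scale_data" +
  fixes A B :: "real \<Rightarrow> real \<Rightarrow> real \<Rightarrow> 'a \<Rightarrow> 'a" and M :: "real \<Rightarrow> real" and \<alpha>' :: real and l :: "'a \<Rightarrow> 'k"
  assumes A0: "\<forall>t\<ge>0. A t \<in> scale_ops X" and A1: "condA1 X A"
    and B0: "\<forall>t\<ge>0. B t \<in> scale_ops X" and B1: "condB1 X B" and B2: "condB2 X M B"
    and low0: "low X < \<alpha>'" and l0: "l \<in> dual X \<alpha>'"
begin

lemma A_operator_family: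
  assumes \<beta>: "low X < \<beta>" "\<beta> < \<gamma>"
  shows "operator_family X \<gamma> \<beta> {0..} (\<lambda>r. A r \<gamma> \<beta>)"
proof -
  have \<gamma>: "low X < \<gamma>" using \<beta> by simp
  have bo: "bounded_op X \<gamma> \<beta> (A r \<gamma> \<beta>)" if "r \<ge> 0" for r
    using scale_ops_bounded[of "A r"] A0 that \<beta> by simp
  show ?thesis
    unfolding operator_family_def cont_into_def
  proof (intro conjI ballI)
    show "bounded_op X \<gamma> \<beta> (A r \<gamma> \<beta>)" if "r \<in> {0..}" for r using bo that by simp
    fix k p assume k: "k \<in> spc X \<gamma>" and p: "p \<in> {0::real..}"
    show "A p \<gamma> \<beta> k \<in> spc X \<beta>" using bounded_opD(1)[OF bo k] p by simp
    have "((\<lambda>q. op_norm X \<gamma> \<beta> (\<lambda>k. A q \<gamma> \<beta> k - A p \<gamma> \<beta> k) * nrm X \<gamma> k) \<longlongrightarrow> 0 * nrm X \<gamma> k) (at p within {0..})"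
      using A1 \<beta> p by (intro tendsto_intros) (auto simp: condA1_def)
    then have *: "((\<lambda>q. op_norm X \<gamma> \<beta> (\<lambda>k. A q \<gamma> \<beta> k - A p \<gamma> \<beta> k) * nrm X \<gamma> k) \<longlongrightarrow> 0) (at p within {0..})" by simp
    have "norm (nrm X \<beta> (A q \<gamma> \<beta> k - A p \<gamma> \<beta> k)) \<le> op_norm X \<gamma> \<beta> (\<lambda>k. A q \<gamma> \<beta> k - A p \<gamma> \<beta> k) * nrm X \<gamma> k"
      if "q \<in> {0..}" for q
    proof -
      have b: "bounded_op X \<gamma> \<beta> (\<lambda>k. A q \<gamma> \<beta> k - A p \<gamma> \<beta> k)" using bo p that \<beta> \<gamma> by (intro bounded_op_sub) auto
      show ?thesis using bounded_op_le[OF b \<gamma> \<beta>(1) k] nrm_ge0[OF \<beta>(1) bounded_opD(1)[OF b k]] by simp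
    qed
    then show "((\<lambda>q. nrm X \<beta> (A q \<gamma> \<beta> k - A p \<gamma> \<beta> k)) \<longlongrightarrow> 0) (at p within {0..})"
      by (intro Lim_null_comparison[OF _ *]) (auto simp: eventually_at_filter)
  qed
qed

lemma B_operator_family:
  assumes \<beta>: "low X < \<beta>" "\<beta> < \<gamma>"
  shows "operator_family X \<gamma> \<beta> {0..} (\<lambda>r. B r \<gamma> \<beta>)"
  using B0 B1 \<beta> by (intro operator_family_of_strongly_continuous) (auto simp: condB1_def intro: scale_ops_bounded)

lemma V_operator_family:
  assumes V: "condA2 X V" and \<beta>: "low X < \<beta>" "\<beta> < \<gamma>"
  shows "operator_family X \<gamma> \<beta> {(t, s). 0 \<le> s \<and> s \<le> t} (\<lambda>(t, s). V t s \<gamma> \<beta>)"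
  using V \<beta> by (intro operator_family_of_strongly_continuous) (auto simp: condA2_def intro: scale_ops_bounded)

lemma dual_cauchy_forward:
  assumes V: "condA2 X V" "condA3 X A V" and a: "0 \<le> a"
  shows "dual_cauchy X A B V a b \<alpha>' l"
proof (intro dual_cauchy.intro dual_cauchy_axioms.intro)
  show "banach_scale_space X" by (rule banach_scale_space_axioms)
  show "low X < \<alpha>'" "bounded_functional X \<alpha>' l" using low0 dual_bounded_functional[OF l0] .
  show "A r \<in> scale_ops X" "B r \<in> scale_ops X" if "r \<in> {a..b}" for r using A0 B0 that a by auto
  show "V t s \<in> scale_ops X" if "a \<le> s" "s \<le> t" "t \<le> b" for s t
    using V(1) that a by (auto simp: condA2_def)
  fix \<beta> \<gamma> assume \<beta>: "low X < \<beta>" "\<beta> < \<gamma>"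
  show "operator_family X \<gamma> \<beta> {a..b} (\<lambda>r. A r \<gamma> \<beta>)"
    using operator_family_compose[OF A_operator_family[OF \<beta>], of "{a..b}" "\<lambda>r. r"] a \<beta> by auto
  show "operator_family X \<gamma> \<beta> {a..b} (\<lambda>r. B r \<gamma> \<beta>)"
    using operator_family_compose[OF B_operator_family[OF \<beta>], of "{a..b}" "\<lambda>r. r"] a \<beta> by auto
  have "operator_family X \<gamma> \<beta> {(t, s). a \<le> s \<and> s \<le> t \<and> t \<le> b} (\<lambda>p. (\<lambda>(t, s). V t s \<gamma> \<beta>) p)"
    by (rule operator_family_compose[OF V_operator_family[OF V(1) \<beta>] _ _ \<beta>(1)]) (use a in auto)
  then show "operator_family X \<gamma> \<beta> {(t, s). a \<le> s \<and> s \<le> t \<and> t \<le> b} (\<lambda>(t, s). V t s \<gamma> \<beta>)" by simp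
next
  fix \<beta> \<mu> \<gamma> f k s t
  assume *: "low X < \<beta>" "\<beta> < \<mu>" "\<mu> < \<gamma>" "bounded_functional X \<beta> f" "k \<in> spc X \<gamma>" "a \<le> s" "s \<le> t" "t \<le> b"
  then have "0 \<le> s" using a by simp
  then show "((\<lambda>r. f (A r \<mu> \<beta> (V r s \<gamma> \<mu> k))) has_integral f (V t s \<gamma> \<beta> k - k)) {s..t}"
    "((\<lambda>r. f (V t r \<mu> \<beta> (A r \<gamma> \<mu> k))) has_integral f (V t s \<gamma> \<beta> k - k)) {s..t}"
    using V(2) * by (auto simp: condA3_def intro!: has_integral_functional[OF _ *(4,1)])
qed

text \<open>
  As \<open>s \<le> t\<close> means \<open>c - t \<le> c - s\<close>, the reversed family \<open>V (c - t) (c - s)\<close> has its arguments in the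
  order of the backward family.  Products such as \<open>V(s,r)A(r)\<close> keep their order, so each integral
  equation turns into the forward one of the same shape.
\<close>

lemma dual_cauchy_backward:
  assumes V: "condA2 X (\<lambda>t s. V s t)" "condA3_bwd X A V" and a: "0 \<le> a" and c: "c = a + b"
  shows "dual_cauchy X (\<lambda>r. A (c - r)) (\<lambda>r. B (c - r)) (\<lambda>t s. V (c - t) (c - s)) a b \<alpha>' l"
proof (intro dual_cauchy.intro dual_cauchy_axioms.intro)
  show "banach_scale_space X" by (rule banach_scale_space_axioms)
  show "low X < \<alpha>'" "bounded_functional X \<alpha>' l" using low0 dual_bounded_functional[OF l0] .
  show "A (c - r) \<in> scale_ops X" "B (c - r) \<in> scale_ops X" if "r \<in> {a..b}" for r using A0 B0 that a c by auto
  show "V (c - t) (c - s) \<in> scale_ops X" if "a \<le> s" "s \<le> t" "t \<le> b" for s t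
    using V(1) that a c by (auto simp: condA2_def)
  fix \<beta> \<gamma> assume \<beta>: "low X < \<beta>" "\<beta> < \<gamma>"
  show "operator_family X \<gamma> \<beta> {a..b} (\<lambda>r. A (c - r) \<gamma> \<beta>)"
    by (rule operator_family_compose[OF A_operator_family[OF \<beta>] _ _ \<beta>(1)]) (use a c in \<open>auto intro!: continuous_intros\<close>)
  show "operator_family X \<gamma> \<beta> {a..b} (\<lambda>r. B (c - r) \<gamma> \<beta>)"
    by (rule operator_family_compose[OF B_operator_family[OF \<beta>] _ _ \<beta>(1)]) (use a c in \<open>auto intro!: continuous_intros\<close>)
  have "operator_family X \<gamma> \<beta> {(t, s). a \<le> s \<and> s \<le> t \<and> t \<le> b} (\<lambda>p. (\<lambda>(t, s). V s t \<gamma> \<beta>) (c - snd p, c - fst p))"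
    by (rule operator_family_compose[OF V_operator_family[OF V(1) \<beta>] _ _ \<beta>(1)]) (use a c in \<open>auto intro!: continuous_intros\<close>)
  then show "operator_family X \<gamma> \<beta> {(t, s). a \<le> s \<and> s \<le> t \<and> t \<le> b} (\<lambda>(t, s). V (c - t) (c - s) \<gamma> \<beta>)"
    by (simp add: case_prod_unfold)
next
  fix \<beta> \<mu> \<gamma> f k s t
  assume *: "low X < \<beta>" "\<beta> < \<mu>" "\<mu> < \<gamma>" "bounded_functional X \<beta> f" "k \<in> spc X \<gamma>" "a \<le> s" "s \<le> t" "t \<le> b"
  then have 0: "0 \<le> c - t" "c - t \<le> c - s" using a c by auto
  have 1: "scale_has_integral X \<beta> (\<lambda>r. A r \<mu> \<beta> (V r (c - s) \<gamma> \<mu> k)) (V (c - t) (c - s) \<gamma> \<beta> k - k) (c - t) (c - s)"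
    and 2: "scale_has_integral X \<beta> (\<lambda>r. V (c - t) r \<mu> \<beta> (A r \<gamma> \<mu> k)) (V (c - t) (c - s) \<gamma> \<beta> k - k) (c - t) (c - s)"
    using V(2) * 0 by (auto simp: condA3_bwd_def)
  show "((\<lambda>r. f (A (c - r) \<mu> \<beta> (V (c - r) (c - s) \<gamma> \<mu> k))) has_integral f (V (c - t) (c - s) \<gamma> \<beta> k - k)) {s..t}"
    using has_integral_reflect_about[OF has_integral_functional[OF 1 *(4,1)], of c] by simp
  show "((\<lambda>r. f (V (c - t) (c - r) \<mu> \<beta> (A (c - r) \<gamma> \<mu> k))) has_integral f (V (c - t) (c - s) \<gamma> \<beta> k - k)) {s..t}"
    using has_integral_reflect_about[OF has_integral_functional[OF 2 *(4,1)], of c] by simp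
qed

definition admissible :: "real \<Rightarrow> real \<Rightarrow> real set" where
  "admissible K d = {\<gamma>. \<alpha>' < \<gamma> \<and> ereal d < Tmax K M \<alpha>' \<gamma>}"

lemma open_admissible: "1 \<le> K \<Longrightarrow> 0 \<le> d \<Longrightarrow> open (admissible K d)"
  unfolding admissible_def using B2 low0 by (intro open_Tmax[where w = "low X"]) (auto simp: condB2_def)

lemma W_operator_family:
  assumes W: "perturbed_base X K M W" and \<gamma>: "\<alpha>' < \<gamma>"
  shows "operator_family X \<gamma> \<alpha>' {(t, s). 0 \<le> s \<and> s \<le> t \<and> ereal (t - s) < Tmax K M \<alpha>' \<gamma>} (\<lambda>(t, s). W t s \<gamma> \<alpha>')"
  using W \<gamma> low0 by (intro operator_family_of_strongly_continuous) (auto simp: perturbed_base_def)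

lemma W_eq:
  assumes W: "perturbed_base X K M W" and d: "\<beta> \<in> admissible K d" "\<gamma> \<in> admissible K d" "\<beta> < \<gamma>"
    and s: "0 \<le> s" "s \<le> t" "t - s \<le> d" and k: "k \<in> spc X \<gamma>"
  shows "W t s \<gamma> \<alpha>' k = W t s \<beta> \<alpha>' k"
proof -
  have le: "ereal (t - s) \<le> ereal d" using s by simp
  have "ereal (t - s) < min (Tmax K M \<alpha>' \<gamma>) (Tmax K M \<alpha>' \<beta>)"
    using d unfolding admissible_def by (auto intro: le_less_trans[OF le])
  then show ?thesis using W low0 d s k unfolding perturbed_base_def admissible_def by blast
qed

lemma perturbed_dual_cauchy_forward:
  assumes V: "condA2 X V" "condA3 X A V" and K: "1 \<le> K" and W: "perturbed_forward X K M V B W"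
    and a: "0 \<le> a" "a \<le> b"
  shows "perturbed_dual_cauchy X A B V a b \<alpha>' l (\<lambda>s \<gamma>. W b s \<gamma> \<alpha>') (admissible K (b - a))"
proof (intro perturbed_dual_cauchy.intro perturbed_dual_cauchy_axioms.intro)
  have Wb: "perturbed_base X K M W" using W by (simp add: perturbed_forward_def)
  show "dual_cauchy X A B V a b \<alpha>' l" by (rule dual_cauchy_forward[OF V a(1)])
  show "open (admissible K (b - a))" using K a by (intro open_admissible) auto
  show "admissible K (b - a) \<subseteq> {\<alpha>'<..}" by (auto simp: admissible_def)
  have small: "ereal (b - s) < Tmax K M \<alpha>' \<gamma>" if "\<gamma> \<in> admissible K (b - a)" "s \<in> {a..b}" for \<gamma> s
    using that by (auto simp: admissible_def intro: le_less_trans[of _ "ereal (b - a)"])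
  show "operator_family X \<gamma> \<alpha>' {a..b} (\<lambda>s. W b s \<gamma> \<alpha>')" if g: "\<gamma> \<in> admissible K (b - a)" for \<gamma>
  proof -
    have "operator_family X \<gamma> \<alpha>' {a..b} (\<lambda>s. (\<lambda>(t, s). W t s \<gamma> \<alpha>') (b, s))"
      using g small[OF g] a
      by (intro operator_family_compose[OF W_operator_family[OF Wb] _ _ low0]) (auto simp: admissible_def intro!: continuous_intros)
    then show ?thesis by simp
  qed
  fix \<beta> \<gamma> s k
  assume *: "\<beta> \<in> admissible K (b - a)" "\<gamma> \<in> admissible K (b - a)" "\<beta> < \<gamma>" "s \<in> {a..b}" "k \<in> spc X \<gamma>"
  show eq: "W b s \<gamma> \<alpha>' k = W b s \<beta> \<alpha>' k" using * a by (intro W_eq[OF Wb *(1-3) _ _ _ *(5)]) auto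
  have "scale_has_integral X \<alpha>' (\<lambda>r. W b r \<beta> \<alpha>' (scale_comp (B r) (V r s) \<gamma> \<beta> k))
      (W b s \<gamma> \<alpha>' k - V b s \<gamma> \<alpha>' k) s b"
    using W low0 * a small[OF *(1,4)] small[OF *(2,4)] unfolding perturbed_forward_def admissible_def by auto
  from has_integral_functional[OF this dual_bounded_functional[OF l0] low0]
  have "((\<lambda>r. l (W b r \<beta> \<alpha>' (scale_comp (B r) (V r s) \<gamma> \<beta> k))) has_integral l (W b s \<gamma> \<alpha>' k - V b s \<gamma> \<alpha>' k)) {s..b}" .
  moreover have "l (W b s \<gamma> \<alpha>' k - V b s \<gamma> \<alpha>' k) = l (W b s \<gamma> \<alpha>' k) - l (V b s \<gamma> \<alpha>' k)"
  proof (rule functional_diff[OF dual_bounded_functional[OF l0] low0])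
    have "\<alpha>' < \<gamma>" using * by (simp add: admissible_def)
    then show "V b s \<gamma> \<alpha>' k \<in> spc X \<alpha>'"
      using V(1) * a low0 by (intro scale_ops_in[OF _ low0 _ *(5)]) (auto simp: condA2_def)
    have "bounded_op X \<gamma> \<alpha>' (W b s \<gamma> \<alpha>')"
      using Wb low0 \<open>\<alpha>' < \<gamma>\<close> small[OF *(2,4)] * a unfolding perturbed_base_def by auto
    then show "W b s \<gamma> \<alpha>' k \<in> spc X \<alpha>'" using bounded_opD(1) *(5) by blast
  qed
  ultimately show "((\<lambda>r. l (W b r \<beta> \<alpha>' (scale_comp (B r) (V r s) \<gamma> \<beta> k))) has_integral
      l (W b s \<gamma> \<alpha>' k) - l (V b s \<gamma> \<alpha>' k)) {s..b}" by simp
qed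

text \<open>
  Reversal moves the fixed first time \<open>a\<close> of \<open>W(a,\<cdot>)\<close> to the final time \<open>b = c - a\<close> of the window.
\<close>

lemma perturbed_dual_cauchy_backward:
  assumes V: "condA2 X (\<lambda>t s. V s t)" "condA3_bwd X A V" and K: "1 \<le> K" and W: "perturbed_backward X K M V B W"
    and a: "0 \<le> a" "a \<le> b" and c: "c = a + b"
  shows "perturbed_dual_cauchy X (\<lambda>r. A (c - r)) (\<lambda>r. B (c - r)) (\<lambda>t s. V (c - t) (c - s)) a b \<alpha>' l
    (\<lambda>r \<gamma>. W a (c - r) \<gamma> \<alpha>') (admissible K (b - a))"
proof (intro perturbed_dual_cauchy.intro perturbed_dual_cauchy_axioms.intro)
  have Wb: "perturbed_base X K M (\<lambda>t s. W s t)" using W by (simp add: perturbed_backward_def)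
  show "dual_cauchy X (\<lambda>r. A (c - r)) (\<lambda>r. B (c - r)) (\<lambda>t s. V (c - t) (c - s)) a b \<alpha>' l"
    by (rule dual_cauchy_backward[OF V a(1) c])
  show "open (admissible K (b - a))" using K a by (intro open_admissible) auto
  show "admissible K (b - a) \<subseteq> {\<alpha>'<..}" by (auto simp: admissible_def)
  have small: "ereal (c - s - a) < Tmax K M \<alpha>' \<gamma>" if "\<gamma> \<in> admissible K (b - a)" "s \<in> {a..b}" for \<gamma> s
    using that c by (auto simp: admissible_def intro: le_less_trans[of _ "ereal (b - a)"])
  show "operator_family X \<gamma> \<alpha>' {a..b} (\<lambda>s. W a (c - s) \<gamma> \<alpha>')" if g: "\<gamma> \<in> admissible K (b - a)" for \<gamma>
  proof -
    have "operator_family X \<gamma> \<alpha>' {a..b} (\<lambda>s. (\<lambda>(t, s). W s t \<gamma> \<alpha>') (c - s, a))"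
      using g small[OF g] a c
      by (intro operator_family_compose[OF W_operator_family[OF Wb] _ _ low0]) (auto simp: admissible_def intro!: continuous_intros)
    then show ?thesis by simp
  qed
  fix \<beta> \<gamma> s k
  assume *: "\<beta> \<in> admissible K (b - a)" "\<gamma> \<in> admissible K (b - a)" "\<beta> < \<gamma>" "s \<in> {a..b}" "k \<in> spc X \<gamma>"
  show eq: "W a (c - s) \<gamma> \<alpha>' k = W a (c - s) \<beta> \<alpha>' k"
    using * a c by (intro W_eq[OF Wb *(1-3) _ _ _ *(5)]) auto
  have "scale_has_integral X \<alpha>' (\<lambda>r. W a r \<beta> \<alpha>' (scale_comp (B r) (V r (c - s)) \<gamma> \<beta> k))
      (W a (c - s) \<gamma> \<alpha>' k - V a (c - s) \<gamma> \<alpha>' k) a (c - s)"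
    using W low0 * a c small[OF *(1,4)] small[OF *(2,4)] unfolding perturbed_backward_def admissible_def by auto
  from has_integral_reflect_about[OF has_integral_functional[OF this dual_bounded_functional[OF l0] low0], of c]
  have "((\<lambda>r. l (W a (c - r) \<beta> \<alpha>' (scale_comp (B (c - r)) (V (c - r) (c - s)) \<gamma> \<beta> k))) has_integral
      l (W a (c - s) \<gamma> \<alpha>' k - V a (c - s) \<gamma> \<alpha>' k)) {s..b}" using c by simp
  moreover have "l (W a (c - s) \<gamma> \<alpha>' k - V a (c - s) \<gamma> \<alpha>' k) = l (W a (c - s) \<gamma> \<alpha>' k) - l (V a (c - s) \<gamma> \<alpha>' k)"
  proof (rule functional_diff[OF dual_bounded_functional[OF l0] low0])
    have "\<alpha>' < \<gamma>" using * by (simp add: admissible_def)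
    then show "V a (c - s) \<gamma> \<alpha>' k \<in> spc X \<alpha>'"
      using V(1) * a c low0 by (intro scale_ops_in[OF _ low0 _ *(5)]) (auto simp: condA2_def)
    have "bounded_op X \<gamma> \<alpha>' (W a (c - s) \<gamma> \<alpha>')"
      using Wb low0 \<open>\<alpha>' < \<gamma>\<close> small[OF *(2,4)] * a c unfolding perturbed_base_def by auto
    then show "W a (c - s) \<gamma> \<alpha>' k \<in> spc X \<alpha>'" using bounded_opD(1) *(5) by blast
  qed
  ultimately show "((\<lambda>r. l (W a (c - r) \<beta> \<alpha>' (scale_comp (B (c - r)) (V (c - r) (c - s)) \<gamma> \<beta> k))) has_integral
      l (W a (c - s) \<gamma> \<alpha>' k) - l (V (c - b) (c - s) \<gamma> \<alpha>' k)) {s..b}" using c by simp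
qed

lemma V_bound:
  assumes V: "condA2 X V" "condA4 X K V" and "low X < \<rho>" "\<rho> < \<gamma>" "0 \<le> s" "s \<le> t" "k \<in> spc X \<gamma>"
  shows "nrm X \<rho> (V t s \<gamma> \<rho> k) \<le> K * nrm X \<gamma> k"
proof -
  have lo: "low X < \<gamma>" using assms by simp
  have "nrm X \<rho> (V t s \<gamma> \<rho> k) \<le> op_norm X \<gamma> \<rho> (V t s \<gamma> \<rho>) * nrm X \<gamma> k"
    using assms lo by (intro bounded_op_le scale_ops_bounded) (auto simp: condA2_def)
  also have "\<dots> \<le> K * nrm X \<gamma> k"
    using assms nrm_ge0[OF lo assms(7)] by (intro mult_right_mono) (auto simp: condA4_def)
  finally show ?thesis .
qed

lemma B_bound:
  assumes "low X < \<rho>" "\<rho> < \<gamma>" "0 \<le> r" "k \<in> spc X \<gamma>"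
  shows "nrm X \<rho> (B r \<gamma> \<rho> k) \<le> M \<gamma> / (\<gamma> - \<rho>) * nrm X \<gamma> k"
proof -
  have lo: "low X < \<gamma>" using assms by simp
  have "nrm X \<rho> (B r \<gamma> \<rho> k) \<le> op_norm X \<gamma> \<rho> (B r \<gamma> \<rho>) * nrm X \<gamma> k"
    using assms lo B0 by (intro bounded_op_le scale_ops_bounded) auto
  also have "\<dots> \<le> M \<gamma> / (\<gamma> - \<rho>) * nrm X \<gamma> k"
    using assms B2 nrm_ge0[OF lo assms(4)] by (intro mult_right_mono) (auto simp: condB2_def)
  finally show ?thesis .
qed

lemma M_mono_nonneg: "mono_on {low X<..} M" "low X < \<gamma> \<Longrightarrow> 0 \<le> M \<gamma>"
  using B2 by (auto simp: condB2_def)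

end

section \<open>Uniqueness and differentiability\<close>

context perturbed_generator begin

text \<open>
  The window \<open>[s,t]\<close> depends on \<open>s\<close>, and the two functionals are compared at its left end.
\<close>

lemma forward_uniqueness:
  assumes V: "condA2 X V" "condA3 X A V" "condA4 X K V" and W: "perturbed_forward X K M V B W"
    and Y: "Y \<subseteq> (\<Inter>\<beta>\<in>{low X<..}. spc X \<beta>)" "\<And>\<beta>. low X < \<beta> \<Longrightarrow> stop X \<beta> closure_of Y = spc X \<beta>"
    and \<alpha>: "\<alpha>' < \<alpha>" and T: "T \<le> t"
    and dual: "\<And>s. s \<in> {t - T..t} \<Longrightarrow> lf s \<in> dual X \<alpha>"
    and cont: "\<And>k. k \<in> spc X \<alpha> \<Longrightarrow> continuous_on {t - T..t} (\<lambda>s. lf s k)"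
    and weak: "\<And>k \<mu> s. k \<in> Y \<Longrightarrow> \<alpha> < \<mu> \<Longrightarrow> s \<in> {t - T..t} \<Longrightarrow>
      lf s k = l k + integral {s..t} (\<lambda>r. lf r (A r \<mu> \<alpha> k + B r \<mu> \<alpha> k))"
    and s: "t - T \<le> s" "s \<le> t" "ereal (t - s) < Tmax K M \<alpha>' \<alpha>"
  shows "lf s = adj X \<alpha> (W t s \<alpha> \<alpha>') l"
proof -
  have K: "1 \<le> K" using V(3) by (simp add: condA4_def)
  have s0: "0 \<le> s" using s T by simp
  interpret P: perturbed_dual_cauchy X A B V s t \<alpha>' l "\<lambda>s \<gamma>. W t s \<gamma> \<alpha>'" "admissible K (t - s)"
    by (rule perturbed_dual_cauchy_forward[OF V(1,2) K W s0 s(2)])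
  have sub: "{s..t} \<subseteq> {t - T..t}" using s by auto
  have \<alpha>g: "\<alpha> \<in> admissible K (t - s)" using \<alpha> s by (simp add: admissible_def)
  have "functional_family X \<alpha> {t - T..t} lf"
    using dual cont unfolding functional_family_def by (auto intro: dual_bounded_functional)
  then have f: "functional_family X \<alpha> {s..t} lf" by (rule functional_family_subset[OF _ sub])
  have eq: "lf s k = l (W t s \<alpha> \<alpha>' k)" if k: "k \<in> spc X \<alpha>" for k
  proof (rule P.weak_solution_unique[OF \<alpha>g f Y _ K _ M_mono_nonneg _ _ k])
    show "lf \<sigma> y = l y + integral {\<sigma>..t} (\<lambda>r. lf r (A r \<mu> \<alpha> y + B r \<mu> \<alpha> y))"
      if "\<alpha> < \<mu>" "\<sigma> \<in> {s..t}" "y \<in> Y" for \<mu> \<sigma> y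
      by (rule weak[OF that(3,1)]) (use that(2) sub in blast)
    show "nrm X \<rho> (V t' s' \<gamma> \<rho> k) \<le> K * nrm X \<gamma> k"
      if "low X < \<rho>" "\<rho> < \<gamma>" "s \<le> s'" "s' \<le> t'" "t' \<le> t" "k \<in> spc X \<gamma>" for \<rho> \<gamma> s' t' k
      using that s0 by (intro V_bound[OF V(1,3)]) auto
    show "nrm X \<rho> (B r \<gamma> \<rho> k) \<le> M \<gamma> / (\<gamma> - \<rho>) * nrm X \<gamma> k"
      if "low X < \<rho>" "\<rho> < \<gamma>" "r \<in> {s..t}" "k \<in> spc X \<gamma>" for \<rho> \<gamma> r k
      using that s0 by (intro B_bound) auto
    show "s \<in> {s..t}" using s by simp
  qed
  have "lf s \<in> extensional (spc X \<alpha>)" using dual s by (simp add: dual_def)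
  then show ?thesis
    by (intro extensionalityI[of _ "spc X \<alpha>"]) (auto simp: adj_def eq)
qed

lemma backward_uniqueness:
  assumes V: "condA2 X (\<lambda>t s. V s t)" "condA3_bwd X A V" "condA4 X K (\<lambda>t s. V s t)"
    and W: "perturbed_backward X K M V B W"
    and Y: "Y \<subseteq> (\<Inter>\<beta>\<in>{low X<..}. spc X \<beta>)" "\<And>\<beta>. low X < \<beta> \<Longrightarrow> stop X \<beta> closure_of Y = spc X \<beta>"
    and \<alpha>: "\<alpha>' < \<alpha>" and s0: "0 \<le> s"
    and dual: "\<And>t. t \<in> {s..s + T} \<Longrightarrow> lf t \<in> dual X \<alpha>"
    and cont: "\<And>k. k \<in> spc X \<alpha> \<Longrightarrow> continuous_on {s..s + T} (\<lambda>t. lf t k)"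
    and weak: "\<And>k \<mu> t. k \<in> Y \<Longrightarrow> \<alpha> < \<mu> \<Longrightarrow> t \<in> {s..s + T} \<Longrightarrow>
      lf t k = l k + integral {s..t} (\<lambda>r. lf r (A r \<mu> \<alpha> k + B r \<mu> \<alpha> k))"
    and t: "t \<le> s + T" "s \<le> t" "ereal (t - s) < Tmax K M \<alpha>' \<alpha>"
  shows "lf t = adj X \<alpha> (W s t \<alpha> \<alpha>') l"
proof -
  have K: "1 \<le> K" using V(3) by (simp add: condA4_def)
  define c where "c = s + t"
  interpret P: perturbed_dual_cauchy X "\<lambda>r. A (c - r)" "\<lambda>r. B (c - r)" "\<lambda>t s. V (c - t) (c - s)" s t \<alpha>' l
      "\<lambda>r \<gamma>. W s (c - r) \<gamma> \<alpha>'" "admissible K (t - s)"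
    by (rule perturbed_dual_cauchy_backward[OF V(1,2) K W s0 t(2) c_def])
  have sub: "{s..t} \<subseteq> {s..s + T}" using t by auto
  have \<alpha>g: "\<alpha> \<in> admissible K (t - s)" using \<alpha> t by (simp add: admissible_def)
  have "functional_family X \<alpha> {s..s + T} lf"
    using dual cont unfolding functional_family_def by (auto intro: dual_bounded_functional)
  then have f0: "functional_family X \<alpha> {s..t} lf" by (rule functional_family_subset[OF _ sub])
  have f: "functional_family X \<alpha> {s..t} (\<lambda>r. lf (c - r))"
    by (rule functional_family_compose[OF f0]) (auto simp: c_def intro!: continuous_intros)
  have eq: "lf (c - s) k = l (W s (c - s) \<alpha> \<alpha>' k)" if k: "k \<in> spc X \<alpha>" for k
  proof (rule P.weak_solution_unique[OF \<alpha>g f Y _ K _ M_mono_nonneg _ _ k])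
    show "lf (c - r) y = l y + integral {r..t} (\<lambda>u. lf (c - u) (A (c - u) \<mu> \<alpha> y + B (c - u) \<mu> \<alpha> y))"
      if "\<alpha> < \<mu>" "r \<in> {s..t}" "y \<in> Y" for \<mu> r y
    proof -
      let ?g = "\<lambda>r. lf r (A r \<mu> \<alpha> y + B r \<mu> \<alpha> y)"
      have r: "c - r \<in> {s..t}" using that(2) by (auto simp: c_def)
      have lo: "low X < \<alpha>" "\<alpha> < \<mu>" using low0 \<alpha> that(1) by linarith+
      have ymu: "y \<in> spc X \<mu>" using Y(1) that(3) lo by auto
      have "continuous_on {s..t} ?g"
      proof -
        have "operator_family X \<mu> \<alpha> {s..t} (\<lambda>r. A r \<mu> \<alpha>)" "operator_family X \<mu> \<alpha> {s..t} (\<lambda>r. B r \<mu> \<alpha>)"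
          using operator_family_compose[OF A_operator_family[OF lo], of "{s..t}" "\<lambda>r. r"]
            operator_family_compose[OF B_operator_family[OF lo], of "{s..t}" "\<lambda>r. r"] s0 lo by auto
        then show ?thesis using ymu
          by (intro functional_family_apply[OF f0 compact_Icc _ lo(1)] cont_into_add lo) (simp_all add: operator_family_def)
      qed
      then have "?g integrable_on {s..c - r}"
        using r by (intro integrable_continuous_real) (auto intro: continuous_on_subset)
      from has_integral_reflect_about[OF integrable_integral[OF this], of c]
      have "integral {r..t} (\<lambda>u. ?g (c - u)) = integral {s..c - r} ?g"
        by (simp add: c_def integral_unique)
      then show ?thesis using weak[OF that(3,1), of "c - r"] r sub by auto
    qed
    show "nrm X \<rho> (V (c - t') (c - s') \<gamma> \<rho> k) \<le> K * nrm X \<gamma> k"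
      if "low X < \<rho>" "\<rho> < \<gamma>" "s \<le> s'" "s' \<le> t'" "t' \<le> t" "k \<in> spc X \<gamma>" for \<rho> \<gamma> s' t' k
      using that s0 by (intro V_bound[OF V(1,3)]) (auto simp: c_def)
    show "nrm X \<rho> (B (c - r) \<gamma> \<rho> k) \<le> M \<gamma> / (\<gamma> - \<rho>) * nrm X \<gamma> k"
      if "low X < \<rho>" "\<rho> < \<gamma>" "r \<in> {s..t}" "k \<in> spc X \<gamma>" for \<rho> \<gamma> r k
      using that s0 by (intro B_bound) (auto simp: c_def)
    show "s \<in> {s..t}" using t by simp
  qed
  have "lf t \<in> extensional (spc X \<alpha>)" using dual t by (simp add: dual_def)
  then show ?thesis using eq
    by (intro extensionalityI[of _ "spc X \<alpha>"]) (auto simp: adj_def c_def)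
qed

lemma generator_in:
  assumes "0 \<le> r" "low X < \<beta>" "\<beta> < \<gamma>" "k \<in> spc X \<gamma>"
  shows "A r \<gamma> \<beta> k + B r \<gamma> \<beta> k \<in> spc X \<beta>"
  by (intro spc_add scale_ops_in[OF _ assms(2-4)] assms(2) A0[rule_format] B0[rule_format] assms(1))

text \<open>
  The left end of the window may be any point of \<open>D\<close>; the window between it and \<open>t\<close> yields the increments over
  all intervals inside.
\<close>

lemma forward_derivative:
  assumes V: "condA2 X V" "condA3 X A V" "condA4 X K V" and W: "perturbed_forward X K M V B W"
    and \<beta>: "\<alpha>' < \<beta>" "\<beta> < \<alpha>" and k: "k \<in> spc X \<alpha>"
  shows "continuously_differentiable_on
    {s. 0 \<le> s \<and> ereal (t - s) < min (Tmax K M \<alpha>' \<alpha>) (Tmax K M \<alpha>' \<beta>) \<and> s \<le> t}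
    (\<lambda>s. adj X \<alpha> (W t s \<alpha> \<alpha>') l k) (\<lambda>s. - adj X \<beta> (W t s \<beta> \<alpha>') l (A s \<alpha> \<beta> k + B s \<alpha> \<beta> k))"
    (is "continuously_differentiable_on ?D ?F ?f'")
proof (rule continuously_differentiable_on_of_increments)
  have K: "1 \<le> K" using V(3) by (simp add: condA4_def)
  have lo: "low X < \<beta>" using low0 \<beta> by simp
  show "is_interval ?D"
    unfolding is_interval_1
    by (auto intro: le_less_trans[of "ereal (t - _)" "ereal (t - _)"])
  fix x y assume xy: "x \<in> ?D" "y \<in> ?D" "x \<le> y"
  then have x0: "0 \<le> x" and xt: "x \<le> t" by auto
  interpret P: perturbed_dual_cauchy X A B V x t \<alpha>' l "\<lambda>s \<gamma>. W t s \<gamma> \<alpha>'" "admissible K (t - x)"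
    by (rule perturbed_dual_cauchy_forward[OF V(1,2) K W x0 xt])
  have g: "\<beta> \<in> admissible K (t - x)" "\<alpha> \<in> admissible K (t - x)" using xy \<beta> by (auto simp: admissible_def)
  let ?g = "\<lambda>u. l (W t u \<beta> \<alpha>' (A u \<alpha> \<beta> k + B u \<alpha> \<beta> k))"
  have eq: "?f' u = - ?g u" if "u \<in> {x..y}" for u
    using generator_in[OF _ lo \<beta>(2) k, of u] that x0 by (simp add: adj_def)
  have yt: "y \<le> t" using xy by auto
  note gen = P.generator_equation[OF g \<beta>(2) k order.refl xy(3) yt]
  have "continuous_on {x..y} (\<lambda>u. - ?g u)" by (intro continuous_on_minus gen(1))
  then have "continuous_on {x..y} ?f'" by (rule continuous_on_eq) (simp add: eq)
  moreover have "integral {x..y} ?f' = - integral {x..y} ?g"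
    unfolding integral_neg[symmetric] by (rule integral_cong[OF eq])
  moreover have "?F y - ?F x = - (l (W t x \<alpha> \<alpha>' k) - l (W t y \<alpha> \<alpha>' k))" using k by (simp add: adj_def)
  ultimately show "continuous_on {x..y} ?f' \<and> ?F y - ?F x = integral {x..y} ?f'"
    unfolding gen(2) by simp
qed

text \<open>
  An increment over \<open>[x,y]\<close> comes from the window \<open>[s,y]\<close>, whose reversal maps \<open>[x,y]\<close> to \<open>[s, s + y - x]\<close>.
\<close>

lemma backward_derivative:
  assumes V: "condA2 X (\<lambda>t s. V s t)" "condA3_bwd X A V" "condA4 X K (\<lambda>t s. V s t)"
    and W: "perturbed_backward X K M V B W"
    and s0: "0 \<le> s" and \<beta>: "\<alpha>' < \<beta>" "\<beta> < \<alpha>" and k: "k \<in> spc X \<alpha>"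
  shows "continuously_differentiable_on
    {t. s \<le> t \<and> ereal (t - s) < min (Tmax K M \<alpha>' \<alpha>) (Tmax K M \<alpha>' \<beta>)}
    (\<lambda>t. adj X \<alpha> (W s t \<alpha> \<alpha>') l k) (\<lambda>t. adj X \<beta> (W s t \<beta> \<alpha>') l (A t \<alpha> \<beta> k + B t \<alpha> \<beta> k))"
    (is "continuously_differentiable_on ?D ?F ?f'")
proof (rule continuously_differentiable_on_of_increments)
  have K: "1 \<le> K" using V(3) by (simp add: condA4_def)
  have lo: "low X < \<beta>" using low0 \<beta> by simp
  show "is_interval ?D"
    unfolding is_interval_1
    by (auto intro: le_less_trans[of "ereal (_ - s)" "ereal (_ - s)"])
  fix x y assume xy: "x \<in> ?D" "y \<in> ?D" "x \<le> y"
  then have sx: "s \<le> x" and sy: "s \<le> y" by auto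
  define c where "c = s + y"
  interpret P: perturbed_dual_cauchy X "\<lambda>r. A (c - r)" "\<lambda>r. B (c - r)" "\<lambda>t s. V (c - t) (c - s)" s y \<alpha>' l
      "\<lambda>r \<gamma>. W s (c - r) \<gamma> \<alpha>'" "admissible K (y - s)"
    by (rule perturbed_dual_cauchy_backward[OF V(1,2) K W s0 sy c_def])
  have g: "\<beta> \<in> admissible K (y - s)" "\<alpha> \<in> admissible K (y - s)" using xy \<beta> by (auto simp: admissible_def)
  let ?g = "\<lambda>u. l (W s u \<beta> \<alpha>' (A u \<alpha> \<beta> k + B u \<alpha> \<beta> k))"
  have eq: "?f' u = ?g u" if "u \<in> {x..y}" for u
    using generator_in[OF _ lo \<beta>(2) k, of u] that s0 sx by (simp add: adj_def)
  have sc: "s \<le> c - x" "c - x \<le> y" using xy(3) sx by (auto simp: c_def)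
  note gen = P.generator_equation[OF g \<beta>(2) k order.refl sc]
  have "continuous_on {x..y} (\<lambda>u. (\<lambda>u. ?g (c - u)) (c - u))"
    by (rule continuous_on_compose2[OF gen(1)]) (auto simp: c_def intro!: continuous_intros)
  then have gc: "continuous_on {x..y} ?g" by simp
  then have "continuous_on {x..y} ?f'" by (rule continuous_on_eq) (simp add: eq)
  moreover have "integral {x..y} ?f' = integral {s..c - x} (\<lambda>u. ?g (c - u))"
  proof -
    from has_integral_reflect_about[OF integrable_integral[OF integrable_continuous_real[OF gc]], of c]
    have "integral {s..c - x} (\<lambda>u. ?g (c - u)) = integral {x..y} ?g"
      by (simp add: c_def integral_unique)
    moreover have "integral {x..y} ?f' = integral {x..y} ?g" by (rule integral_cong[OF eq])
    ultimately show ?thesis by simp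
  qed
  ultimately show "continuous_on {x..y} ?f' \<and> ?F y - ?F x = integral {x..y} ?f'"
    using gen(2) k by (simp add: adj_def c_def)
qed

end

theorem theorem3p17:
  fixes X :: "('k::{real_normed_field,banach}, 'a::ab_group_add) scale_data"
    and A B :: "real \<Rightarrow> real \<Rightarrow> real \<Rightarrow> 'a \<Rightarrow> 'a"
    and M :: "real \<Rightarrow> real"
    and Y :: "'a set"
    and \<alpha>' \<alpha> :: real
    and l :: "'a \<Rightarrow> 'k"
  assumes "banach_scale X"
    and "\<forall>t\<ge>0. A t \<in> scale_ops X" and "condA1 X A"
    and "\<forall>t\<ge>0. B t \<in> scale_ops X" and "condB1 X B" and "condB2 X M B"
    and "Y \<subseteq> (\<Inter>\<beta>\<in>{low X<..}. spc X \<beta>)"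
    and "\<forall>\<beta>>low X. stop X \<beta> closure_of Y = spc X \<beta>"
    and "low X < \<alpha>'" and "\<alpha>' < \<alpha>"
    and "l \<in> dual X \<alpha>'"
  shows
    "(\<forall>V W K t. 0 < t \<and> condA2 X V \<and> condA3 X A V \<and> condA4 X K V \<and> perturbed_forward X K M V B W \<longrightarrow>
        (\<forall>T lf. 0 < T \<and> T \<le> t \<and>
           (\<forall>s\<in>{t - T..t}. lf s \<in> dual X \<alpha>) \<and>
           (\<forall>k\<in>spc X \<alpha>. continuous_on {t - T..t} (\<lambda>s. \<langle>k, lf s\<rangle>)) \<and>
           (\<forall>k\<in>Y. \<forall>\<alpha>''>\<alpha>. \<forall>s\<in>{t - T..t}.
              \<langle>k, lf s\<rangle> = \<langle>k, l\<rangle> + integral {s..t} (\<lambda>r. \<langle>A r \<alpha>'' \<alpha> k + B r \<alpha>'' \<alpha> k, lf r\<rangle>)) \<longrightarrow>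
           (\<forall>s. ereal t - min (ereal T) (Tmax K M \<alpha>' \<alpha>) < ereal s \<and> s \<le> t \<longrightarrow>
              lf s = adj X \<alpha> (W t s \<alpha> \<alpha>') l)) \<and>
        (\<forall>k\<in>spc X \<alpha>. \<forall>\<alpha>''. \<alpha>' < \<alpha>'' \<and> \<alpha>'' < \<alpha> \<longrightarrow>
           continuously_differentiable_on
             {s. 0 \<le> s \<and> ereal t - min (Tmax K M \<alpha>' \<alpha>) (Tmax K M \<alpha>' \<alpha>'') < ereal s \<and> s \<le> t}
             (\<lambda>s. \<langle>k, adj X \<alpha> (W t s \<alpha> \<alpha>') l\<rangle>)
             (\<lambda>s. - \<langle>A s \<alpha> \<alpha>'' k + B s \<alpha> \<alpha>'' k, adj X \<alpha>'' (W t s \<alpha>'' \<alpha>') l\<rangle>)))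
     \<and>
     (\<forall>V W K s. 0 \<le> s \<and> condA2 X (\<lambda>t s. V s t) \<and> condA3_bwd X A V \<and> condA4 X K (\<lambda>t s. V s t) \<and>
          perturbed_backward X K M V B W \<longrightarrow>
        (\<forall>T lf. 0 < T \<and>
           (\<forall>t\<in>{s..s + T}. lf t \<in> dual X \<alpha>) \<and>
           (\<forall>k\<in>spc X \<alpha>. continuous_on {s..s + T} (\<lambda>t. \<langle>k, lf t\<rangle>)) \<and>
           (\<forall>k\<in>Y. \<forall>\<alpha>''>\<alpha>. \<forall>t\<in>{s..s + T}.
              \<langle>k, lf t\<rangle> = \<langle>k, l\<rangle> + integral {s..t} (\<lambda>r. \<langle>A r \<alpha>'' \<alpha> k + B r \<alpha>'' \<alpha> k, lf r\<rangle>)) \<longrightarrow>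
           (\<forall>t. s \<le> t \<and> ereal t < ereal s + min (ereal T) (Tmax K M \<alpha>' \<alpha>) \<longrightarrow>
              lf t = adj X \<alpha> (W s t \<alpha> \<alpha>') l)) \<and>
        (\<forall>k\<in>spc X \<alpha>. \<forall>\<alpha>''. \<alpha>' < \<alpha>'' \<and> \<alpha>'' < \<alpha> \<longrightarrow>
           continuously_differentiable_on
             {t. s \<le> t \<and> ereal t < ereal s + min (Tmax K M \<alpha>' \<alpha>) (Tmax K M \<alpha>' \<alpha>'')}
             (\<lambda>t. \<langle>k, adj X \<alpha> (W s t \<alpha> \<alpha>') l\<rangle>)
             (\<lambda>t. \<langle>A t \<alpha> \<alpha>'' k + B t \<alpha> \<alpha>'' k, adj X \<alpha>'' (W s t \<alpha>'' \<alpha>') l\<rangle>)))"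
proof -
  interpret G: perturbed_generator X A B M \<alpha>' l
    by (intro perturbed_generator.intro banach_scale_space.intro perturbed_generator_axioms.intro) (fact assms)+
  have Y: "\<And>\<beta>. low X < \<beta> \<Longrightarrow> stop X \<beta> closure_of Y = spc X \<beta>" using assms(8) by blast
  have Tm: "Tmax K M \<alpha>' \<alpha> \<noteq> - \<infinity>" for K by (rule Tmax_not_MInf[OF assms(10)])
  have Tmin: "min (ereal T) (Tmax K M \<alpha>' \<alpha>) \<noteq> - \<infinity>" for K T using Tm[of K] by (simp add: min_def)
  have Tmin': "min (Tmax K M \<alpha>' \<alpha>) (Tmax K M \<alpha>' \<alpha>'') \<noteq> - \<infinity>" if "\<alpha>' < \<alpha>''" for K \<alpha>''
    using Tm[of K] Tmax_not_MInf[OF that, of K M] by (simp add: min_def)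
  show ?thesis
    unfolding pairing_def
  proof (intro conjI allI impI ballI)
    fix V W :: "real \<Rightarrow> real \<Rightarrow> real \<Rightarrow> real \<Rightarrow> 'a \<Rightarrow> 'a" and K t T s :: real and lf :: "real \<Rightarrow> 'a \<Rightarrow> 'k"
    assume V: "0 < t \<and> condA2 X V \<and> condA3 X A V \<and> condA4 X K V \<and> perturbed_forward X K M V B W"
      and lf: "0 < T \<and> T \<le> t \<and> (\<forall>s\<in>{t - T..t}. lf s \<in> dual X \<alpha>) \<and>
        (\<forall>k\<in>spc X \<alpha>. continuous_on {t - T..t} (\<lambda>s. lf s k)) \<and>
        (\<forall>k\<in>Y. \<forall>\<alpha>''>\<alpha>. \<forall>s\<in>{t - T..t}.
           lf s k = l k + integral {s..t} (\<lambda>r. lf r (A r \<alpha>'' \<alpha> k + B r \<alpha>'' \<alpha> k)))"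
      and s: "ereal t - min (ereal T) (Tmax K M \<alpha>' \<alpha>) < ereal s \<and> s \<le> t"
    have s': "t - T \<le> s" "s \<le> t" "ereal (t - s) < Tmax K M \<alpha>' \<alpha>"
      using s unfolding ereal_minus_less_iff[OF Tmin] by auto
    show "lf s = adj X \<alpha> (W t s \<alpha> \<alpha>') l"
      by (rule G.forward_uniqueness[OF _ _ _ _ assms(7) Y assms(10) _ _ _ _ s']) (use V lf in blast)+
  next
    fix V W :: "real \<Rightarrow> real \<Rightarrow> real \<Rightarrow> real \<Rightarrow> 'a \<Rightarrow> 'a" and K t :: real and k \<alpha>''
    assume V: "0 < t \<and> condA2 X V \<and> condA3 X A V \<and> condA4 X K V \<and> perturbed_forward X K M V B W"
      and k: "k \<in> spc X \<alpha>" and \<alpha>'': "\<alpha>' < \<alpha>'' \<and> \<alpha>'' < \<alpha>"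
    show "continuously_differentiable_on
        {s. 0 \<le> s \<and> ereal t - min (Tmax K M \<alpha>' \<alpha>) (Tmax K M \<alpha>' \<alpha>'') < ereal s \<and> s \<le> t}
        (\<lambda>s. adj X \<alpha> (W t s \<alpha> \<alpha>') l k)
        (\<lambda>s. - adj X \<alpha>'' (W t s \<alpha>'' \<alpha>') l (A s \<alpha> \<alpha>'' k + B s \<alpha> \<alpha>'' k))"
      unfolding ereal_minus_less_iff[OF Tmin'[OF conjunct1[OF \<alpha>'']]]
      by (rule G.forward_derivative[OF _ _ _ _ _ _ k]) (use V \<alpha>'' in blast)+
  next
    fix V W :: "real \<Rightarrow> real \<Rightarrow> real \<Rightarrow> real \<Rightarrow> 'a \<Rightarrow> 'a" and K s T t :: real and lf :: "real \<Rightarrow> 'a \<Rightarrow> 'k"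
    assume V: "0 \<le> s \<and> condA2 X (\<lambda>t s. V s t) \<and> condA3_bwd X A V \<and> condA4 X K (\<lambda>t s. V s t) \<and>
        perturbed_backward X K M V B W"
      and lf: "0 < T \<and> (\<forall>t\<in>{s..s + T}. lf t \<in> dual X \<alpha>) \<and>
        (\<forall>k\<in>spc X \<alpha>. continuous_on {s..s + T} (\<lambda>t. lf t k)) \<and>
        (\<forall>k\<in>Y. \<forall>\<alpha>''>\<alpha>. \<forall>t\<in>{s..s + T}.
           lf t k = l k + integral {s..t} (\<lambda>r. lf r (A r \<alpha>'' \<alpha> k + B r \<alpha>'' \<alpha> k)))"
      and t: "s \<le> t \<and> ereal t < ereal s + min (ereal T) (Tmax K M \<alpha>' \<alpha>)"
    have t': "t \<le> s + T" "s \<le> t" "ereal (t - s) < Tmax K M \<alpha>' \<alpha>"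
      using t unfolding ereal_less_add_iff[OF Tmin] by auto
    show "lf t = adj X \<alpha> (W s t \<alpha> \<alpha>') l"
      by (rule G.backward_uniqueness[where V = V, OF _ _ _ _ assms(7) Y assms(10) _ _ _ _ t']) (use V lf in blast)+
  next
    fix V W :: "real \<Rightarrow> real \<Rightarrow> real \<Rightarrow> real \<Rightarrow> 'a \<Rightarrow> 'a" and K s :: real and k \<alpha>''
    assume V: "0 \<le> s \<and> condA2 X (\<lambda>t s. V s t) \<and> condA3_bwd X A V \<and> condA4 X K (\<lambda>t s. V s t) \<and>
        perturbed_backward X K M V B W"
      and k: "k \<in> spc X \<alpha>" and \<alpha>'': "\<alpha>' < \<alpha>'' \<and> \<alpha>'' < \<alpha>"
    show "continuously_differentiable_on
        {t. s \<le> t \<and> ereal t < ereal s + min (Tmax K M \<alpha>' \<alpha>) (Tmax K M \<alpha>' \<alpha>'')}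
        (\<lambda>t. adj X \<alpha> (W s t \<alpha> \<alpha>') l k)
        (\<lambda>t. adj X \<alpha>'' (W s t \<alpha>'' \<alpha>') l (A t \<alpha> \<alpha>'' k + B t \<alpha> \<alpha>'' k))"
      unfolding ereal_less_add_iff[OF Tmin'[OF conjunct1[OF \<alpha>'']]]
      by (rule G.backward_derivative[where V = V, OF _ _ _ _ _ _ _ k]) (use V \<alpha>'' in blast)+
  qed
qed

end
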